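(* Suppose that $f,g\in C^2[0,1)$ are positive, increasing and strictly convex with $\lim_{v\to1^-}f(v)=\lim_{u\to1^-}g(u)=+\infty$, and that $u_0,v_0\in C^2(\bar\Omega)$ satisfy $0\le u_0,v_0<1$ and $u_0=v_0=0$ on $\partial\Omega$. Let $(\lambda,\mu)\in\mathcal{O}_1$, let $(w_{\lambda,\mu},z_{\lambda,\mu})$ be the minimal solution of (E), and suppose that one of the following two cases holds: (i) $(u_0,v_0)\le(w_{\lambda,\mu},z_{\lambda,\mu})$; (ii) (E) has a solution $(w_1,z_1)$ different from $(w_{\lambda,\mu},z_{\lambda,\mu})$ and $(u_0,v_0)\le\not\equiv(w_1,z_1)$. If the space dimension satisfies $1\le N\le3$, then the (global) solution $(u,v)$ of (P) satisfies $$\|u(x,t)-w_{\lambda,\mu}(x)\|_2^2+\|v(x,t)-z_{\lambda,\mu}(x)\|_2^2\le C_0\exp\left(-\min\left\{2\lambda_1,\frac{\nu_1}{2}\right\}t\right),\qquad t>T_0,$$ for some $T_0>0$, where $C_0$ is a constant depending at most on $u_0,v_0,w_{\lambda,\mu},z_{\lambda,\mu},w_1,z_1,\varphi_1,\psi_1$. Here $\lambda_1>0$ is the first eigenvalue of $-\Delta$ on $H_0^1(\Omega)$, $\nu_1>0$ is the first eigenvalue of the linearized elliptic system $$-\Delta\varphi-\lambda\alpha(x)f'(z_{\lambda,\mu})\psi=\nu\varphi\ \text{ in }\Omega,\quad -\Delta\psi-\mu\beta(x)g'(w_{\lambda,\mu})\varphi=\nu\psi\ \text{ in }\Omega,\quad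 \varphi=\psi=0\ \text{ on }\partial\Omega,$$ and $(\varphi_1,\psi_1)$ is the corresponding strictly positive eigenfunction.
   Context: $\Omega\subset\mathbb{R}^N$ is a smooth bounded domain; $\lambda,\mu>0$; $\alpha,\beta$ are nonnegative, nontrivial (not identically zero), Hölder continuous functions on $\bar\Omega$. Problem (P) is $$u_t-\Delta u=\lambda\alpha(x)f(v),\quad v_t-\Delta v=\mu\beta(x)g(u)\quad\text{in }\Omega\times(0,T),$$ $$u=v=0\ \text{ on }\partial\Omega\times(0,T),\qquad u(x,0)=u_0(x),\ v(x,0)=v_0(x)\ \text{ in }\Omega,$$ and problem (E) is $$-\Delta w=\lambda\alpha(x)f(z),\quad -\Delta z=\mu\beta(x)g(w)\ \text{ in }\Omega,\qquad w=z=0\ \text{ on }\partial\Omega.$$ Solutions of (E) are classical, with $0\le w,z<1$; the minimal solution is the solution which is $\le$ every other solution. In cases (i) and (ii) the solution of (P) exists globally in time. Let $\Lambda$ be the set of $(\lambda,\mu)\in\mathbb{R}^+\times\mathbb{R}^+$ for which (E) has a classical minimal solution. The critical curve $\mu=\Gamma(\lambda)$ is the non-increasing continuous curve, connecting $(0,\mu^* )$ to $(\lambda^*,0)$ for some $0<\lambda^*,\mu^*<\infty$, such that $(\lambda,\mu)\in\Lambda$ if $\mu<\Gamma(\lambda)$ and $(\lambda,\mu)\in(\mathbb{R}^+\times\mathbb{R}^+)\setminus\bar\Lambda$ if $\mu>\Gamma(\lambda)$; put $\mathcal{O}_1=\Lambda\setminus\Gamma$. The linearized system has a first eigenvalue $\nu_1>0$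 with a smooth eigenfunction pair $(\varphi_1,\psi_1)$ satisfying $\varphi_1>0$, $\psi_1>0$ in $\Omega$. $(u,v)\le(w,z)$ means $u\le w$ and $v\le z$; $(u,v)\le\not\equiv(w,z)$ means $(u,v)\le(w,z)$ and $(u,v)\not\equiv(w,z)$. $\|\cdot\|_p$ is the $L^p(\Omega)$ norm. *)

theory Defs
  imports "HOL-Analysis.Analysis"
begin

section \<open>Differential calculus\<close>

definition partial_deriv :: "'a::euclidean_space \<Rightarrow> ('a \<Rightarrow> real) \<Rightarrow> 'a \<Rightarrow> real" where
  "partial_deriv b F x = frechet_derivative F (at x) b"

definition gradient :: "('a::euclidean_space \<Rightarrow> real) \<Rightarrow> 'a \<Rightarrow> 'a" where
  "gradient F x = (\<Sum>b\<in>Basis. partial_deriv b F x *\<^sub>R b)"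

definition laplacian :: "('a::euclidean_space \<Rightarrow> real) \<Rightarrow> 'a \<Rightarrow> real" where
  "laplacian F x = (\<Sum>b\<in>Basis. partial_deriv b (partial_deriv b F) x)"

text \<open>The class \<open>C\<^sup>k(S)\<close> for an \<^emph>\<open>open\<close> set \<open>S\<close>.\<close>

primrec Ck_on :: "nat \<Rightarrow> 'a::euclidean_space set \<Rightarrow> ('a \<Rightarrow> real) \<Rightarrow> bool" where
  "Ck_on 0 S F \<longleftrightarrow> continuous_on S F"
| "Ck_on (Suc k) S F \<longleftrightarrow> F differentiable_on S \<and> (\<forall>b\<in>Basis. Ck_on k S (partial_deriv b F))"

text \<open>The class \<open>C\<^sup>k\<close> on the closure of an open set \<open>S\<close>: every partial derivative of order at most
  \<open>k\<close> exists on \<open>S\<close> and extends continuously to \<open>closure S\<close>. The function \<open>G\<close> is this extension.\<close>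

primrec Ck_closure :: "nat \<Rightarrow> 'a::euclidean_space set \<Rightarrow> ('a \<Rightarrow> real) \<Rightarrow> bool" where
  "Ck_closure 0 S F \<longleftrightarrow> continuous_on (closure S) F"
| "Ck_closure (Suc k) S F \<longleftrightarrow>
     continuous_on (closure S) F \<and> F differentiable_on S \<and>
     (\<forall>b\<in>Basis. \<exists>G. (\<forall>x\<in>S. G x = partial_deriv b F x) \<and> Ck_closure k S G)"

text \<open>Bounded domains whose boundary is locally the regular zero set of a smooth function, with the
  domain lying on one side of it.\<close>

definition smooth_bounded_domain :: "'a::euclidean_space set \<Rightarrow> bool" where
  "smooth_bounded_domain \<Omega> \<longleftrightarrow>
     open \<Omega> \<and> connected \<Omega> \<and> \<Omega> \<noteq> {} \<and> bounded \<Omega> \<and>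
     (\<forall>p\<in>frontier \<Omega>. \<exists>r>0. \<exists>\<rho>.
        (\<forall>k. Ck_on k (ball p r) \<rho>) \<and> (\<forall>x\<in>ball p r. gradient \<rho> x \<noteq> 0) \<and>
        \<Omega> \<inter> ball p r = {x\<in>ball p r. \<rho> x < 0})"

definition hoelder_continuous_on :: "'a::euclidean_space set \<Rightarrow> ('a \<Rightarrow> real) \<Rightarrow> bool" where
  "hoelder_continuous_on S F \<longleftrightarrow>
     (\<exists>\<gamma> C. 0 < \<gamma> \<and> \<gamma> \<le> 1 \<and> (\<forall>x\<in>S. \<forall>y\<in>S. \<bar>F x - F y\<bar> \<le> C * dist x y powr \<gamma>))"

section \<open>The data of the problem\<close>

text \<open>The derivative of a function on \<open>[0,1)\<close>, one-sided at \<open>0\<close>.\<close>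

definition deriv01 :: "(real \<Rightarrow> real) \<Rightarrow> real \<Rightarrow> real" where
  "deriv01 f s = vector_derivative f (at s within {0..<1})"

definition C2_01 :: "(real \<Rightarrow> real) \<Rightarrow> bool" where
  "C2_01 f \<longleftrightarrow> f differentiable_on {0..<1} \<and> deriv01 f differentiable_on {0..<1} \<and>
     continuous_on {0..<1} (deriv01 (deriv01 f))"

definition strictly_convex_on :: "real set \<Rightarrow> (real \<Rightarrow> real) \<Rightarrow> bool" where
  "strictly_convex_on S f \<longleftrightarrow> convex S \<and>
     (\<forall>x\<in>S. \<forall>y\<in>S. \<forall>t. x \<noteq> y \<and> 0 < t \<and> t < 1 \<longrightarrow>
        f ((1 - t) * x + t * y) < (1 - t) * f x + t * f y)"

definition nonlinearity :: "(real \<Rightarrow> real) \<Rightarrow> bool" where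
  "nonlinearity f \<longleftrightarrow> C2_01 f \<and> (\<forall>s\<in>{0..<1}. 0 < f s) \<and> strict_mono_on {0..<1} f \<and>
     strictly_convex_on {0..<1} f \<and> filterlim f at_top (at_left 1)"

definition weight :: "'a::euclidean_space set \<Rightarrow> ('a \<Rightarrow> real) \<Rightarrow> bool" where
  "weight \<Omega> \<alpha> \<longleftrightarrow> hoelder_continuous_on (closure \<Omega>) \<alpha> \<and>
     (\<forall>x\<in>closure \<Omega>. 0 \<le> \<alpha> x) \<and> (\<exists>x\<in>closure \<Omega>. \<alpha> x \<noteq> 0)"

definition initial_datum :: "'a::euclidean_space set \<Rightarrow> ('a \<Rightarrow> real) \<Rightarrow> bool" where
  "initial_datum \<Omega> u0 \<longleftrightarrow> Ck_closure 2 \<Omega> u0 \<and>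
     (\<forall>x\<in>closure \<Omega>. 0 \<le> u0 x \<and> u0 x < 1) \<and> (\<forall>x\<in>frontier \<Omega>. u0 x = 0)"

definition pair_le :: "'a set \<Rightarrow> ('a \<Rightarrow> real) \<Rightarrow> ('a \<Rightarrow> real) \<Rightarrow> ('a \<Rightarrow> real) \<Rightarrow> ('a \<Rightarrow> real) \<Rightarrow> bool" where
  "pair_le \<Omega> u v w z \<longleftrightarrow> (\<forall>x\<in>\<Omega>. u x \<le> w x \<and> v x \<le> z x)"

definition pair_eq :: "'a set \<Rightarrow> ('a \<Rightarrow> real) \<Rightarrow> ('a \<Rightarrow> real) \<Rightarrow> ('a \<Rightarrow> real) \<Rightarrow> ('a \<Rightarrow> real) \<Rightarrow> bool" where
  "pair_eq \<Omega> u v w z \<longleftrightarrow> (\<forall>x\<in>\<Omega>. u x = w x \<and> v x = z x)"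

section \<open>The elliptic problem\<close>

definition solution_E ::
  "'a::euclidean_space set \<Rightarrow> (real \<Rightarrow> real) \<Rightarrow> (real \<Rightarrow> real) \<Rightarrow> ('a \<Rightarrow> real) \<Rightarrow> ('a \<Rightarrow> real) \<Rightarrow>
   real \<Rightarrow> real \<Rightarrow> ('a \<Rightarrow> real) \<Rightarrow> ('a \<Rightarrow> real) \<Rightarrow> bool" where
  "solution_E \<Omega> f g \<alpha> \<beta> lam \<mu> w z \<longleftrightarrow>
     Ck_on 2 \<Omega> w \<and> Ck_on 2 \<Omega> z \<and> continuous_on (closure \<Omega>) w \<and> continuous_on (closure \<Omega>) z \<and>
     (\<forall>x\<in>closure \<Omega>. 0 \<le> w x \<and> w x < 1 \<and> 0 \<le> z x \<and> z x < 1) \<and>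
     (\<forall>x\<in>\<Omega>. - laplacian w x = lam * \<alpha> x * f (z x) \<and> - laplacian z x = \<mu> * \<beta> x * g (w x)) \<and>
     (\<forall>x\<in>frontier \<Omega>. w x = 0 \<and> z x = 0)"

definition minimal_solution_E ::
  "'a::euclidean_space set \<Rightarrow> (real \<Rightarrow> real) \<Rightarrow> (real \<Rightarrow> real) \<Rightarrow> ('a \<Rightarrow> real) \<Rightarrow> ('a \<Rightarrow> real) \<Rightarrow>
   real \<Rightarrow> real \<Rightarrow> ('a \<Rightarrow> real) \<Rightarrow> ('a \<Rightarrow> real) \<Rightarrow> bool" where
  "minimal_solution_E \<Omega> f g \<alpha> \<beta> lam \<mu> w z \<longleftrightarrow> solution_E \<Omega> f g \<alpha> \<beta> lam \<mu> w z \<and>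
     (\<forall>w' z'. solution_E \<Omega> f g \<alpha> \<beta> lam \<mu> w' z' \<longrightarrow> pair_le \<Omega> w z w' z')"

definition Lambda_set ::
  "'a::euclidean_space set \<Rightarrow> (real \<Rightarrow> real) \<Rightarrow> (real \<Rightarrow> real) \<Rightarrow> ('a \<Rightarrow> real) \<Rightarrow> ('a \<Rightarrow> real) \<Rightarrow>
   (real \<times> real) set" where
  "Lambda_set \<Omega> f g \<alpha> \<beta> =
     {(lam, \<mu>). 0 < lam \<and> 0 < \<mu> \<and> (\<exists>w z. minimal_solution_E \<Omega> f g \<alpha> \<beta> lam \<mu> w z)}"

text \<open>\<open>\<mu> = \<Gamma>(lam)\<close>, \<open>0 \<le> lam \<le> ls\<close>, is the critical curve of the parameter set \<open>L\<close>, connecting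
  \<open>(0, ms)\<close> to \<open>(ls, 0)\<close>. Points with \<open>lam > ls\<close>, where the curve has ended, lie above it.\<close>

definition critical_curve :: "(real \<times> real) set \<Rightarrow> (real \<Rightarrow> real) \<Rightarrow> real \<Rightarrow> real \<Rightarrow> bool" where
  "critical_curve L \<Gamma> ls ms \<longleftrightarrow>
     0 < ls \<and> 0 < ms \<and> continuous_on {0..ls} \<Gamma> \<and> antimono_on {0..ls} \<Gamma> \<and> \<Gamma> 0 = ms \<and> \<Gamma> ls = 0 \<and>
     (\<forall>lam>0. \<forall>\<mu>>0. (lam \<le> ls \<and> \<mu> < \<Gamma> lam \<longrightarrow> (lam, \<mu>) \<in> L) \<and>
                     (ls < lam \<or> \<Gamma> lam < \<mu> \<longrightarrow> (lam, \<mu>) \<notin> closure L))"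

definition O1_set :: "(real \<times> real) set \<Rightarrow> (real \<Rightarrow> real) \<Rightarrow> real \<Rightarrow> (real \<times> real) set" where
  "O1_set L \<Gamma> ls = L - (\<lambda>lam. (lam, \<Gamma> lam)) ` {0..ls}"

section \<open>The parabolic problem\<close>

text \<open>The class \<open>C\<^sup>2\<^sup>,\<^sup>1\<close> on \<open>\<Omega> \<times> (0,T)\<close>: continuous \<open>u\<^sub>t\<close> and continuous spatial derivatives up to
  order two, jointly in \<open>(x,t)\<close>.\<close>

definition C21_on :: "'a::euclidean_space set \<Rightarrow> real \<Rightarrow> ('a \<Rightarrow> real \<Rightarrow> real) \<Rightarrow> bool" where
  "C21_on \<Omega> T u \<longleftrightarrow>
     (\<forall>x\<in>\<Omega>. u x differentiable_on {0<..<T}) \<and>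
     (\<forall>t\<in>{0<..<T}. Ck_on 2 \<Omega> (\<lambda>x. u x t)) \<and>
     continuous_on (\<Omega> \<times> {0<..<T}) (\<lambda>(x, t). deriv (u x) t) \<and>
     (\<forall>b\<in>Basis. continuous_on (\<Omega> \<times> {0<..<T}) (\<lambda>(x, t). partial_deriv b (\<lambda>y. u y t) x)) \<and>
     (\<forall>b\<in>Basis. \<forall>c\<in>Basis. continuous_on (\<Omega> \<times> {0<..<T})
        (\<lambda>(x, t). partial_deriv c (partial_deriv b (\<lambda>y. u y t)) x))"

definition solution_P ::
  "'a::euclidean_space set \<Rightarrow> (real \<Rightarrow> real) \<Rightarrow> (real \<Rightarrow> real) \<Rightarrow> ('a \<Rightarrow> real) \<Rightarrow> ('a \<Rightarrow> real) \<Rightarrow>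
   real \<Rightarrow> real \<Rightarrow> ('a \<Rightarrow> real) \<Rightarrow> ('a \<Rightarrow> real) \<Rightarrow> real \<Rightarrow> ('a \<Rightarrow> real \<Rightarrow> real) \<Rightarrow> ('a \<Rightarrow> real \<Rightarrow> real) \<Rightarrow> bool" where
  "solution_P \<Omega> f g \<alpha> \<beta> lam \<mu> u0 v0 T u v \<longleftrightarrow>
     C21_on \<Omega> T u \<and> C21_on \<Omega> T v \<and>
     continuous_on (closure \<Omega> \<times> {0..<T}) (\<lambda>(x, t). u x t) \<and>
     continuous_on (closure \<Omega> \<times> {0..<T}) (\<lambda>(x, t). v x t) \<and>
     (\<forall>x\<in>closure \<Omega>. \<forall>t\<in>{0..<T}. 0 \<le> u x t \<and> u x t < 1 \<and> 0 \<le> v x t \<and> v x t < 1) \<and>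
     (\<forall>x\<in>\<Omega>. \<forall>t\<in>{0<..<T}.
        deriv (u x) t - laplacian (\<lambda>y. u y t) x = lam * \<alpha> x * f (v x t) \<and>
        deriv (v x) t - laplacian (\<lambda>y. v y t) x = \<mu> * \<beta> x * g (u x t)) \<and>
     (\<forall>x\<in>frontier \<Omega>. \<forall>t\<in>{0<..<T}. u x t = 0 \<and> v x t = 0) \<and>
     (\<forall>x\<in>\<Omega>. u x 0 = u0 x \<and> v x 0 = v0 x)"

definition global_solution_P ::
  "'a::euclidean_space set \<Rightarrow> (real \<Rightarrow> real) \<Rightarrow> (real \<Rightarrow> real) \<Rightarrow> ('a \<Rightarrow> real) \<Rightarrow> ('a \<Rightarrow> real) \<Rightarrow>
   real \<Rightarrow> real \<Rightarrow> ('a \<Rightarrow> real) \<Rightarrow> ('a \<Rightarrow> real) \<Rightarrow> ('a \<Rightarrow> real \<Rightarrow> real) \<Rightarrow> ('a \<Rightarrow> real \<Rightarrow> real) \<Rightarrow> bool" where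
  "global_solution_P \<Omega> f g \<alpha> \<beta> lam \<mu> u0 v0 u v \<longleftrightarrow>
     (\<forall>T>0. solution_P \<Omega> f g \<alpha> \<beta> lam \<mu> u0 v0 T u v)"

definition L2_norm :: "'a::euclidean_space set \<Rightarrow> ('a \<Rightarrow> real) \<Rightarrow> real" where
  "L2_norm \<Omega> F = sqrt (\<integral>x. \<bar>F x\<bar>\<^sup>2 \<partial>lebesgue_on \<Omega>)"

section \<open>Eigenvalues\<close>

definition test_function :: "'a::euclidean_space set \<Rightarrow> ('a \<Rightarrow> real) \<Rightarrow> bool" where
  "test_function \<Omega> \<phi> \<longleftrightarrow> (\<forall>k. Ck_on k UNIV \<phi>) \<and>
     compact (closure {x. \<phi> x \<noteq> 0}) \<and> closure {x. \<phi> x \<noteq> 0} \<subseteq> \<Omega>"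

text \<open>\<open>H10 \<Omega> u G\<close>: the function \<open>u\<close> belongs to \<open>H\<^sub>0\<^sup>1(\<Omega>)\<close>, the closure of the test functions in
  \<open>H\<^sup>1(\<Omega>)\<close>, and \<open>G\<close> is its weak gradient.\<close>

definition H10 :: "'a::euclidean_space set \<Rightarrow> ('a \<Rightarrow> real) \<Rightarrow> ('a \<Rightarrow> 'a) \<Rightarrow> bool" where
  "H10 \<Omega> u G \<longleftrightarrow>
     u \<in> borel_measurable (lebesgue_on \<Omega>) \<and> integrable (lebesgue_on \<Omega>) (\<lambda>x. (u x)\<^sup>2) \<and>
     G \<in> borel_measurable (lebesgue_on \<Omega>) \<and> integrable (lebesgue_on \<Omega>) (\<lambda>x. (norm (G x))\<^sup>2) \<and>
     (\<exists>\<phi>. (\<forall>n. test_function \<Omega> (\<phi> n)) \<and>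
       (\<lambda>n. \<integral>x. (\<phi> n x - u x)\<^sup>2 \<partial>lebesgue_on \<Omega>) \<longlonglongrightarrow> 0 \<and>
       (\<lambda>n. \<integral>x. (norm (gradient (\<phi> n) x - G x))\<^sup>2 \<partial>lebesgue_on \<Omega>) \<longlonglongrightarrow> 0)"

definition dirichlet_eigenvalue :: "'a::euclidean_space set \<Rightarrow> real \<Rightarrow> bool" where
  "dirichlet_eigenvalue \<Omega> e \<longleftrightarrow>
     (\<exists>u G. H10 \<Omega> u G \<and> \<not> (AE x in lebesgue_on \<Omega>. u x = 0) \<and>
       (\<forall>v H. H10 \<Omega> v H \<longrightarrow>
          (\<integral>x. G x \<bullet> H x \<partial>lebesgue_on \<Omega>) = e * (\<integral>x. u x * v x \<partial>lebesgue_on \<Omega>)))"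

definition first_dirichlet_eigenvalue :: "'a::euclidean_space set \<Rightarrow> real \<Rightarrow> bool" where
  "first_dirichlet_eigenvalue \<Omega> e \<longleftrightarrow>
     dirichlet_eigenvalue \<Omega> e \<and> (\<forall>e'. dirichlet_eigenvalue \<Omega> e' \<longrightarrow> e \<le> e')"

definition linearized_eigenpair ::
  "'a::euclidean_space set \<Rightarrow> (real \<Rightarrow> real) \<Rightarrow> (real \<Rightarrow> real) \<Rightarrow> ('a \<Rightarrow> real) \<Rightarrow> ('a \<Rightarrow> real) \<Rightarrow>
   real \<Rightarrow> real \<Rightarrow> ('a \<Rightarrow> real) \<Rightarrow> ('a \<Rightarrow> real) \<Rightarrow> real \<Rightarrow> ('a \<Rightarrow> real) \<Rightarrow> ('a \<Rightarrow> real) \<Rightarrow> bool" where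
  "linearized_eigenpair \<Omega> f g \<alpha> \<beta> lam \<mu> w z \<nu> \<phi> \<psi> \<longleftrightarrow>
     Ck_on 2 \<Omega> \<phi> \<and> Ck_on 2 \<Omega> \<psi> \<and> continuous_on (closure \<Omega>) \<phi> \<and> continuous_on (closure \<Omega>) \<psi> \<and>
     (\<forall>x\<in>\<Omega>. - laplacian \<phi> x - lam * \<alpha> x * deriv01 f (z x) * \<psi> x = \<nu> * \<phi> x \<and>
             - laplacian \<psi> x - \<mu> * \<beta> x * deriv01 g (w x) * \<phi> x = \<nu> * \<psi> x) \<and>
     (\<forall>x\<in>frontier \<Omega>. \<phi> x = 0 \<and> \<psi> x = 0) \<and>
     (\<exists>x\<in>\<Omega>. \<phi> x \<noteq> 0 \<or> \<psi> x \<noteq> 0)"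

text \<open>The linearized system is not self-adjoint in general. Its first eigenvalue is the least real
  one; being cooperative, the system has no complex eigenvalue of smaller real part.\<close>

definition first_linearized_eigenvalue ::
  "'a::euclidean_space set \<Rightarrow> (real \<Rightarrow> real) \<Rightarrow> (real \<Rightarrow> real) \<Rightarrow> ('a \<Rightarrow> real) \<Rightarrow> ('a \<Rightarrow> real) \<Rightarrow>
   real \<Rightarrow> real \<Rightarrow> ('a \<Rightarrow> real) \<Rightarrow> ('a \<Rightarrow> real) \<Rightarrow> real \<Rightarrow> bool" where
  "first_linearized_eigenvalue \<Omega> f g \<alpha> \<beta> lam \<mu> w z \<nu> \<longleftrightarrow>
     (\<exists>\<phi> \<psi>. linearized_eigenpair \<Omega> f g \<alpha> \<beta> lam \<mu> w z \<nu> \<phi> \<psi>) \<and>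
     (\<forall>\<nu>' \<phi> \<psi>. linearized_eigenpair \<Omega> f g \<alpha> \<beta> lam \<mu> w z \<nu>' \<phi> \<psi> \<longrightarrow> \<nu> \<le> \<nu>')"

end

theory Submission
  imports Defs
begin

text \<open>Linearizing \<open>(E)\<close> at the minimal solution \<open>(w, z)\<close> gives decay of \<open>(u - w, v - z)\<close> at every rate
  below \<open>\<nu>1\<close>, whereas the claim asks only for \<open>\<nu>1 / 4\<close> in \<open>L\<^sup>2\<close>. Since \<open>T\<^sub>0\<close> may depend on everything,
  \<open>C\<^sub>0 = 1\<close> suffices. The decay follows from maximum principles alone. Adding to \<open>(\<phi>1, \<psi>1)\<close> a small
  multiple of a function \<open>H \<ge> 1\<close> with \<open>- \<Delta>H \<ge> M H\<close> near the boundary, \<open>M\<close> large, yields \<open>(\<Phi>, \<Psi>)\<close>,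
  bounded below by a positive constant, which is a strict supersolution of the linearized system with rate
  \<open>\<nu> < \<nu>1\<close>; this replaces Hopf's lemma throughout. By convexity of \<open>f\<close> and \<open>g\<close>, \<open>(w - u, z - v)\<close> is a
  subsolution of the linearized system, so it decays like \<open>exp (- \<nu> t)\<close>. For the bound from above, case (i)
  is comparison with \<open>(w, z)\<close>. In case (ii) the strong maximum principle puts \<open>(u, v)\<close> strictly below
  \<open>(w1, z1)\<close> at time 1, and strict convexity makes \<open>w + s(t) (w1 - w) + \<tau>(t) \<Phi>\<close>, and likewise for \<open>z\<close>,
  a supersolution, first with \<open>s\<close> decreasing from a value below 1 to 0 and \<open>\<tau>\<close> constant, then with
  \<open>s = 0\<close> and \<open>\<tau>\<close> decaying exponentially.\<close>

section \<open>Laplacians in the touching sense\<close>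

text \<open>The stationary solutions, the eigenfunctions and \<open>u\<close>, \<open>v\<close> all
  vanish on the boundary, so comparing \<open>w1 - u\<close> with a multiple of
  \<open>\<phi>1\<close> there would rest on normal derivatives. A supersolution with a positive
  lower bound makes every boundary inequality strict, and compactness does the rest. The price is
  that \<open>H\<close> is a truncated minimum of chart functions and not C^2: Laplacians become
  one-sided, and comparison works by excluding a first contact.

  In case (ii) the convexity gain along the segment from \<open>w\<close> to \<open>w1\<close> is of
  order \<open>s * (1 - s)\<close> and vanishes at both ends. Near \<open>s = 0\<close> the spectral
  margin \<open>\<nu> * \<Phi>\<close> pays instead. At \<open>s = 1\<close> nothing does,
  \<open>w1\<close> being stationary itself; so \<open>s\<close> starts below 1 and
  \<open>\<tau>\<close> is limited to a multiple of \<open>1 - s\<close>.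

  Rates: \<open>\<nu> = 3 / 4 * \<nu>1\<close> leaves room to build \<open>\<Phi>\<close>; half of
  \<open>\<nu>\<close> is spent on moving \<open>s\<close> and on the convexity error, so the
  pointwise rate is \<open>3 / 8 * \<nu>1\<close>. Squaring doubles it to
  \<open>3 / 4 * \<nu>1\<close>, and the surplus over \<open>\<nu>1 / 2\<close> swallows all
  constants for large times.\<close>

definition d2_at :: "(real \<Rightarrow> real) \<Rightarrow> real \<Rightarrow> real \<Rightarrow> bool" where
  "d2_at \<phi> a l \<longleftrightarrow> (\<exists>\<phi>'. (\<forall>\<^sub>F s in nhds 0. (\<phi> has_real_derivative \<phi>' s) (at s)) \<and>
     \<phi>' 0 = a \<and> (\<phi>' has_real_derivative l) (at 0))"

text \<open>Only restrictions to coordinate lines are differentiated, since a maximum along each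
  line already controls each second derivative. A relation instead of a value lets explicit
  functions and sums be handled without checking that they are C^2.\<close>

definition has_lap :: "('a::euclidean_space \<Rightarrow> real) \<Rightarrow> 'a \<Rightarrow> real \<Rightarrow> bool" where
  "has_lap F x l \<longleftrightarrow>
     (\<exists>h. (\<forall>b\<in>Basis. \<exists>a. d2_at (\<lambda>s. F (x + s *\<^sub>R b)) a (h b)) \<and> l = sum h Basis)"

text \<open>Second-order test functions touching \<open>F\<close> from above, as for viscosity supersolutions: this class of
  functions is stable under minima.\<close>

definition upper_lap :: "('a::euclidean_space \<Rightarrow> real) \<Rightarrow> 'a \<Rightarrow> real \<Rightarrow> bool" where
  "upper_lap F x l \<longleftrightarrow> (\<exists>h. h x = F x \<and> (\<forall>\<^sub>F y in nhds x. F y \<le> h y) \<and> has_lap h x l)"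

section \<open>Rules for second derivatives on a line\<close>

lemma d2_at_const: "d2_at (\<lambda>s. c) 0 0"
  unfolding d2_at_def by (intro exI[of _ "\<lambda>s. 0"]) auto

lemma d2_at_add:
  assumes "d2_at \<phi> a l" "d2_at \<psi> b m"
  shows "d2_at (\<lambda>s. \<phi> s + \<psi> s) (a + b) (l + m)"
proof -
  obtain \<phi>' where p: "\<forall>\<^sub>F s in nhds 0. (\<phi> has_real_derivative \<phi>' s) (at s)" "\<phi>' 0 = a"
    "(\<phi>' has_real_derivative l) (at 0)" using assms(1) unfolding d2_at_def by blast
  obtain \<psi>' where q: "\<forall>\<^sub>F s in nhds 0. (\<psi> has_real_derivative \<psi>' s) (at s)" "\<psi>' 0 = b"
    "(\<psi>' has_real_derivative m) (at 0)" using assms(2) unfolding d2_at_def by blast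
  have "\<forall>\<^sub>F s in nhds 0. ((\<lambda>s. \<phi> s + \<psi> s) has_real_derivative \<phi>' s + \<psi>' s) (at s)"
    using p(1) q(1) by eventually_elim (auto intro: DERIV_add)
  moreover have "((\<lambda>s. \<phi>' s + \<psi>' s) has_real_derivative l + m) (at 0)"
    using p q by (auto intro: DERIV_add)
  ultimately show ?thesis unfolding d2_at_def using p(2) q(2)
    by (intro exI[of _ "\<lambda>s. \<phi>' s + \<psi>' s"]) simp
qed

lemma d2_at_cmult:
  assumes "d2_at \<phi> a l"
  shows "d2_at (\<lambda>s. c * \<phi> s) (c * a) (c * l)"
proof -
  obtain \<phi>' where p: "\<forall>\<^sub>F s in nhds 0. (\<phi> has_real_derivative \<phi>' s) (at s)" "\<phi>' 0 = a"
    "(\<phi>' has_real_derivative l) (at 0)" using assms(1) unfolding d2_at_def by blast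
  have "\<forall>\<^sub>F s in nhds 0. ((\<lambda>s. c * \<phi> s) has_real_derivative c * \<phi>' s) (at s)"
    using p(1) by eventually_elim (auto intro: DERIV_cmult)
  moreover have "((\<lambda>s. c * \<phi>' s) has_real_derivative c * l) (at 0)"
    using p by (auto intro: DERIV_cmult)
  ultimately show ?thesis unfolding d2_at_def using p(2)
    by (intro exI[of _ "\<lambda>s. c * \<phi>' s"]) simp
qed

lemma d2_at_exp:
  assumes "d2_at \<phi> a l"
  shows "d2_at (\<lambda>s. exp (\<phi> s)) (exp (\<phi> 0) * a) (exp (\<phi> 0) * (l + a\<^sup>2))"
proof -
  obtain \<phi>' where p: "\<forall>\<^sub>F s in nhds 0. (\<phi> has_real_derivative \<phi>' s) (at s)" "\<phi>' 0 = a"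
    "(\<phi>' has_real_derivative l) (at 0)" using assms(1) unfolding d2_at_def by blast
  have p0: "(\<phi> has_real_derivative a) (at 0)" using eventually_nhds_x_imp_x[OF p(1)] p(2) by simp
  have "\<forall>\<^sub>F s in nhds 0. ((\<lambda>s. exp (\<phi> s)) has_real_derivative exp (\<phi> s) * \<phi>' s) (at s)"
    using p(1) by eventually_elim (auto intro!: derivative_eq_intros)
  moreover have "((\<lambda>s. exp (\<phi> s) * \<phi>' s) has_real_derivative exp (\<phi> 0) * (l + a\<^sup>2)) (at 0)"
    using p p0 by (auto intro!: derivative_eq_intros simp: power2_eq_square algebra_simps)
  ultimately show ?thesis unfolding d2_at_def using p(2)
    by (intro exI[of _ "\<lambda>s. exp (\<phi> s) * \<phi>' s"]) simp
qed

text \<open>With \<open>l > 0\<close> the first derivative, which is zero at the maximum, would be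
  positive just to the right of 0, and \<open>\<phi>\<close> would increase there.\<close>

lemma d2_at_local_max:
  assumes "d2_at \<phi> a l" and mx: "\<forall>\<^sub>F s in nhds 0. \<phi> s \<le> \<phi> 0"
  shows "l \<le> 0"
proof (rule ccontr)
  assume "\<not> l \<le> 0"
  obtain \<phi>' where p: "\<forall>\<^sub>F s in nhds 0. (\<phi> has_real_derivative \<phi>' s) (at s)" "\<phi>' 0 = a"
    "(\<phi>' has_real_derivative l) (at 0)" using assms(1) unfolding d2_at_def by blast
  obtain d where d: "0 < d" "\<And>s. \<bar>s\<bar> < d \<Longrightarrow> (\<phi> has_real_derivative \<phi>' s) (at s) \<and> \<phi> s \<le> \<phi> 0"
    using eventually_conj[OF p(1) mx] unfolding eventually_nhds_metric by (auto simp: dist_real_def)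
  have a0: "\<phi>' 0 = 0"
    using DERIV_local_max[of \<phi> "\<phi>' 0" 0 d] d by auto
  obtain e where e: "0 < e" "\<And>h. 0 < h \<Longrightarrow> h < e \<Longrightarrow> \<phi>' 0 < \<phi>' (0 + h)"
    using DERIV_pos_inc_right[OF p(3)] \<open>\<not> l \<le> 0\<close> by auto
  define r where "r = min d e / 2"
  have r: "0 < r" "r < d" "r < e" using d e by (auto simp: r_def)
  have "\<phi> 0 < \<phi> r"
  proof (rule DERIV_pos_imp_increasing_open[OF r(1)])
    show "\<And>x. 0 < x \<Longrightarrow> x < r \<Longrightarrow> \<exists>y. (\<phi> has_real_derivative y) (at x) \<and> 0 < y"
      using d e r a0 by (metis abs_of_pos add_0 less_trans)
    show "continuous_on {0..r} \<phi>"
    proof (intro continuous_at_imp_continuous_on ballI)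
      fix y assume "y \<in> {0..r}"
      then have "(\<phi> has_real_derivative \<phi>' y) (at y)" using d r by auto
      then show "isCont \<phi> y" by (rule DERIV_isCont)
    qed
  qed
  then show False using d(2)[of r] r by auto
qed

lemma eventually_nhds_line:
  fixes x :: "'a::real_normed_vector"
  assumes "\<forall>\<^sub>F y in nhds x. P y"
  shows "\<forall>\<^sub>F s::real in nhds 0. P (x + s *\<^sub>R b)"
proof -
  have "((\<lambda>s::real. x + s *\<^sub>R b) \<longlongrightarrow> x + 0 *\<^sub>R b) (nhds 0)"
    by (intro tendsto_intros filterlim_ident)
  then have "filterlim (\<lambda>s::real. x + s *\<^sub>R b) (nhds x) (nhds 0)" by simp
  then show ?thesis using assms by (simp add: filterlim_iff)
qed

section \<open>Laplacians of C^2 functions, polynomials in the distance, and exponentials\<close>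

lemma Ck_on_2_D:
  assumes "Ck_on 2 S F"
  shows "F differentiable_on S" "b \<in> Basis \<Longrightarrow> partial_deriv b F differentiable_on S"
    "b \<in> Basis \<Longrightarrow> continuous_on S (partial_deriv b (partial_deriv b F))"
  using assms by (auto simp: numeral_2_eq_2)

lemma d2_at_slice:
  assumes F: "Ck_on 2 S F" and "open S" "x \<in> S" and b: "b \<in> Basis"
  shows "d2_at (\<lambda>s. F (x + s *\<^sub>R b)) (partial_deriv b F x) (partial_deriv b (partial_deriv b F) x)"
proof -
  have D: "((\<lambda>s. G (x + s *\<^sub>R b)) has_real_derivative partial_deriv b G (x + s *\<^sub>R b)) (at s)"
    if "G differentiable at (x + s *\<^sub>R b)" for G :: "'a \<Rightarrow> real" and s
  proof -
    have G: "(G has_derivative frechet_derivative G (at (x + s *\<^sub>R b))) (at (x + s *\<^sub>R b))"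
      using that by (simp add: frechet_derivative_works)
    have "((\<lambda>s. x + s *\<^sub>R b) has_derivative (\<lambda>h. h *\<^sub>R b)) (at s)"
      by (auto intro!: derivative_eq_intros)
    from diff_chain_at[OF this G]
    have "((\<lambda>s. G (x + s *\<^sub>R b)) has_derivative
        (\<lambda>h. frechet_derivative G (at (x + s *\<^sub>R b)) (h *\<^sub>R b))) (at s)"
      by (simp add: o_def)
    then show ?thesis
      using linear_cmul[OF linear_frechet_derivative[OF that]]
      by (simp add: has_field_derivative_def partial_deriv_def mult_commute_abs)
  qed
  have dF: "\<And>y. y \<in> S \<Longrightarrow> F differentiable at y"
    using Ck_on_2_D(1)[OF F] \<open>open S\<close> by (simp add: differentiable_on_eq_differentiable_at)
  have dF2: "\<And>y. y \<in> S \<Longrightarrow> partial_deriv b F differentiable at y"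
    using Ck_on_2_D(2)[OF F b] \<open>open S\<close> by (simp add: differentiable_on_eq_differentiable_at)
  have "\<forall>\<^sub>F y in nhds x. y \<in> S" using assms eventually_nhds_in_open by blast
  from eventually_nhds_line[OF this, of b]
  have "\<forall>\<^sub>F s in nhds 0. ((\<lambda>s. F (x + s *\<^sub>R b)) has_real_derivative partial_deriv b F (x + s *\<^sub>R b)) (at s)"
    by eventually_elim (use D dF in auto)
  moreover have "((\<lambda>s. partial_deriv b F (x + s *\<^sub>R b)) has_real_derivative
       partial_deriv b (partial_deriv b F) x) (at 0)"
    using D[of "partial_deriv b F" 0] dF2 \<open>x \<in> S\<close> by simp
  ultimately show ?thesis unfolding d2_at_def
    by (intro exI[of _ "\<lambda>s. partial_deriv b F (x + s *\<^sub>R b)"]) auto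
qed

lemma has_lap_C2:
  assumes "Ck_on 2 S F" and "open S" "x \<in> S"
  shows "has_lap F x (laplacian F x)"
  unfolding has_lap_def laplacian_def
  by (intro exI[of _ "\<lambda>b. partial_deriv b (partial_deriv b F) x"]) (auto intro: d2_at_slice[OF assms])

lemma has_lap_const: "has_lap (\<lambda>y. c) x 0"
  unfolding has_lap_def using d2_at_const by (intro exI[of _ "\<lambda>b. 0"]) auto

lemma has_lap_add:
  assumes "has_lap F x l" "has_lap G x m"
  shows "has_lap (\<lambda>y. F y + G y) x (l + m)"
proof -
  obtain h where h: "\<forall>b\<in>Basis. \<exists>a. d2_at (\<lambda>s. F (x + s *\<^sub>R b)) a (h b)" "l = sum h Basis"
    using assms(1) unfolding has_lap_def by blast
  obtain k where k: "\<forall>b\<in>Basis. \<exists>a. d2_at (\<lambda>s. G (x + s *\<^sub>R b)) a (k b)" "m = sum k Basis"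
    using assms(2) unfolding has_lap_def by blast
  have "\<forall>b\<in>Basis. \<exists>a. d2_at (\<lambda>s. F (x + s *\<^sub>R b) + G (x + s *\<^sub>R b)) a (h b + k b)"
    using h(1) k(1) d2_at_add by metis
  then show ?thesis unfolding has_lap_def
    by (intro exI[of _ "\<lambda>b. h b + k b"]) (auto simp: h(2) k(2) sum.distrib)
qed

lemma has_lap_cmult:
  assumes "has_lap F x l"
  shows "has_lap (\<lambda>y. c * F y) x (c * l)"
proof -
  obtain h where h: "\<forall>b\<in>Basis. \<exists>a. d2_at (\<lambda>s. F (x + s *\<^sub>R b)) a (h b)" "l = sum h Basis"
    using assms(1) unfolding has_lap_def by blast
  have "\<forall>b\<in>Basis. \<exists>a. d2_at (\<lambda>s. c * F (x + s *\<^sub>R b)) a (c * h b)"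
    using h(1) d2_at_cmult by metis
  then show ?thesis unfolding has_lap_def
    by (intro exI[of _ "\<lambda>b. c * h b"]) (auto simp: h(2) sum_distrib_left)
qed

lemma has_lap_diff:
  assumes "has_lap F x l" "has_lap G x m"
  shows "has_lap (\<lambda>y. F y - G y) x (l - m)"
  using has_lap_add[OF assms(1) has_lap_cmult[OF assms(2), of "-1"]] by simp

lemma norm_power2_slice:
  fixes x p :: "'a::euclidean_space"
  assumes "b \<in> Basis"
  shows "(norm (x + s *\<^sub>R b - p))\<^sup>2 = (norm (x - p))\<^sup>2 + 2 * s * ((x - p) \<bullet> b) + s\<^sup>2"
proof -
  have "(norm (x + s *\<^sub>R b - p))\<^sup>2 = (norm ((x - p) + s *\<^sub>R b))\<^sup>2" by (simp add: algebra_simps)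
  also have "\<dots> = (norm (x - p))\<^sup>2 + 2 * s * ((x - p) \<bullet> b) + s\<^sup>2 * (b \<bullet> b)"
    unfolding power2_norm_eq_inner by (simp add: inner_add_left inner_add_right inner_commute power2_eq_square)
  finally show ?thesis using assms by (simp add: inner_Basis)
qed

lemma has_lap_dist2:
  fixes x p :: "'a::euclidean_space"
  shows "has_lap (\<lambda>y. (norm (y - p))\<^sup>2) x (2 * real DIM('a))"
proof -
  have "d2_at (\<lambda>s. (norm (x + s *\<^sub>R b - p))\<^sup>2) (2 * ((x - p) \<bullet> b)) 2" if b: "b \<in> Basis" for b
    unfolding d2_at_def norm_power2_slice[OF b]
    by (intro exI[of _ "\<lambda>s. 2 * ((x - p) \<bullet> b) + 2 * s"])
       (auto intro!: derivative_eq_intros always_eventually)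
  then show ?thesis unfolding has_lap_def
    by (intro exI[of _ "\<lambda>b. 2"]) auto
qed

text \<open>Where the bracket vanishes the Laplacian equals \<open>8 * c\<close>. Its positivity for
  \<open>c > 0\<close> is what makes the bump a subsolution of the heat equation near the edge of
  the ball in the strong maximum principle.\<close>

lemma has_lap_bump:
  fixes x p :: "'a::euclidean_space"
  shows "has_lap (\<lambda>y. (c - (norm (y - p))\<^sup>2)\<^sup>2) x
    (8 * (norm (x - p))\<^sup>2 - 4 * real DIM('a) * (c - (norm (x - p))\<^sup>2))"
proof -
  define q where "q b = (x - p) \<bullet> b" for b
  define n where "n = (norm (x - p))\<^sup>2"
  have "d2_at (\<lambda>s. (c - (norm (x + s *\<^sub>R b - p))\<^sup>2)\<^sup>2) (2 * (c - n) * (- 2 * q b)) (8 * (q b)\<^sup>2 - 4 * (c - n))"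
    if b: "b \<in> Basis" for b
    unfolding d2_at_def norm_power2_slice[OF b] q_def[symmetric] n_def[symmetric]
    by (intro exI[of _ "\<lambda>s. 2 * (c - (n + 2 * s * q b + s\<^sup>2)) * (- 2 * q b - 2 * s)"])
       (auto intro!: derivative_eq_intros always_eventually simp: power2_eq_square algebra_simps)
  moreover have "8 * n - 4 * real DIM('a) * (c - n) = (\<Sum>b\<in>Basis. 8 * (q b)\<^sup>2 - 4 * (c - n))"
  proof -
    have "n = (\<Sum>b\<in>Basis. (q b)\<^sup>2)"
      unfolding n_def q_def power2_norm_eq_inner by (subst euclidean_inner) (simp add: power2_eq_square)
    then show ?thesis by (simp add: sum_subtractf sum_distrib_left)
  qed
  ultimately show ?thesis unfolding has_lap_def n_def[symmetric]
    by (intro exI[of _ "\<lambda>b. 8 * (q b)\<^sup>2 - 4 * (c - n)"]) auto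
qed

text \<open>The term quadratic in \<open>k\<close> outweighs the Laplacian of \<open>F\<close> for
  large \<open>k\<close> wherever the gradient does not vanish; the boundary barrier rests on
  this.\<close>

lemma has_lap_exp_C2:
  fixes x :: "'a::euclidean_space"
  assumes "Ck_on 2 S F" and "open S" "x \<in> S"
  shows "has_lap (\<lambda>y. exp (k * F y)) x (exp (k * F x) * (k * laplacian F x + k\<^sup>2 * (norm (gradient F x))\<^sup>2))"
proof -
  have "(norm (gradient F x))\<^sup>2 = (\<Sum>b\<in>Basis. (gradient F x \<bullet> b)\<^sup>2)"
    unfolding power2_norm_eq_inner by (subst euclidean_inner) (simp add: power2_eq_square)
  also have "\<dots> = (\<Sum>b\<in>Basis. (partial_deriv b F x)\<^sup>2)"
    by (rule sum.cong) (auto simp: gradient_def)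
  finally have g: "(norm (gradient F x))\<^sup>2 = (\<Sum>b\<in>Basis. (partial_deriv b F x)\<^sup>2)" .
  show ?thesis unfolding has_lap_def
  proof (intro exI conjI ballI)
    fix b :: 'a assume b: "b \<in> Basis"
    show "d2_at (\<lambda>s. exp (k * F (x + s *\<^sub>R b))) (exp (k * F x) * (k * partial_deriv b F x))
       ((\<lambda>b. exp (k * F x) * (k * partial_deriv b (partial_deriv b F) x + (k * partial_deriv b F x)\<^sup>2)) b)"
      using d2_at_exp[OF d2_at_cmult[OF d2_at_slice[OF assms b]], of k] by simp
  qed (simp add: g laplacian_def sum_distrib_left sum.distrib power_mult_distrib distrib_left)
qed

section \<open>Local maxima and touching points\<close>

lemma has_lap_local_max:
  assumes "has_lap F x l" "\<forall>\<^sub>F y in nhds x. F y \<le> F x"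
  shows "l \<le> 0"
proof -
  obtain h where h: "\<forall>b\<in>Basis. \<exists>a. d2_at (\<lambda>s. F (x + s *\<^sub>R b)) a (h b)" "l = sum h Basis"
    using assms(1) unfolding has_lap_def by blast
  have "h b \<le> 0" if b: "b \<in> Basis" for b
  proof -
    obtain a where "d2_at (\<lambda>s. F (x + s *\<^sub>R b)) a (h b)" using h b by blast
    from d2_at_local_max[OF this] show ?thesis
      using eventually_nhds_line[OF assms(2), of b] by simp
  qed
  then show ?thesis by (simp add: h(2) sum_nonpos)
qed

lemma has_lap_imp_upper: "has_lap F x l \<Longrightarrow> upper_lap F x l"
  unfolding upper_lap_def by (intro exI[of _ F]) auto

lemma upper_lap_add_has_lap:
  assumes "has_lap F x l" "upper_lap G x m"
  shows "upper_lap (\<lambda>y. F y + G y) x (l + m)"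
proof -
  obtain h where h: "h x = G x" "\<forall>\<^sub>F y in nhds x. G y \<le> h y" "has_lap h x m"
    using assms(2) unfolding upper_lap_def by blast
  show ?thesis unfolding upper_lap_def
  proof (intro exI[of _ "\<lambda>y. F y + h y"] conjI)
    show "\<forall>\<^sub>F y in nhds x. F y + G y \<le> F y + h y" using h(2) by eventually_elim simp
  qed (use h has_lap_add[OF assms(1) h(3)] in auto)
qed

lemma upper_lap_cmult:
  assumes "upper_lap G x m" "0 \<le> c"
  shows "upper_lap (\<lambda>y. c * G y) x (c * m)"
proof -
  obtain h where h: "h x = G x" "\<forall>\<^sub>F y in nhds x. G y \<le> h y" "has_lap h x m"
    using assms(1) unfolding upper_lap_def by blast
  show ?thesis unfolding upper_lap_def
  proof (intro exI[of _ "\<lambda>y. c * h y"] conjI)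
    show "\<forall>\<^sub>F y in nhds x. c * G y \<le> c * h y" using h(2)
      by eventually_elim (simp add: assms(2) mult_left_mono)
  qed (use h has_lap_cmult[OF h(3)] in auto)
qed

text \<open>A test function above \<open>G\<close> also lies above a smaller \<open>F\<close> that
  agrees with \<open>G\<close> at \<open>x\<close>. With \<open>F\<close> a minimum and
  \<open>G\<close> the member attaining it at \<open>x\<close>, this is the stability under
  minima.\<close>

lemma upper_lap_mono:
  assumes "upper_lap G x m" "F x = G x" "\<forall>\<^sub>F y in nhds x. F y \<le> G y"
  shows "upper_lap F x m"
proof -
  obtain h where h: "h x = G x" "\<forall>\<^sub>F y in nhds x. G y \<le> h y" "has_lap h x m"
    using assms(1) unfolding upper_lap_def by blast
  have "\<forall>\<^sub>F y in nhds x. F y \<le> h y" using h(2) assms(3) by eventually_elim simp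
  then show ?thesis unfolding upper_lap_def using h assms(2) by auto
qed

text \<open>The test function \<open>h\<close> of \<open>G\<close> touches \<open>F\<close> from
  above as well, so \<open>F - h\<close> has a local maximum at \<open>x\<close>.\<close>

lemma touching_lap_le:
  assumes "has_lap F x l" "upper_lap G x m" "F x = G x" "\<forall>\<^sub>F y in nhds x. F y \<le> G y"
  shows "l \<le> m"
proof -
  obtain h where h: "h x = G x" "\<forall>\<^sub>F y in nhds x. G y \<le> h y" "has_lap h x m"
    using assms(2) unfolding upper_lap_def by blast
  have "\<forall>\<^sub>F y in nhds x. F y - h y \<le> F x - h x"
    using h(2) assms(4) by eventually_elim (simp add: h(1) assms(3))
  from has_lap_local_max[OF has_lap_diff[OF assms(1) h(3)] this] show ?thesis by simp
qed

section \<open>A barrier near the boundary\<close>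

text \<open>The barrier is \<open>2 - exp (\<kappa> \<rho>) + 16 \<bar>x - p\<bar>\<^sup>2 / r\<^sup>2\<close>, \<open>\<kappa>\<close> large, truncated at \<open>4\<close>. The quadratic term
  lifts it above \<open>4\<close> at distance \<open>r / 2\<close> from \<open>p\<close>, so that minima over several charts are still barriers.\<close>

lemma chart_barrier:
  fixes \<Omega> :: "'a::euclidean_space set"
  assumes "open \<Omega>" "bounded \<Omega>" "0 < r" "0 \<le> M"
    and \<rho>: "Ck_on 2 (ball p r) \<rho>" and nz: "\<And>x. x \<in> ball p r \<Longrightarrow> gradient \<rho> x \<noteq> 0"
    and dom: "\<Omega> \<inter> ball p r = {x\<in>ball p r. \<rho> x < 0}"
  shows "\<exists>k K C. continuous_on (closure \<Omega>) k \<and> compact K \<and> K \<subseteq> \<Omega> \<and> 0 \<le> C \<and>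
     (\<forall>x\<in>closure \<Omega>. 1 \<le> k x \<and> k x \<le> 4) \<and> (\<forall>x\<in>closure \<Omega> \<inter> ball p (r/4). k x < 4) \<and>
     (\<forall>x\<in>\<Omega>. \<exists>l. upper_lap k x l \<and> l \<le> C \<and> (k x < 4 \<and> x \<notin> K \<longrightarrow> l \<le> - M * k x))"
proof -
  have cb: "cball p (r/2) \<subseteq> ball p r" using \<open>0 < r\<close> by auto
  have cont_pd: "continuous_on (ball p r) (partial_deriv b \<rho>)" if "b \<in> Basis" for b
    using Ck_on_2_D(2)[OF \<rho> that] by (rule differentiable_imp_continuous_on)
  have cont_grad: "continuous_on (ball p r) (gradient \<rho>)"
    unfolding gradient_def[abs_def] by (intro continuous_intros cont_pd)
  have cont_lap: "continuous_on (ball p r) (laplacian \<rho>)"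
    unfolding laplacian_def[abs_def] by (intro continuous_intros Ck_on_2_D(3)[OF \<rho>])
  have cont_\<rho>: "continuous_on (ball p r) \<rho>"
    using Ck_on_2_D(1)[OF \<rho>] by (rule differentiable_imp_continuous_on)
  have ne: "cball p (r/2) \<noteq> {}" using \<open>0 < r\<close> by auto
  have "\<exists>x\<in>cball p (r/2). \<forall>y\<in>cball p (r/2). (norm (gradient \<rho> x))\<^sup>2 \<le> (norm (gradient \<rho> y))\<^sup>2"
    by (rule continuous_attains_inf[OF compact_cball ne])
       (intro continuous_intros continuous_on_subset[OF cont_grad cb])
  then obtain x0 where x0: "x0 \<in> cball p (r/2)"
    "\<And>y. y \<in> cball p (r/2) \<Longrightarrow> (norm (gradient \<rho> x0))\<^sup>2 \<le> (norm (gradient \<rho> y))\<^sup>2" by blast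
  define c where "c = (norm (gradient \<rho> x0))\<^sup>2"
  have c: "0 < c" using nz x0(1) cb by (auto simp: c_def)
  have "bounded (laplacian \<rho> ` cball p (r/2))"
    by (intro compact_imp_bounded compact_continuous_image continuous_on_subset[OF cont_lap cb]) auto
  then obtain L where L0: "\<And>y. y \<in> cball p (r/2) \<Longrightarrow> \<bar>laplacian \<rho> y\<bar> \<le> L"
    unfolding bounded_iff by (metis image_eqI real_norm_def)
  have L: "0 \<le> L" using L0[of p] \<open>0 < r\<close> by force
  \<comment> \<open>\<open>n\<close> is the Laplacian of the quadratic term, and
    \<open>4 * M\<close> bounds \<open>M * k\<close> because \<open>k \<le> 4\<close>. The factor 3
    in front of \<open>Q\<close> in \<open>\<kappa>\<close> compensates for
    \<open>exp (\<kappa> * \<rho>)\<close>, of which only the lower bound 1/3 is used off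
    \<open>K\<close>.\<close>
  define n where "n = 32 * real DIM('a) / r\<^sup>2"
  have n: "0 \<le> n" by (simp add: n_def)
  define Q where "Q = 4 * M + n"
  have Q: "0 \<le> Q" using n \<open>0 \<le> M\<close> by (simp add: Q_def)
  define \<kappa> where "\<kappa> = 1 + (L + 3 * Q) / c"
  have \<kappa>: "1 \<le> \<kappa>" using c L Q by (simp add: \<kappa>_def)
  have \<kappa>c: "L + 3 * Q \<le> \<kappa> * c" using c by (simp add: \<kappa>_def field_simps)
  define h where "h x = (2 - exp (\<kappa> * \<rho> x)) + 16 / r\<^sup>2 * (norm (x - p))\<^sup>2" for x
  define k where "k x = (if norm (x - p) \<le> r/2 then min 4 (h x) else 4)" for x
  \<comment> \<open>Within the half ball, points of the closure off \<open>K\<close> satisfy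
    \<open>- 1 < \<kappa> * \<rho> x\<close>, which bounds the exponential from below. On
    \<open>K\<close> the function \<open>\<rho>\<close> is negative by a fixed amount, so
    \<open>K\<close> cannot reach the boundary.\<close>
  define K where "K = {x \<in> cball p (r/2) \<inter> closure \<Omega>. \<rho> x \<le> - 1 / \<kappa>}"
  have \<rho>le: "\<rho> x \<le> 0" if x: "x \<in> closure \<Omega>" "x \<in> ball p r" for x
  proof -
    have "x \<in> closure (\<Omega> \<inter> ball p r)"
      using open_Int_closure_subset[of "ball p r" \<Omega>] x by (auto simp: Int_commute)
    moreover obtain X where X: "\<And>n. X n \<in> \<Omega> \<inter> ball p r" "X \<longlonglongrightarrow> x"
      using calculation closure_sequential by blast
    have "(\<lambda>n. \<rho> (X n)) \<longlonglongrightarrow> \<rho> x"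
      using cont_\<rho> x X by (auto intro: continuous_on_tendsto_compose)
    moreover have "\<And>n. \<rho> (X n) \<le> 0" using X(1) dom by (metis (mono_tags, lifting) less_imp_le mem_Collect_eq)
    ultimately show ?thesis using LIMSEQ_le_const2 by blast
  qed
  have hlow: "1 + 16 / r\<^sup>2 * (norm (x - p))\<^sup>2 \<le> h x" and hup: "h x < 2 + 16 / r\<^sup>2 * (norm (x - p))\<^sup>2"
    if "x \<in> closure \<Omega>" "x \<in> ball p r" for x
    using \<rho>le[OF that] \<kappa> by (auto simp: h_def mult_le_0_iff)
  have h1: "1 \<le> h x" if "x \<in> closure \<Omega>" "x \<in> ball p r" for x
    using hlow[OF that] by (smt (verit) zero_le_divide_iff zero_le_power2 mult_nonneg_nonneg)
  have h5: "4 < h x" if "x \<in> closure \<Omega>" "norm (x - p) = r/2" for x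
  proof -
    have "x \<in> ball p r" using that \<open>0 < r\<close> by (simp add: dist_norm norm_minus_commute)
    from hlow[OF that(1) this] show ?thesis
      using that(2) \<open>0 < r\<close> by (simp add: power_divide)
  qed
  have inball: "x \<in> ball p r" if "norm (x - p) \<le> r/2" for x
    using that \<open>0 < r\<close> by (simp add: dist_norm norm_minus_commute)
  have conth: "continuous_on (ball p r) h" unfolding h_def[abs_def]
    by (intro continuous_intros cont_\<rho>)
  have contk: "continuous_on (closure \<Omega>) k" unfolding k_def[abs_def]
  proof (rule continuous_on_cases_le)
    show "continuous_on {t \<in> closure \<Omega>. norm (t - p) \<le> r / 2} (\<lambda>x. min 4 (h x))"
      by (intro continuous_intros continuous_on_subset[OF conth]) (auto intro: inball)
    show "\<And>t. t \<in> closure \<Omega> \<Longrightarrow> norm (t - p) = r / 2 \<Longrightarrow> min 4 (h t) = 4"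
      using h5 by force
  qed (intro continuous_intros)+
  have "compact K"
  proof -
    have "K = (cball p (r/2) \<inter> closure \<Omega>) \<inter> \<rho> -` {.. - 1 / \<kappa>}" by (auto simp: K_def)
    moreover have "closed ((cball p (r/2) \<inter> closure \<Omega>) \<inter> \<rho> -` {.. - 1 / \<kappa>})"
      by (intro continuous_closed_preimage continuous_on_subset[OF cont_\<rho>]) (use cb in auto)
    moreover have "bounded K" by (rule bounded_subset[of "cball p (r/2)"]) (auto simp: K_def)
    ultimately show ?thesis by (simp add: compact_eq_bounded_closed)
  qed
  moreover have "K \<subseteq> \<Omega>"
  proof
    fix x assume "x \<in> K"
    then have "x \<in> ball p r" "\<rho> x \<le> - 1 / \<kappa>" using cb by (auto simp: K_def)
    moreover have "- 1 / \<kappa> < 0" using \<kappa> by simp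
    ultimately have "x \<in> ball p r" "\<rho> x < 0" by linarith+
    then show "x \<in> \<Omega>" using dom by blast
  qed
  moreover have "0 \<le> \<kappa> * L + n" using \<kappa> L n by simp
  moreover have "\<forall>x\<in>closure \<Omega>. 1 \<le> k x \<and> k x \<le> 4"
    using h1 inball by (auto simp: k_def)
  \<comment> \<open>Here the quadratic term is at most 1 and the rest of \<open>h\<close> is below
    2, so the truncation at 4 is inactive.\<close>
  moreover have "\<forall>x\<in>closure \<Omega> \<inter> ball p (r/4). k x < 4"
  proof
    fix x assume x: "x \<in> closure \<Omega> \<inter> ball p (r/4)"
    then have d: "norm (x - p) < r/4" by (simp add: dist_norm norm_minus_commute)
    then have "(norm (x - p))\<^sup>2 \<le> (r/4)\<^sup>2" by (intro power_mono) auto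
    then have "16 / r\<^sup>2 * (norm (x - p))\<^sup>2 \<le> 1" using \<open>0 < r\<close> by (simp add: field_simps power_divide)
    moreover have "x \<in> ball p r" using inball d \<open>0 < r\<close> by simp
    ultimately have "h x < 4" using hup[of x] x by force
    then show "k x < 4" using d \<open>0 < r\<close> by (simp add: k_def)
  qed
  moreover have "\<exists>l. upper_lap k x l \<and> l \<le> \<kappa> * L + n \<and> (k x < 4 \<and> x \<notin> K \<longrightarrow> l \<le> - M * k x)"
    if x: "x \<in> \<Omega>" for x
  proof (cases "k x < 4")
    case False
    have xc: "x \<in> closure \<Omega>" using x closure_subset by blast
    have "k x = 4" using False xc calculation by force
    moreover have "\<forall>\<^sub>F y in nhds x. k y \<le> 4"
      by (rule always_eventually) (simp add: k_def)
    \<comment> \<open>At the truncation level the constant 4 is itself a test function touching from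
      above.\<close>
    ultimately have "upper_lap k x 0"
      by (intro upper_lap_mono[OF has_lap_imp_upper[OF has_lap_const[of 4]]]) auto
    then show ?thesis using False \<open>0 \<le> \<kappa> * L + n\<close> by blast
  next
    case True
    have xc: "x \<in> closure \<Omega>" using x closure_subset by blast
    have le: "norm (x - p) \<le> r/2" using True by (auto simp: k_def split: if_splits)
    then have "norm (x - p) < r/2" using True h5[OF xc] by (force simp: k_def)
    then have xb: "x \<in> ball p (r/2)" by (simp add: dist_norm norm_minus_commute)
    have kh: "k x = h x" using True le by (auto simp: k_def)
    have ev: "\<forall>\<^sub>F y in nhds x. k y \<le> h y"
      using eventually_nhds_in_open[OF open_ball xb]
      by eventually_elim (auto simp: k_def dist_norm norm_minus_commute)
    have xb': "x \<in> ball p r" using xb \<open>0 < r\<close> by auto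
    define l where "l = (0 - exp (\<kappa> * \<rho> x) * (\<kappa> * laplacian \<rho> x + \<kappa>\<^sup>2 * (norm (gradient \<rho> x))\<^sup>2))
        + 16 / r\<^sup>2 * (2 * real DIM('a))"
    have "has_lap h x l"
      unfolding h_def[abs_def] l_def
      by (intro has_lap_add has_lap_diff has_lap_const has_lap_cmult has_lap_dist2
          has_lap_exp_C2[OF \<rho> open_ball xb'])
    then have ul: "upper_lap k x l"
      by (intro upper_lap_mono[OF has_lap_imp_upper]) (use kh ev in auto)
    have ln: "l = n - exp (\<kappa> * \<rho> x) * (\<kappa> * laplacian \<rho> x + \<kappa>\<^sup>2 * (norm (gradient \<rho> x))\<^sup>2)"
      by (simp add: l_def n_def)
    define E where "E = exp (\<kappa> * \<rho> x)"
    have E: "0 < E" "E \<le> 1" using \<rho>le[OF xc xb'] \<kappa> by (auto simp: E_def mult_le_0_iff)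
    have Lx: "\<bar>laplacian \<rho> x\<bar> \<le> L" and gx: "c \<le> (norm (gradient \<rho> x))\<^sup>2"
      using L0 x0(2) xb by (auto simp: c_def)
    have low: "\<kappa> * (\<kappa> * c - L) \<le> \<kappa> * laplacian \<rho> x + \<kappa>\<^sup>2 * (norm (gradient \<rho> x))\<^sup>2"
    proof -
      have "\<kappa> * (- L) \<le> \<kappa> * laplacian \<rho> x" using Lx \<kappa> by (intro mult_left_mono) auto
      moreover have "\<kappa>\<^sup>2 * c \<le> \<kappa>\<^sup>2 * (norm (gradient \<rho> x))\<^sup>2" using gx by (intro mult_left_mono) auto
      ultimately show ?thesis by (simp add: power2_eq_square algebra_simps)
    qed
    have low2: "3 * Q \<le> \<kappa> * (\<kappa> * c - L)"
    proof -
      have "1 * (3 * Q) \<le> \<kappa> * (\<kappa> * c - L)" using \<kappa> \<kappa>c Q by (intro mult_mono) auto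
      then show ?thesis by simp
    qed
    have lE: "l \<le> n - E * (3 * Q)"
      unfolding ln E_def[symmetric] using low low2 E by (simp add: mult_left_mono)
    have "l \<le> \<kappa> * L + n" using lE E Q \<kappa> L by (smt (verit) mult_nonneg_nonneg)
    moreover have "l \<le> - M * k x" if "x \<notin> K"
    proof -
      have "- 1 / \<kappa> < \<rho> x" using that xb xc by (auto simp: K_def)
      then have "- 1 < \<kappa> * \<rho> x" using \<kappa> by (simp add: field_simps)
      then have "exp (- 1) \<le> E" by (simp add: E_def)
      moreover have "1 / 3 \<le> exp (- 1::real)"
        using exp_le by (simp add: exp_minus field_simps)
      ultimately have "1 / 3 * (3 * Q) \<le> E * (3 * Q)" using Q by (intro mult_right_mono) auto
      then have "l \<le> - (4 * M)" using lE by (simp add: Q_def)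
      moreover have "M * k x \<le> M * 4" using True \<open>0 \<le> M\<close> by (intro mult_left_mono) auto
      ultimately show ?thesis by simp
    qed
    ultimately show ?thesis using ul by blast
  qed
  ultimately show ?thesis using contk by blast
qed

text \<open>Finitely many quarter balls of charts cover the frontier, and \<open>H\<close> is the
  minimum of their barriers. At each point \<open>H\<close> inherits the Laplacian bound of the
  barrier that attains the minimum. Every frontier point has some barrier below 4, so the truncation
  is never what counts there.\<close>

lemma boundary_barrier:
  fixes \<Omega> :: "'a::euclidean_space set"
  assumes \<Omega>: "smooth_bounded_domain \<Omega>" and M: "0 \<le> M"
  shows "\<exists>H K C. continuous_on (closure \<Omega>) H \<and> compact K \<and> K \<subseteq> \<Omega> \<and> 0 \<le> C \<and>
     (\<forall>x\<in>closure \<Omega>. 1 \<le> H x \<and> H x \<le> 4) \<and>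
     (\<forall>x\<in>\<Omega>. \<exists>l. upper_lap H x l \<and> l \<le> C \<and> (x \<notin> K \<longrightarrow> l \<le> - M * H x))"
proof -
  have op: "open \<Omega>" and bd: "bounded \<Omega>" using \<Omega> by (auto simp: smooth_bounded_domain_def)
  define chart where "chart p r \<longleftrightarrow> 0 < r \<and> (\<exists>\<rho>. Ck_on 2 (ball p r) \<rho> \<and>
      (\<forall>x\<in>ball p r. gradient \<rho> x \<noteq> 0) \<and> \<Omega> \<inter> ball p r = {x\<in>ball p r. \<rho> x < 0})" for p r
  have "\<exists>r. chart p r" if "p \<in> frontier \<Omega>" for p
  proof -
    obtain r \<rho> where "0 < r" "\<forall>k. Ck_on k (ball p r) \<rho>" "\<forall>x\<in>ball p r. gradient \<rho> x \<noteq> 0"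
      "\<Omega> \<inter> ball p r = {x\<in>ball p r. \<rho> x < 0}"
      using \<Omega> \<open>p \<in> frontier \<Omega>\<close> unfolding smooth_bounded_domain_def by blast
    then show ?thesis
      unfolding chart_def by (intro exI[of _ r] exI[of _ \<rho>] conjI) blast+
  qed
  then obtain r where r: "\<And>p. p \<in> frontier \<Omega> \<Longrightarrow> chart p (r p)" by metis
  have cf: "compact (frontier \<Omega>)" using bd by (rule compact_frontier_bounded)
  have cov: "frontier \<Omega> \<subseteq> (\<Union>p\<in>frontier \<Omega>. ball p (r p / 4))"
    using r unfolding chart_def by force
  obtain F where F: "F \<subseteq> frontier \<Omega>" "finite F" "frontier \<Omega> \<subseteq> (\<Union>p\<in>F. ball p (r p / 4))"
    using compactE_image[OF cf _ cov] by blast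
  have "\<exists>H K C. continuous_on (closure \<Omega>) H \<and> compact K \<and> K \<subseteq> \<Omega> \<and> 0 \<le> C \<and>
     (\<forall>x\<in>closure \<Omega>. 1 \<le> H x \<and> H x \<le> 4) \<and> (\<forall>p\<in>F. \<forall>x\<in>closure \<Omega> \<inter> ball p (r p/4). H x < 4) \<and>
     (\<forall>x\<in>\<Omega>. \<exists>l. upper_lap H x l \<and> l \<le> C \<and> (H x < 4 \<and> x \<notin> K \<longrightarrow> l \<le> - M * H x))"
    using F(2,1)
  proof (induction F rule: finite_induct)
    case empty
    show ?case
      by (rule exI[of _ "\<lambda>x. 4"], rule exI[of _ "{}"], rule exI[of _ 0])
         (auto intro: has_lap_imp_upper has_lap_const)
  next
    case (insert p F)
    obtain H K C where H: "continuous_on (closure \<Omega>) H" "compact K" "K \<subseteq> \<Omega>" "0 \<le> C"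
      "\<forall>x\<in>closure \<Omega>. 1 \<le> H x \<and> H x \<le> 4" "\<forall>p\<in>F. \<forall>x\<in>closure \<Omega> \<inter> ball p (r p/4). H x < 4"
      "\<forall>x\<in>\<Omega>. \<exists>l. upper_lap H x l \<and> l \<le> C \<and> (H x < 4 \<and> x \<notin> K \<longrightarrow> l \<le> - M * H x)"
      using insert.IH insert.prems by auto
    obtain \<rho> where p: "0 < r p" "Ck_on 2 (ball p (r p)) \<rho>" "\<And>x. x \<in> ball p (r p) \<Longrightarrow> gradient \<rho> x \<noteq> 0"
       "\<Omega> \<inter> ball p (r p) = {x\<in>ball p (r p). \<rho> x < 0}"
      using r[of p] insert.prems unfolding chart_def by auto
    obtain k K' C' where k: "continuous_on (closure \<Omega>) k" "compact K'" "K' \<subseteq> \<Omega>" "0 \<le> C'"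
      "\<forall>x\<in>closure \<Omega>. 1 \<le> k x \<and> k x \<le> 4" "\<forall>x\<in>closure \<Omega> \<inter> ball p (r p/4). k x < 4"
      "\<forall>x\<in>\<Omega>. \<exists>l. upper_lap k x l \<and> l \<le> C' \<and> (k x < 4 \<and> x \<notin> K' \<longrightarrow> l \<le> - M * k x)"
      using chart_barrier[OF op bd p(1) M p(2-4)] by auto
    have "\<exists>l. upper_lap (\<lambda>x. min (H x) (k x)) x l \<and> l \<le> max C C' \<and>
        (min (H x) (k x) < 4 \<and> x \<notin> K \<union> K' \<longrightarrow> l \<le> - M * min (H x) (k x))" if x: "x \<in> \<Omega>" for x
    proof (cases "H x \<le> k x")
      case True
      obtain l where l: "upper_lap H x l" "l \<le> C" "H x < 4 \<and> x \<notin> K \<longrightarrow> l \<le> - M * H x"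
        using H(7) x by blast
      have "upper_lap (\<lambda>x. min (H x) (k x)) x l"
        by (rule upper_lap_mono[OF l(1)]) (use True in auto)
      then show ?thesis using l True by (intro exI[of _ l]) auto
    next
      case False
      obtain l where l: "upper_lap k x l" "l \<le> C'" "k x < 4 \<and> x \<notin> K' \<longrightarrow> l \<le> - M * k x"
        using k(7) x by blast
      have "upper_lap (\<lambda>x. min (H x) (k x)) x l"
        by (rule upper_lap_mono[OF l(1)]) (use False in auto)
      then show ?thesis using l False by (intro exI[of _ l]) auto
    qed
    then show ?case
      using H k
      by (intro exI[of _ "\<lambda>x. min (H x) (k x)"] exI[of _ "K \<union> K'"] exI[of _ "max C C'"])
         (auto intro!: continuous_on_min simp: min_less_iff_disj)
  qed
  then obtain H K C where H: "continuous_on (closure \<Omega>) H" "compact K" "K \<subseteq> \<Omega>" "0 \<le> C"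
      "\<forall>x\<in>closure \<Omega>. 1 \<le> H x \<and> H x \<le> 4" "\<forall>p\<in>F. \<forall>x\<in>closure \<Omega> \<inter> ball p (r p/4). H x < 4"
      "\<forall>x\<in>\<Omega>. \<exists>l. upper_lap H x l \<and> l \<le> C \<and> (H x < 4 \<and> x \<notin> K \<longrightarrow> l \<le> - M * H x)" by blast
  \<comment> \<open>Where \<open>H = 4\<close> the Laplacian need not be negative. This set misses
    the frontier, hence is compact inside the domain, and can join the exceptional set.\<close>
  define K' where "K' = closure \<Omega> \<inter> H -` {4..}"
  have "closed K'" unfolding K'_def using H(1) by (intro continuous_closed_preimage) auto
  moreover have "bounded K'" unfolding K'_def using bd by (auto intro: bounded_subset bounded_closure)
  ultimately have "compact K'" by (simp add: compact_eq_bounded_closed)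
  moreover have "K' \<subseteq> \<Omega>"
  proof
    fix x assume x: "x \<in> K'"
    have "x \<notin> frontier \<Omega>" using x F(3) H(6) by (force simp: K'_def)
    then show "x \<in> \<Omega>" using x op by (auto simp: K'_def frontier_def interior_open)
  qed
  moreover have "\<exists>l. upper_lap H x l \<and> l \<le> C \<and> (x \<notin> K \<union> K' \<longrightarrow> l \<le> - M * H x)" if x: "x \<in> \<Omega>" for x
  proof -
    obtain l where "upper_lap H x l" "l \<le> C" "H x < 4 \<and> x \<notin> K \<longrightarrow> l \<le> - M * H x" using H x by blast
    moreover have "x \<in> closure \<Omega>" using x closure_subset by blast
    ultimately show ?thesis by (intro exI[of _ l]) (auto simp: K'_def)
  qed
  ultimately show ?thesis using H
    by (intro exI[of _ H] exI[of _ "K \<union> K'"] exI[of _ C]) auto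
qed

section \<open>Comparison for cooperative systems\<close>

text \<open>The heat operator applied to \<open>p\<close> is smaller than that applied to
  \<open>A\<close>, at one point. \<open>A\<close> has only a one-sided Laplacian, which need not be
  unique, so some admissible value is asked for.\<close>

definition strict_sub_at :: "('a::euclidean_space \<Rightarrow> real \<Rightarrow> real) \<Rightarrow> ('a \<Rightarrow> real \<Rightarrow> real) \<Rightarrow> 'a \<Rightarrow> real \<Rightarrow> bool" where
  "strict_sub_at p A x t \<longleftrightarrow> (\<exists>p' pl A' Al. (p x has_real_derivative p') (at t) \<and>
     (A x has_real_derivative A') (at t) \<and> has_lap (\<lambda>y. p y t) x pl \<and>
     upper_lap (\<lambda>y. A y t) x Al \<and> p' - pl < A' - Al)"

text \<open>At a first contact \<open>p - A\<close> has risen to 0 in time and has a spatial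
  maximum, so \<open>A' \<le> p'\<close> and \<open>pl \<le> Al\<close>, against the strict
  inequality. Only the past of \<open>t\<close> enters.\<close>

lemma no_first_touching:
  fixes \<Omega> :: "'a::euclidean_space set"
  assumes "open \<Omega>" "x \<in> \<Omega>" "a < t" "strict_sub_at p A x t" "p x t = A x t"
    and sp: "\<And>y. y \<in> \<Omega> \<Longrightarrow> p y t \<le> A y t" and tm: "\<And>s. a \<le> s \<Longrightarrow> s \<le> t \<Longrightarrow> p x s \<le> A x s"
  shows False
proof -
  obtain p' pl A' Al where d: "(p x has_real_derivative p') (at t)"
     "(A x has_real_derivative A') (at t)" "has_lap (\<lambda>y. p y t) x pl"
     "upper_lap (\<lambda>y. A y t) x Al" "p' - pl < A' - Al"
    using assms(4) unfolding strict_sub_at_def by blast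
  have "\<forall>\<^sub>F y in nhds x. p y t \<le> A y t"
    using eventually_nhds_in_open[OF assms(1,2)] by eventually_elim (rule sp)
  then have "pl \<le> Al" using touching_lap_le[OF d(3,4)] assms(5) by simp
  moreover have "A' \<le> p'"
  proof (rule ccontr)
    assume "\<not> A' \<le> p'"
    then obtain e where e: "0 < e" "\<And>h. 0 < h \<Longrightarrow> h < e \<Longrightarrow> p x t - A x t < p x (t - h) - A x (t - h)"
      using DERIV_neg_dec_left[OF DERIV_diff[OF d(1,2)]] by auto
    define h where "h = min e (t - a) / 2"
    have "0 < h" "h < e" "h \<le> t - a" using e(1) \<open>a < t\<close> by (auto simp: h_def)
    then show False using e(2)[of h] tm[of "t - h"] assms(5) by auto
  qed
  ultimately show False using d(5) by simp
qed

text \<open>If an inequality fails, there is an earliest time of failure in either component.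
  Cooperativity is encoded in \<open>P\<close> and \<open>Q\<close>: strictness at a contact of one
  component may presuppose the weak ordering of the other, which holds at that earliest
  time.\<close>

lemma system_comparison:
  fixes \<Omega> :: "'a::euclidean_space set"
  assumes "open \<Omega>" "bounded \<Omega>"
    and cp: "continuous_on (closure \<Omega> \<times> {a..b}) (\<lambda>(x, t). p x t)"
    and cA: "continuous_on (closure \<Omega> \<times> {a..b}) (\<lambda>(x, t). A x t)"
    and cq: "continuous_on (closure \<Omega> \<times> {a..b}) (\<lambda>(x, t). q x t)"
    and cB: "continuous_on (closure \<Omega> \<times> {a..b}) (\<lambda>(x, t). B x t)"
    and init: "\<And>x. x \<in> closure \<Omega> \<Longrightarrow> p x a < A x a \<and> q x a < B x a"
    and bdry: "\<And>x t. x \<in> frontier \<Omega> \<Longrightarrow> a < t \<Longrightarrow> t \<le> b \<Longrightarrow> p x t < A x t \<and> q x t < B x t"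
    and P: "\<And>x t. x \<in> \<Omega> \<Longrightarrow> a < t \<Longrightarrow> t \<le> b \<Longrightarrow> p x t = A x t \<Longrightarrow> q x t \<le> B x t \<Longrightarrow> strict_sub_at p A x t"
    and Q: "\<And>x t. x \<in> \<Omega> \<Longrightarrow> a < t \<Longrightarrow> t \<le> b \<Longrightarrow> q x t = B x t \<Longrightarrow> p x t \<le> A x t \<Longrightarrow> strict_sub_at q B x t"
    and xt: "x \<in> closure \<Omega>" "a \<le> t" "t \<le> b"
  shows "p x t < A x t \<and> q x t < B x t"
proof (rule ccontr)
  assume neg: "\<not> ?thesis"
  define X where "X = closure \<Omega> \<times> {a..b}"
  have X: "compact X" unfolding X_def using \<open>bounded \<Omega>\<close> by (intro compact_Times) auto
  have cl: "closed (X \<inter> h -` {0..})" if "continuous_on X h" for h :: "'a \<times> real \<Rightarrow> real"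
    using continuous_closed_preimage[OF that compact_imp_closed[OF X]] by simp
  have "closed (X \<inter> (\<lambda>(x, t). p x t - A x t) -` {0..})" "closed (X \<inter> (\<lambda>(x, t). q x t - B x t) -` {0..})"
    using cp cA cq cB unfolding X_def[symmetric] case_prod_unfold
    by (auto intro!: cl continuous_on_diff)
  then have "compact (X \<inter> ((X \<inter> (\<lambda>(x, t). p x t - A x t) -` {0..}) \<union> (X \<inter> (\<lambda>(x, t). q x t - B x t) -` {0..})))"
    using X by (intro compact_Int_closed) auto
  moreover define S where "S = X \<inter> ((X \<inter> (\<lambda>(x, t). p x t - A x t) -` {0..}) \<union> (X \<inter> (\<lambda>(x, t). q x t - B x t) -` {0..}))"
  ultimately have "compact S" by simp
  have Smem: "(y, s) \<in> S \<longleftrightarrow> y \<in> closure \<Omega> \<and> a \<le> s \<and> s \<le> b \<and> (A y s \<le> p y s \<or> B y s \<le> q y s)" for y s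
    by (auto simp: S_def X_def)
  have "S \<noteq> {}" using Smem[of x t] neg xt by auto
  \<comment> \<open>Minimizing the time coordinate over the compact set of failures yields the first
    contact.\<close>
  then have "\<exists>z\<in>S. \<forall>w\<in>S. snd z \<le> snd w"
    using \<open>compact S\<close> by (intro continuous_attains_inf continuous_intros) auto
  then obtain y s where ys: "(y, s) \<in> S" "\<And>y' s'. (y', s') \<in> S \<Longrightarrow> s \<le> s'" by force
  have y: "y \<in> closure \<Omega>" "a \<le> s" "s \<le> b" "A y s \<le> p y s \<or> B y s \<le> q y s" using ys Smem by auto
  have "a < s" using y init[OF y(1)] by (cases "a = s") auto
  have lt: "p z r < A z r \<and> q z r < B z r" if "z \<in> closure \<Omega>" "a \<le> r" "r < s" for z r
    using ys(2)[of z r] that y Smem[of z r] by force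
  have sl: "continuous_on {a..s} (\<lambda>r. f z r - g z r)"
    if "continuous_on (closure \<Omega> \<times> {a..b}) (\<lambda>(x, t). f x t)"
       "continuous_on (closure \<Omega> \<times> {a..b}) (\<lambda>(x, t). g x t)" "z \<in> closure \<Omega>" for f g :: "'a \<Rightarrow> real \<Rightarrow> real" and z
  proof -
    have "continuous_on {a..s} (\<lambda>r. (\<lambda>(x, t). f x t) (z, r))"
      by (rule continuous_on_compose2[OF that(1)]) (use that(3) y in \<open>auto intro!: continuous_intros\<close>)
    moreover have "continuous_on {a..s} (\<lambda>r. (\<lambda>(x, t). g x t) (z, r))"
      by (rule continuous_on_compose2[OF that(2)]) (use that(3) y in \<open>auto intro!: continuous_intros\<close>)
    ultimately show ?thesis by (simp add: continuous_on_diff)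
  qed
  have cl: "closure {a..<s} = {a..s}" using \<open>a < s\<close> by simp
  \<comment> \<open>Continuity from earlier times preserves the weak inequalities at time
    \<open>s\<close>, simultaneously at all points and in both components.\<close>
  have le: "p z s \<le> A z s \<and> q z s \<le> B z s" if z: "z \<in> closure \<Omega>" for z
  proof
    have "p z s - A z s \<le> 0"
      by (rule continuous_le_on_closure[of "{a..<s}"])
         (use sl[OF cp cA z] lt[OF z] cl \<open>a < s\<close> in \<open>auto simp: less_imp_le\<close>)
    then show "p z s \<le> A z s" by simp
    have "q z s - B z s \<le> 0"
      by (rule continuous_le_on_closure[of "{a..<s}"])
         (use sl[OF cq cB z] lt[OF z] cl \<open>a < s\<close> in \<open>auto simp: less_imp_le\<close>)
    then show "q z s \<le> B z s" by simp
  qed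
  have "y \<in> \<Omega>"
  proof (rule ccontr)
    assume "y \<notin> \<Omega>"
    then have "y \<in> frontier \<Omega>" using y(1) \<open>open \<Omega>\<close> by (simp add: frontier_def interior_open)
    then show False using bdry[of y s] \<open>a < s\<close> y by auto
  qed
  have sub: "z \<in> closure \<Omega>" if "z \<in> \<Omega>" for z using that closure_subset by blast
  have tle: "p y r \<le> A y r \<and> q y r \<le> B y r" if "a \<le> r" "r \<le> s" for r
    using lt[OF y(1), of r] le[OF y(1)] that by (cases "r = s") auto
  from y(4) show False
  proof
    assume "A y s \<le> p y s"
    then have e: "p y s = A y s" using le[OF y(1)] by auto
    have "strict_sub_at p A y s" using P[OF \<open>y \<in> \<Omega>\<close> \<open>a < s\<close> y(3) e] le[OF y(1)] by blast
    from no_first_touching[OF \<open>open \<Omega>\<close> \<open>y \<in> \<Omega>\<close> \<open>a < s\<close> this e] show False using le tle sub by blast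
  next
    assume "B y s \<le> q y s"
    then have e: "q y s = B y s" using le[OF y(1)] by auto
    have "strict_sub_at q B y s" using Q[OF \<open>y \<in> \<Omega>\<close> \<open>a < s\<close> y(3) e] le[OF y(1)] by blast
    from no_first_touching[OF \<open>open \<Omega>\<close> \<open>y \<in> \<Omega>\<close> \<open>a < s\<close> this e] show False using le tle sub by blast
  qed
qed

text \<open>Adding the same \<open>e * H\<close> to both components changes the first equation by
  \<open>e * (l + (a x + \<nu>) * H x)\<close>, and likewise the second. Off \<open>K\<close> this
  is nonpositive, because \<open>M\<close> dominates \<open>a + \<nu>\<close> and
  \<open>b + \<nu>\<close>. On \<open>K\<close> it is merely bounded, but there the margin
  \<open>(\<nu>1 - \<nu>) * \<phi> x\<close> has a positive minimum and absorbs it for small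
  \<open>e\<close>.\<close>

lemma positive_strict_supersolution:
  fixes \<Omega> :: "'a::euclidean_space set"
  assumes \<Omega>: "smooth_bounded_domain \<Omega>"
    and ca: "continuous_on (closure \<Omega>) a" and cb: "continuous_on (closure \<Omega>) b"
    and a0: "\<And>x. x \<in> \<Omega> \<Longrightarrow> 0 \<le> a x" and b0: "\<And>x. x \<in> \<Omega> \<Longrightarrow> 0 \<le> b x"
    and \<phi>: "Ck_on 2 \<Omega> \<phi>" "continuous_on (closure \<Omega>) \<phi>"
    and \<psi>: "Ck_on 2 \<Omega> \<psi>" "continuous_on (closure \<Omega>) \<psi>"
    and bdry: "\<And>x. x \<in> frontier \<Omega> \<Longrightarrow> \<phi> x = 0 \<and> \<psi> x = 0"
    and pos: "\<And>x. x \<in> \<Omega> \<Longrightarrow> 0 < \<phi> x \<and> 0 < \<psi> x"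
    and eq: "\<And>x. x \<in> \<Omega> \<Longrightarrow> - laplacian \<phi> x - a x * \<psi> x = \<nu>1 * \<phi> x \<and> - laplacian \<psi> x - b x * \<phi> x = \<nu>1 * \<psi> x"
    and \<nu>: "0 < \<nu>" "\<nu> < \<nu>1"
  obtains \<Phi> \<Psi> e R where "0 < e" "continuous_on (closure \<Omega>) \<Phi>" "continuous_on (closure \<Omega>) \<Psi>"
    "\<And>x. x \<in> closure \<Omega> \<Longrightarrow> e \<le> \<Phi> x \<and> \<Phi> x \<le> R" "\<And>x. x \<in> closure \<Omega> \<Longrightarrow> e \<le> \<Psi> x \<and> \<Psi> x \<le> R"
    "\<And>x. x \<in> \<Omega> \<Longrightarrow> \<exists>l. upper_lap \<Phi> x l \<and> l < - (a x * \<Psi> x + \<nu> * \<Phi> x)"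
    "\<And>x. x \<in> \<Omega> \<Longrightarrow> \<exists>l. upper_lap \<Psi> x l \<and> l < - (b x * \<Phi> x + \<nu> * \<Psi> x)"
proof -
  have op: "open \<Omega>" and bd: "bounded \<Omega>" and ne: "\<Omega> \<noteq> {}" using \<Omega> by (auto simp: smooth_bounded_domain_def)
  have cpt: "compact (closure \<Omega>)" using bd by simp
  have sub: "z \<in> closure \<Omega>" if "z \<in> \<Omega>" for z using that closure_subset by blast
  have bnd: "\<exists>A. \<forall>x\<in>closure \<Omega>. \<bar>F x\<bar> \<le> A" if "continuous_on (closure \<Omega>) F" for F :: "'a \<Rightarrow> real"
    using compact_imp_bounded[OF compact_continuous_image[OF that cpt]] by (auto simp: bounded_iff)
  obtain A1 A2 where A: "\<forall>x\<in>closure \<Omega>. \<bar>a x\<bar> \<le> A1" "\<forall>x\<in>closure \<Omega>. \<bar>b x\<bar> \<le> A2"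
    using bnd[OF ca] bnd[OF cb] by blast
  define M where "M = max A1 A2 + \<nu>"
  have M: "a x + \<nu> \<le> M" "b x + \<nu> \<le> M" if "x \<in> closure \<Omega>" for x using A that by (auto simp: M_def abs_le_iff max_def)
  obtain x0 where "x0 \<in> \<Omega>" using ne by blast
  have M0: "0 \<le> M" using M(1)[OF sub[OF \<open>x0 \<in> \<Omega>\<close>]] a0[OF \<open>x0 \<in> \<Omega>\<close>] \<nu> by linarith
  obtain H K C where H: "continuous_on (closure \<Omega>) H" "compact K" "K \<subseteq> \<Omega>" "0 \<le> C"
     "\<forall>x\<in>closure \<Omega>. 1 \<le> H x \<and> H x \<le> 4"
     "\<forall>x\<in>\<Omega>. \<exists>l. upper_lap H x l \<and> l \<le> C \<and> (x \<notin> K \<longrightarrow> l \<le> - M * H x)"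
    using boundary_barrier[OF \<Omega> M0] by blast
  have "\<exists>d>0. \<forall>x\<in>K. d \<le> \<phi> x \<and> d \<le> \<psi> x"
  proof (cases "K = {}")
    case False
    have c: "continuous_on K (\<lambda>x. min (\<phi> x) (\<psi> x))"
      by (intro continuous_on_min continuous_on_subset[OF \<phi>(2)] continuous_on_subset[OF \<psi>(2)])
         (use H(3) sub in auto)
    obtain y where "y \<in> K" "\<forall>x\<in>K. min (\<phi> y) (\<psi> y) \<le> min (\<phi> x) (\<psi> x)"
      using continuous_attains_inf[OF H(2) False c] by blast
    then show ?thesis using pos[of y] H(3) by (intro exI[of _ "min (\<phi> y) (\<psi> y)"]) auto
  qed (auto intro: exI[of _ 1])
  then obtain d where d: "0 < d" "\<And>x. x \<in> K \<Longrightarrow> d \<le> \<phi> x \<and> d \<le> \<psi> x" by blast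
  \<comment> \<open>\<open>D\<close> bounds \<open>l + (a x + \<nu>) * H x\<close> on
    \<open>K\<close>, by \<open>l \<le> C\<close> and \<open>H \<le> 4\<close>; the 1 makes it
    positive. Then \<open>e\<close> uses half of the margin available on \<open>K\<close>, which
    keeps the inequality strict.\<close>
  define D where "D = C + 4 * M + 1"
  have D: "0 < D" using H(4) M0 by (simp add: D_def)
  define e where "e = (\<nu>1 - \<nu>) * d / D / 2"
  have e: "0 < e" using D d \<nu> by (simp add: e_def)
  have eD: "e * D < (\<nu>1 - \<nu>) * d" using D d \<nu> by (simp add: e_def)
  \<comment> \<open>The local names \<open>\<phi>\<close>, \<open>\<psi>\<close>, \<open>a\<close>
    are generic: the two equations are mirror images and both are instances.\<close>
  have key: "\<exists>l. upper_lap (\<lambda>y. \<phi> y + e * H y) x l \<and> l < - (a x * (\<psi> x + e * H x) + \<nu> * (\<phi> x + e * H x))"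
    if x: "x \<in> \<Omega>" and C2: "Ck_on 2 \<Omega> \<phi>" and eq: "- laplacian \<phi> x - a x * \<psi> x = \<nu>1 * \<phi> x"
      and a: "0 \<le> a x" "a x + \<nu> \<le> M" and pos: "0 < \<phi> x" and dK: "x \<in> K \<longrightarrow> d \<le> \<phi> x"
    for \<phi> \<psi> :: "'a \<Rightarrow> real" and x and a :: "'a \<Rightarrow> real"
  proof -
    obtain l where l: "upper_lap H x l" "l \<le> C" "x \<notin> K \<longrightarrow> l \<le> - M * H x" using H(6) x by blast
    have Hx: "1 \<le> H x" "H x \<le> 4" using H(5) sub[OF x] by auto
    have ul: "upper_lap (\<lambda>y. \<phi> y + e * H y) x (laplacian \<phi> x + e * l)"
      by (intro upper_lap_add_has_lap has_lap_C2[OF C2 op x] upper_lap_cmult l) (use e in auto)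
    have MH: "(a x + \<nu>) * H x \<le> M * H x" using a Hx by (intro mult_right_mono) auto
    have "e * (l + (a x + \<nu>) * H x) < (\<nu>1 - \<nu>) * \<phi> x"
    proof (cases "x \<in> K")
      case True
      have "M * H x \<le> M * 4" using M0 Hx by (intro mult_left_mono) auto
      then have "l + (a x + \<nu>) * H x \<le> D" using l(2) MH by (simp add: D_def)
      then have "e * (l + (a x + \<nu>) * H x) \<le> e * D" using e by (intro mult_left_mono) auto
      also have "\<dots> < (\<nu>1 - \<nu>) * d" by (rule eD)
      also have "\<dots> \<le> (\<nu>1 - \<nu>) * \<phi> x" using True dK \<nu> by (intro mult_left_mono) auto
      finally show ?thesis .
    next
      case False
      then have "l + (a x + \<nu>) * H x \<le> 0" using l(3) MH by simp
      then have "e * (l + (a x + \<nu>) * H x) \<le> 0" using e by (simp add: mult_le_0_iff)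
      also have "0 < (\<nu>1 - \<nu>) * \<phi> x" using \<nu> pos by simp
      finally show ?thesis .
    qed
    then have "laplacian \<phi> x + e * l < - (a x * (\<psi> x + e * H x) + \<nu> * (\<phi> x + e * H x))"
      using eq by (simp add: algebra_simps)
    then show ?thesis using ul by blast
  qed
  obtain R1 R2 where R: "\<forall>x\<in>closure \<Omega>. \<bar>\<phi> x\<bar> \<le> R1" "\<forall>x\<in>closure \<Omega>. \<bar>\<psi> x\<bar> \<le> R2"
    using bnd[OF \<phi>(2)] bnd[OF \<psi>(2)] by blast
  have nn: "0 \<le> \<phi> x \<and> 0 \<le> \<psi> x" if "x \<in> closure \<Omega>" for x
    using pos[of x] bdry[of x] that op by (cases "x \<in> \<Omega>") (auto simp: frontier_def interior_open less_imp_le)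
  have eH: "e \<le> e * H x" "e * H x \<le> e * 4" if "x \<in> closure \<Omega>" for x
    using H(5) that e by auto
  show ?thesis
  proof (rule that[of e "\<lambda>y. \<phi> y + e * H y" "\<lambda>y. \<psi> y + e * H y" "max R1 R2 + e * 4"])
    show "continuous_on (closure \<Omega>) (\<lambda>y. \<phi> y + e * H y)" "continuous_on (closure \<Omega>) (\<lambda>y. \<psi> y + e * H y)"
      using \<phi> \<psi> H by (auto intro!: continuous_intros)
    show "e \<le> \<phi> x + e * H x \<and> \<phi> x + e * H x \<le> max R1 R2 + e * 4" if "x \<in> closure \<Omega>" for x
      using eH[OF that] nn[OF that] R that by (smt (verit))
    show "e \<le> \<psi> x + e * H x \<and> \<psi> x + e * H x \<le> max R1 R2 + e * 4" if "x \<in> closure \<Omega>" for x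
      using eH[OF that] nn[OF that] R that by (smt (verit))
    fix x assume x: "x \<in> \<Omega>"
    show "\<exists>l. upper_lap (\<lambda>y. \<phi> y + e * H y) x l \<and> l < - (a x * (\<psi> x + e * H x) + \<nu> * (\<phi> x + e * H x))"
      by (rule key[OF x]) (use x \<phi> eq a0 M sub pos d in auto)
    show "\<exists>l. upper_lap (\<lambda>y. \<psi> y + e * H y) x l \<and> l < - (b x * (\<phi> x + e * H x) + \<nu> * (\<psi> x + e * H x))"
      by (rule key[OF x]) (use x \<psi> eq b0 M sub pos d in auto)
  qed (rule e)
qed

section \<open>Convexity of the nonlinearities\<close>

context
  fixes f :: "real \<Rightarrow> real"
  assumes f: "nonlinearity f"
begin

lemma nonlinearity_deriv:
  assumes "x \<in> {0..<1}"
  shows "(f has_real_derivative deriv01 f x) (at x within {0..<1})"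
proof -
  have "f differentiable (at x within {0..<1})"
    using f assms by (auto simp: nonlinearity_def C2_01_def differentiable_on_def)
  then show ?thesis
    by (simp add: deriv01_def has_real_derivative_iff_has_vector_derivative vector_derivative_works)
qed

lemma nonlinearity_continuous: "continuous_on {0..<1} f"
  using f by (auto simp: nonlinearity_def C2_01_def intro: differentiable_imp_continuous_on)

lemma nonlinearity_deriv_continuous: "continuous_on {0..<1} (deriv01 f)"
  using f by (auto simp: nonlinearity_def C2_01_def intro: differentiable_imp_continuous_on)

lemma nonlinearity_less: "0 \<le> x \<Longrightarrow> x < y \<Longrightarrow> y < 1 \<Longrightarrow> f x < f y"
  using f by (auto simp: nonlinearity_def strict_mono_on_def)

lemma nonlinearity_le: "0 \<le> x \<Longrightarrow> x \<le> y \<Longrightarrow> y < 1 \<Longrightarrow> f x \<le> f y"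
  using nonlinearity_less[of x y] by (cases "x = y") auto

lemma nonlinearity_convex:
  assumes "x \<in> {0..<1}" "y \<in> {0..<1}" "0 \<le> t" "t \<le> 1"
  shows "f ((1 - t) * x + t * y) \<le> (1 - t) * f x + t * f y"
proof (cases "x = y \<or> t = 0 \<or> t = 1")
  case True
  then show ?thesis by (auto simp: algebra_simps)
next
  case False
  then show ?thesis
    using f assms unfolding nonlinearity_def strictly_convex_on_def by (auto intro: less_imp_le)
qed

text \<open>By convexity the difference quotients along the segment from \<open>x\<close> to
  \<open>y\<close> are at most \<open>f y - f x\<close>; let the parameter tend to 0. Working within
  the segment keeps the argument valid at the end point 0, where the derivative is
  one-sided.\<close>

lemma nonlinearity_tangent:
  assumes x: "x \<in> {0..<1}" and y: "y \<in> {0..<1}"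
  shows "f x + deriv01 f x * (y - x) \<le> f y"
proof -
  define g where "g t = x + t * (y - x)" for t
  have gin: "g t \<in> {0..<1}" if "t \<in> {0..1}" for t
  proof -
    have "g t = (1 - t) *\<^sub>R x + t *\<^sub>R y" by (simp add: g_def algebra_simps)
    then show ?thesis using convexD_alt[OF convex_real_interval(7), of x 0 1 y t] x y that by auto
  qed
  have "(f has_real_derivative deriv01 f x) (at (g 0) within g ` {0..1})"
    using DERIV_subset[OF nonlinearity_deriv[OF x], of "g ` {0..1}"] gin
    by (simp add: g_def[of 0] image_subset_iff)
  moreover have "(g has_real_derivative (y - x)) (at 0 within {0..1})"
    unfolding g_def by (auto intro!: derivative_eq_intros)
  ultimately have "((f \<circ> g) has_real_derivative deriv01 f x * (y - x)) (at 0 within {0..1})"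
    by (rule DERIV_image_chain)
  then have lim: "((\<lambda>t. (f (g t) - f x) / t) \<longlongrightarrow> deriv01 f x * (y - x)) (at 0 within {0..1})"
    by (simp add: has_field_derivative_iff g_def)
  have "\<forall>\<^sub>F t in at 0 within {0..1}. (f (g t) - f x) / t \<le> f y - f x"
    unfolding eventually_at_filter
  proof (intro always_eventually allI impI)
    fix t :: real assume t: "t \<noteq> 0" "t \<in> {0..1}"
    have "f (g t) \<le> (1 - t) * f x + t * f y"
      using nonlinearity_convex[OF x y, of t] t by (simp add: g_def algebra_simps)
    then show "(f (g t) - f x) / t \<le> f y - f x" using t by (simp add: field_simps)
  qed
  moreover have "at (0::real) within {0..1} \<noteq> bot" by (simp add: trivial_limit_within islimpt_Icc)
  ultimately show ?thesis using tendsto_upperbound[OF lim] by force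
qed

lemma nonlinearity_deriv_mono:
  assumes "0 \<le> x" "x \<le> y" "y < 1"
  shows "deriv01 f x \<le> deriv01 f y"
proof (cases "x = y")
  case False
  have "(deriv01 f x - deriv01 f y) * (y - x) \<le> 0"
    using nonlinearity_tangent[of x y] nonlinearity_tangent[of y x] assms by (simp add: algebra_simps)
  then show ?thesis using False assms by (simp add: mult_le_0_iff)
qed simp

text \<open>At \<open>y > 0\<close> the tangent evaluated at 0, together with monotonicity, gives a
  positive slope. The slope at 0 is a limit of these, and slopes increase by convexity.\<close>

lemma nonlinearity_deriv_nonneg:
  assumes x: "x \<in> {0..<1}"
  shows "0 \<le> deriv01 f x"
proof -
  have pos: "0 \<le> deriv01 f y" if "y \<in> {0<..<1/2}" for y
  proof -
    have "0 < deriv01 f y * y"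
      using nonlinearity_tangent[of y 0] nonlinearity_less[of 0 y] that by auto
    then show ?thesis using that by (simp add: zero_less_mult_iff)
  qed
  have "0 \<le> deriv01 f 0"
    by (rule continuous_ge_on_closure[of "{0<..<1/2}"])
       (use pos in \<open>auto intro!: continuous_on_subset[OF nonlinearity_deriv_continuous]\<close>)
  then show ?thesis using nonlinearity_deriv_mono[of 0 x] x by auto
qed

text \<open>Convexity puts \<open>f\<close> below the broken chord through the midpoint. The gap
  between the full chord and the broken one is \<open>s\<close> or \<open>1 - s\<close> times the
  midpoint gap, on the left and right half respectively, and both factors dominate
  \<open>s * (1 - s)\<close>.\<close>

lemma nonlinearity_slack:
  assumes a: "a \<in> {0..<1}" and b: "b \<in> {0..<1}" and s: "0 \<le> s" "s \<le> 1"
  shows "s * (1 - s) * (f a + f b - 2 * f ((a + b) / 2)) \<le> (1 - s) * f a + s * f b - f (a + s * (b - a))"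
proof -
  define G where "G = f a + f b - 2 * f ((a + b) / 2)"
  have m: "(a + b) / 2 \<in> {0..<1}" using a b by auto
  have eq: "(1 - 1/2) * a + 1/2 * b = (a + b) / 2" by (simp add: field_simps)
  have G: "0 \<le> G" using nonlinearity_convex[OF a b, of "1/2", unfolded eq] by (simp add: G_def)
  show ?thesis
  proof (cases "s \<le> 1/2")
    case True
    have e: "(1 - 2 * s) * a + 2 * s * ((a + b) / 2) = a + s * (b - a)" by (simp add: field_simps)
    have "f (a + s * (b - a)) \<le> (1 - 2 * s) * f a + 2 * s * f ((a + b) / 2)"
      using nonlinearity_convex[OF a m, of "2 * s", unfolded e] True s by simp
    then have "s * G \<le> (1 - s) * f a + s * f b - f (a + s * (b - a))"
      by (simp add: G_def algebra_simps)
    moreover have "s * (1 - s) * G \<le> s * G" using G s by (intro mult_right_mono) (auto simp: mult_left_le)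
    ultimately show ?thesis by (simp add: G_def)
  next
    case False
    have e: "(1 - (2-2 * s)) * b + (2-2 * s) * ((a + b) / 2) = a + s * (b - a)" by (simp add: field_simps)
    have "f (a + s * (b - a)) \<le> (1 - (2-2 * s)) * f b + (2-2 * s) * f ((a + b) / 2)"
      using nonlinearity_convex[OF b m, of "2-2 * s", unfolded e] False s by simp
    then have "(1 - s) * G \<le> (1 - s) * f a + s * f b - f (a + s * (b - a))"
      by (simp add: G_def algebra_simps)
    moreover have "s * (1 - s) * G \<le> (1 - s) * G" using G s by (intro mult_right_mono) (auto simp: mult_left_le_one_le)
    ultimately show ?thesis by (simp add: G_def)
  qed
qed

text \<open>The pairs in question form a compact set on which the midpoint gap is continuous and
  positive, so it has a positive minimum.\<close>

lemma uniform_strict_convexity: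
  assumes "m < 1" "0 < \<eta>"
  obtains \<kappa> where "0 < \<kappa>"
    "\<And>a b. 0 \<le> a \<Longrightarrow> a + \<eta> \<le> b \<Longrightarrow> b \<le> m \<Longrightarrow> \<kappa> \<le> f a + f b - 2 * f ((a + b) / 2)"
proof -
  define Z where "Z = ({0..m} \<times> {0..m}) \<inter> (\<lambda>z. snd z - fst z - \<eta>) -` {0..}"
  have "closed Z" unfolding Z_def
    by (intro continuous_closed_preimage continuous_intros closed_Times)
  moreover have "bounded Z" unfolding Z_def
    by (rule bounded_subset[of "{0..m} \<times> {0..m}"]) (auto intro: bounded_Times)
  ultimately have Z: "compact Z" by (simp add: compact_eq_bounded_closed)
  define G where "G z = f (fst z) + f (snd z) - 2 * f ((fst z + snd z) / 2)" for z
  have cG: "continuous_on Z G" unfolding G_def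
    using assms
    by (auto intro!: continuous_intros continuous_on_compose2[OF nonlinearity_continuous] simp: Z_def)
  have pos: "0 < G z" if "z \<in> Z" for z
  proof -
    obtain a b where z: "z = (a, b)" by (cases z)
    have ab: "a \<in> {0..<1}" "b \<in> {0..<1}" "a \<noteq> b" using that assms by (auto simp: Z_def z)
    have eq: "(1 - 1/2) * a + 1/2 * b = (a + b) / 2" by (simp add: field_simps)
    have "\<forall>t. a \<noteq> b \<and> 0 < t \<and> t < 1 \<longrightarrow> f ((1 - t) * a + t * b) < (1 - t) * f a + t * f b"
      using f ab unfolding nonlinearity_def strictly_convex_on_def by blast
    from this[rule_format, of "1/2", unfolded eq] ab show ?thesis by (simp add: G_def z)
  qed
  show ?thesis
  proof (cases "Z = {}")
    case True
    have "(a, b) \<in> Z" if "0 \<le> a" "a + \<eta> \<le> b" "b \<le> m" for a b using that assms by (auto simp: Z_def)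
    then show ?thesis by (intro that[of 1]) (use True in auto)
  next
    case False
    obtain w where w: "w \<in> Z" "\<And>z. z \<in> Z \<Longrightarrow> G w \<le> G z"
      using continuous_attains_inf[OF Z False cG] by blast
    show ?thesis
    proof (rule that[of "G w"])
      fix a b assume "0 \<le> a" "a + \<eta> \<le> b" "b \<le> m"
      then have "(a, b) \<in> Z" using assms by (auto simp: Z_def)
      from w(2)[OF this] show "G w \<le> f a + f b - 2 * f ((a + b) / 2)" by (simp add: G_def)
    qed (use pos w in auto)
  qed
qed

text \<open>If \<open>s (z1 - z)\<close> is small, the derivative of \<open>f\<close> has hardly changed since \<open>z\<close>; otherwise the strict
  convexity gap, of order \<open>1 - s\<close>, absorbs the error, of order \<open>\<tau>\<close>.\<close>

lemma convex_combination_defect: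
  assumes m: "0 \<le> m" "m < 1" and R: "0 \<le> R" and e: "0 < e"
  obtains c where "0 < c"
    "\<And>z z1 s \<tau> P. 0 \<le> z \<Longrightarrow> z \<le> z1 \<Longrightarrow> z1 \<le> m \<Longrightarrow> 0 \<le> s \<Longrightarrow> s \<le> 1 \<Longrightarrow> 0 \<le> \<tau> \<Longrightarrow> \<tau> \<le> c * (1 - s) \<Longrightarrow>
        0 \<le> P \<Longrightarrow> P \<le> R \<Longrightarrow> z + s * (z1 - z) + \<tau> * P < 1 \<and>
        f (z + s * (z1 - z) + \<tau> * P) \<le> (1 - s) * f z + s * f z1 + \<tau> * (deriv01 f z * P) + \<tau> * e"
proof -
  \<comment> \<open>Halfway between \<open>m\<close> and 1: room for the perturbation
    \<open>\<tau> * P\<close>, while the derivative of \<open>f\<close> stays uniformly continuous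
    on \<open>{0..m'}\<close>.\<close>
  define m' where "m' = (1 + m) / 2"
  have m': "m < m'" "m' < 1" "0 < m'" using m by (auto simp: m'_def)
  have "uniformly_continuous_on {0..m'} (deriv01 f)"
    by (intro compact_uniformly_continuous continuous_on_subset[OF nonlinearity_deriv_continuous])
       (use m' in auto)
  moreover have "0 < e / (R + 1)" using e R by simp
  ultimately obtain \<eta> where \<eta>: "0 < \<eta>" "\<And>x y. x \<in> {0..m'} \<Longrightarrow> y \<in> {0..m'} \<Longrightarrow> dist y x < \<eta> \<Longrightarrow>
      dist (deriv01 f y) (deriv01 f x) < e / (R + 1)"
    unfolding uniformly_continuous_on_def by metis
  obtain \<kappa> where \<kappa>: "0 < \<kappa>"
    "\<And>a b. 0 \<le> a \<Longrightarrow> a + \<eta> / 2 \<le> b \<Longrightarrow> b \<le> m \<Longrightarrow> \<kappa> \<le> f a + f b - 2 * f ((a + b) / 2)"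
    using uniform_strict_convexity[OF m(2), of "\<eta>/2"] \<eta>(1) by auto
  define F where "F = deriv01 f m'"
  have F: "0 \<le> F" using nonlinearity_deriv_nonneg[of m'] m' by (simp add: F_def)
  \<comment> \<open>The three bounds serve, in order, to keep the argument below \<open>m'\<close>,
    to make \<open>\<tau> * P < \<eta> / 2\<close>, and to let the convexity gap beat the
    perturbation error when \<open>s * (z1 - z)\<close> is large.\<close>
  define c where "c = Min {(1 - m) / 2 / (R + 1), \<eta> / 2 / (R + 1), \<eta> * \<kappa> / 2 / ((R + 1) * (F + 1))}"
  have c: "0 < c" using m \<eta> \<kappa> R F by (simp add: c_def)
  have cle: "c \<le> (1 - m) / 2 / (R + 1)" "c \<le> \<eta> / 2 / (R + 1)" "c \<le> \<eta> * \<kappa> / 2 / ((R + 1) * (F + 1))"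
    by (auto simp: c_def)
  have c1: "c * (R + 1) \<le> (1 - m) / 2" "c * (R + 1) \<le> \<eta> / 2"
    using cle(1,2) R by (simp_all only: pos_le_divide_eq)
  have c2: "c * ((R + 1) * (F + 1)) \<le> \<eta> * \<kappa> / 2"
    using cle(3) mult_pos_pos[of "R + 1" "F + 1"] R F by (simp only: pos_le_divide_eq)
  show ?thesis
  proof (rule that[OF c])
    fix z z1 s \<tau> P
    assume z: "0 \<le> z" "z \<le> z1" "z1 \<le> m" and s: "0 \<le> s" "s \<le> 1" and \<tau>: "0 \<le> \<tau>" "\<tau> \<le> c * (1 - s)"
      and P: "0 \<le> P" "P \<le> R"
    define x where "x = z + s * (z1 - z)"
    define y where "y = x + \<tau> * P"
    have sz: "0 \<le> s * (z1 - z)" "s * (z1 - z) \<le> z1 - z"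
      using s z by (auto intro: mult_left_le_one_le)
    have "\<tau> \<le> c" using \<tau> c s by (smt (verit) mult_left_le)
    then have "\<tau> * P \<le> c * R" using c \<tau> P by (intro mult_mono) auto
    then have \<tau>P: "0 \<le> \<tau> * P" "\<tau> * P \<le> (1 - m) / 2" "\<tau> * P < \<eta> / 2"
      using c1 c \<tau> P by (auto simp: algebra_simps)
    have xy: "0 \<le> x" "x \<le> m" "x \<le> y" "y \<le> m'" "z \<le> y"
      using sz \<tau>P z by (auto simp: x_def y_def m'_def field_simps)
    \<comment> \<open>The tangent at the far point \<open>y\<close> bounds \<open>f y\<close> from
      above, so the whole error relative to the linearization at \<open>z\<close> is
      \<open>deriv01 f y - deriv01 f z\<close> times \<open>\<tau> * P\<close>.\<close>
    have "f y + deriv01 f y * (x - y) \<le> f x"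
      using xy m' m by (intro nonlinearity_tangent) auto
    then have fy: "f y \<le> f x + \<tau> * (deriv01 f y * P)" by (simp add: y_def algebra_simps)
    define G where "G = f z + f z1 - 2 * f ((z + z1) / 2)"
    have sl: "s * (1 - s) * G \<le> (1 - s) * f z + s * f z1 - f x"
      unfolding x_def G_def by (rule nonlinearity_slack) (use z m s in auto)
    have main: "s * (1 - s) * G + \<tau> * e \<ge> \<tau> * ((deriv01 f y - deriv01 f z) * P)"
    proof (cases "s * (z1 - z) \<le> \<eta> / 2")
      case True
      have "dist y z < \<eta>" using True \<tau>P xy by (simp add: dist_real_def y_def x_def)
      then have "deriv01 f y - deriv01 f z \<le> e / (R + 1)"
        using \<eta>(2)[of z y] xy z m' by (simp add: dist_real_def)
      then have "(deriv01 f y - deriv01 f z) * P \<le> e / (R + 1) * (R + 1)"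
        using P R e by (intro mult_mono) auto
      then have "\<tau> * ((deriv01 f y - deriv01 f z) * P) \<le> \<tau> * e"
        using \<tau> R by (intro mult_left_mono) auto
      moreover have "0 \<le> G"
        using nonlinearity_slack[of z z1 "1/2"] nonlinearity_convex[of z z1 "1/2"] z m
        by (simp add: G_def field_simps)
      ultimately show ?thesis using s by (smt (verit) mult_nonneg_nonneg)
    next
      case False
      \<comment> \<open>Both factors of \<open>s * (z1 - z)\<close> are at most 1, so each exceeds
        \<open>\<eta> / 2\<close>: the one makes the midpoint gap at least \<open>\<kappa>\<close>,
        the other bounds \<open>s\<close> from below.\<close>
      have "\<kappa> \<le> G" unfolding G_def by (rule \<kappa>(2)) (use False sz z in auto)
      have "s * (z1 - z) \<le> s * 1" using s z m by (intro mult_left_mono) auto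
      then have "\<eta> / 2 \<le> s" using False by simp
      then have "\<eta> / 2 * (1 - s) * \<kappa> \<le> s * (1 - s) * G"
        using \<open>\<kappa> \<le> G\<close> \<kappa> s \<eta> by (intro mult_mono) auto
      moreover have "\<tau> * ((deriv01 f y - deriv01 f z) * P) \<le> (c * (1 - s)) * ((F + 1) * (R + 1))"
      proof (intro mult_mono)
        have "deriv01 f y \<le> F" unfolding F_def using xy m' by (intro nonlinearity_deriv_mono) auto
        then show "deriv01 f y - deriv01 f z \<le> F + 1" using nonlinearity_deriv_nonneg[of z] z m by auto
        have "deriv01 f z \<le> deriv01 f y" using xy z m' by (intro nonlinearity_deriv_mono) auto
        then show "0 \<le> (deriv01 f y - deriv01 f z) * P" using P by simp
      qed (use \<tau> P F R c s in auto)
      moreover have "(c * (1 - s)) * ((F + 1) * (R + 1)) \<le> \<eta> * \<kappa> / 2 * (1 - s)"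
        using mult_right_mono[OF c2, of "1 - s"] s by (simp add: algebra_simps)
      moreover have "0 \<le> \<tau> * e" using \<tau> e by simp
      moreover have "\<eta> / 2 * (1 - s) * \<kappa> = \<eta> * \<kappa> / 2 * (1 - s)" by simp
      ultimately show ?thesis by linarith
    qed
    have "f y \<le> (1 - s) * f z + s * f z1 + \<tau> * (deriv01 f z * P) + \<tau> * e"
      using fy sl main by (simp add: algebra_simps)
    moreover have "y < 1" using xy m' by simp
    ultimately show "z + s * (z1 - z) + \<tau> * P < 1 \<and>
        f (z + s * (z1 - z) + \<tau> * P) \<le> (1 - s) * f z + s * f z1 + \<tau> * (deriv01 f z * P) + \<tau> * e"
      by (simp add: x_def y_def)
  qed
qed

end

section \<open>The strong maximum principle\<close>

text \<open>Comparison with \<open>exp (- a (r - s)) (\<rho>(r) - \<bar>x - y\<bar>\<^sup>2)\<^sup>2\<close>, a subsolution of the heat equation on the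
  expanding ball where the bracket is positive.\<close>

lemma positivity_spreads_in_ball:
  fixes y :: "'a::euclidean_space"
  assumes st: "s < t" and cont: "continuous_on (cball y R \<times> {s..t}) (\<lambda>(x, r). p x r)"
    and nn: "\<And>x r. x \<in> cball y R \<Longrightarrow> s \<le> r \<Longrightarrow> r \<le> t \<Longrightarrow> 0 \<le> p x r"
    and R: "0 < R" and pos: "0 < p y s"
    and super: "\<And>x r. x \<in> ball y R \<Longrightarrow> s < r \<Longrightarrow> r \<le> t \<Longrightarrow>
       \<exists>p' pl. (p x has_real_derivative p') (at r) \<and> has_lap (\<lambda>z. p z r) x pl \<and> pl \<le> p'"
    and x: "x \<in> ball y R"
  shows "0 < p x t"
proof -
  have "continuous_on (cball y R) (\<lambda>x. (\<lambda>(x, r). p x r) (x, s))"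
    by (rule continuous_on_compose2[OF cont]) (use st in \<open>auto intro!: continuous_intros\<close>)
  then have "\<exists>d>0. \<forall>x\<in>cball y R. dist x y < d \<longrightarrow> dist (p x s) (p y s) < p y s / 2"
    using R pos unfolding continuous_on_iff prod.case by (meson centre_in_cball half_gt_zero less_imp_le)
  then obtain d where d: "0 < d" "\<And>x. x \<in> cball y R \<Longrightarrow> dist x y < d \<Longrightarrow> dist (p x s) (p y s) < p y s / 2"
    by blast
  define r0 where "r0 = min d R / 2"
  have r0: "0 < r0" "r0 < d" "r0 < R" using d R by (auto simp: r0_def)
  have init: "p y s / 2 \<le> p x s" if "norm (x - y) \<le> r0" for x
  proof -
    have "x \<in> cball y R" "dist x y < d" using that r0 by (auto simp: dist_norm norm_minus_commute)
    from d(2)[OF this] show ?thesis unfolding dist_real_def by linarith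
  qed
  \<comment> \<open>The squared radius grows linearly in time, from \<open>r0\<^sup>2\<close> at
    time \<open>s\<close> to \<open>R\<^sup>2\<close> at time \<open>t\<close>.\<close>
  define k where "k = (R\<^sup>2 - r0\<^sup>2) / (t - s)"
  have "r0\<^sup>2 < R\<^sup>2" using r0 by (intro power_strict_mono) auto
  then have k: "0 < k" using st by (simp add: k_def)
  define \<rho> where "\<rho> r = r0\<^sup>2 + k * (r - s)" for r
  have \<rho>s: "\<rho> s = r0\<^sup>2" and \<rho>t: "\<rho> t = R\<^sup>2" using st by (auto simp: \<rho>_def k_def)
  have \<rho>b: "r0\<^sup>2 \<le> \<rho> r" "\<rho> r \<le> R\<^sup>2" if "s \<le> r" "r \<le> t" for r
  proof -
    show "r0\<^sup>2 \<le> \<rho> r" using that k by (simp add: \<rho>_def)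
    have "k * (r - s) \<le> k * (t - s)" using that k by (intro mult_left_mono) auto
    then show "\<rho> r \<le> R\<^sup>2" using \<rho>t by (simp add: \<rho>_def)
  qed
  \<comment> \<open>\<open>B\<close> collects the coefficients of the bracket \<open>\<eta>\<close>
    in the heat operator applied to \<open>h\<close>. The value of \<open>a\<close> turns
    \<open>a * \<eta>\<^sup>2 - B * \<eta> + 4 * r0\<^sup>2\<close> into a perfect square, leaving a
    surplus because \<open>8 * \<rho> r\<close> exceeds \<open>4 * r0\<^sup>2\<close>.\<close>
  define B where "B = 2 * k + 8 + 4 * real DIM('a)"
  define a where "a = (B / (4 * r0))\<^sup>2"
  define \<eta> where "\<eta> x r = \<rho> r - (norm (x - y))\<^sup>2" for x r
  define h where "h x r = exp (- a * (r - s)) * (\<eta> x r)\<^sup>2" for x r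
  \<comment> \<open>Initially \<open>h\<close> is at most \<open>r0^4\<close>, so
    \<open>e * h\<close> starts below \<open>p y s / 2\<close>, a lower bound for \<open>p\<close>
    on the small ball.\<close>
  define e where "e = p y s / 2 / r0^4"
  have e: "0 < e" using pos r0 by (simp add: e_def)
  \<comment> \<open>A negative minimum of \<open>p - e * h\<close> over this expanding region is
    impossible on its lateral edge, where \<open>h = 0\<close>, and at time \<open>s\<close>, by the
    choice of \<open>e\<close>. It remains to exclude points where the heat equation holds.\<close>
  define X where "X = (cball y R \<times> {s..t}) \<inter> (\<lambda>z. \<eta> (fst z) (snd z)) -` {0..}"
  have "closed X" unfolding X_def \<eta>_def \<rho>_def
    by (intro continuous_closed_preimage continuous_intros closed_Times closed_cball)
  moreover have "bounded X" unfolding X_def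
    by (rule bounded_subset[of "cball y R \<times> {s..t}"]) (auto intro: bounded_Times)
  ultimately have X: "compact X" by (simp add: compact_eq_bounded_closed)
  have xt: "(x, t) \<in> X" using x st \<rho>t
    by (auto simp: X_def \<eta>_def dist_norm norm_minus_commute intro!: power_mono)
  define D where "D z = p (fst z) (snd z) - e * h (fst z) (snd z)" for z
  have cD: "continuous_on X D" unfolding D_def h_def \<eta>_def \<rho>_def
    by (intro continuous_intros continuous_on_subset[OF cont[unfolded case_prod_unfold]])
       (auto simp: X_def)
  obtain z where z: "z \<in> X" "\<And>w. w \<in> X \<Longrightarrow> D z \<le> D w"
    using continuous_attains_inf[OF X _ cD] xt by blast
  obtain x1 r1 where z1: "z = (x1, r1)" by (cases z)
  have X1: "x1 \<in> cball y R" "s \<le> r1" "r1 \<le> t" "0 \<le> \<eta> x1 r1" using z(1) by (auto simp: X_def z1)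
  have "0 \<le> D z"
  proof (rule ccontr)
    assume neg: "\<not> 0 \<le> D z"
    have \<eta>1: "0 < \<eta> x1 r1"
    proof (rule ccontr)
      assume "\<not> 0 < \<eta> x1 r1"
      then have "D z = p x1 r1" using X1 by (simp add: D_def z1 h_def)
      then show False using neg nn[of x1 r1] X1 by simp
    qed
    have "s < r1"
    proof (rule ccontr)
      assume "\<not> s < r1"
      then have r1: "r1 = s" using X1 by simp
      have "(norm (x1 - y))\<^sup>2 \<le> r0\<^sup>2" using \<eta>1 by (simp add: \<eta>_def r1 \<rho>s)
      then have n: "norm (x1 - y) \<le> r0" using r0 by (simp add: power2_le_iff_abs_le)
      have "(\<eta> x1 s)\<^sup>2 \<le> (r0\<^sup>2)\<^sup>2" using X1 by (intro power_mono) (auto simp: \<eta>_def r1 \<rho>s)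
      then have "e * h x1 s \<le> e * (r0\<^sup>2)\<^sup>2" using e by (simp add: h_def)
      also have "\<dots> = p y s / 2" using r0 by (simp add: e_def)
      also have "\<dots> \<le> p x1 s" using init[OF n] .
      finally show False using neg by (simp add: D_def z1 r1)
    qed
    have "(norm (x1 - y))\<^sup>2 < R\<^sup>2" using \<eta>1 \<rho>b[of r1] X1 by (simp add: \<eta>_def)
    then have "norm (x1 - y) < R" using R by (simp add: power2_less_imp_less)
    then have xb: "x1 \<in> ball y R" by (simp add: dist_norm norm_minus_commute)
    obtain p' pl where p': "(p x1 has_real_derivative p') (at r1)" "has_lap (\<lambda>z. p z r1) x1 pl" "pl \<le> p'"
      using super[OF xb \<open>s < r1\<close> X1(3)] by blast
    define E where "E = exp (- a * (r1 - s))"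
    have E: "0 < E" by (simp add: E_def)
    define n where "n = (norm (x1 - y))\<^sup>2"
    define hl where "hl = E * (8 * n - 4 * real DIM('a) * \<eta> x1 r1)"
    define h' where "h' = E * (2 * \<eta> x1 r1 * k - a * (\<eta> x1 r1)\<^sup>2)"
    have lap: "has_lap (\<lambda>z. e * h z r1 - p z r1) x1 (e * hl - pl)"
      unfolding hl_def h_def \<eta>_def E_def[symmetric] n_def
      by (intro has_lap_diff has_lap_cmult has_lap_bump p')
    have dh: "((\<lambda>r. h x1 r) has_real_derivative h') (at r1)"
      unfolding h_def h'_def E_def \<eta>_def \<rho>_def
      by (auto intro!: derivative_eq_intros simp: algebra_simps power2_eq_square)
    have "\<forall>\<^sub>F z in nhds x1. z \<in> ball y R" using xb by (intro eventually_nhds_in_open) auto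
    moreover have "\<forall>\<^sub>F z in nhds x1. 0 < \<eta> z r1"
    proof -
      have "open {z. 0 < \<eta> z r1}" unfolding \<eta>_def by (intro open_Collect_less continuous_intros)
      from eventually_nhds_in_open[OF this, of x1] \<eta>1 show ?thesis by simp
    qed
    ultimately have "\<forall>\<^sub>F z in nhds x1. e * h z r1 - p z r1 \<le> e * h x1 r1 - p x1 r1"
    proof eventually_elim
      case (elim w)
      then have "(w, r1) \<in> X" using X1 by (auto simp: X_def)
      from z(2)[OF this] show ?case by (simp add: D_def z1)
    qed
    from has_lap_local_max[OF lap this] have 1: "e * hl \<le> pl" by simp
    have 2: "p' \<le> e * h'"
    proof (rule ccontr)
      assume "\<not> p' \<le> e * h'"
      have "((\<lambda>r. e * h x1 r - p x1 r) has_real_derivative e * h' - p') (at r1)"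
        by (intro DERIV_diff DERIV_cmult dh p')
      from DERIV_neg_dec_left[OF this] \<open>\<not> p' \<le> e * h'\<close>
      obtain \<delta> where \<delta>: "0 < \<delta>"
        "\<And>\<epsilon>. 0 < \<epsilon> \<Longrightarrow> \<epsilon> < \<delta> \<Longrightarrow> e * h x1 r1 - p x1 r1 < e * h x1 (r1 - \<epsilon>) - p x1 (r1 - \<epsilon>)" by auto
      \<comment> \<open>Backwards in time the bracket shrinks at rate \<open>k\<close>; the third
        bound keeps it nonnegative, so the earlier point still lies in \<open>X\<close>.\<close>
      define \<epsilon> where "\<epsilon> = Min {\<delta>, r1 - s, \<eta> x1 r1 / k} / 2"
      have m0: "0 < Min {\<delta>, r1 - s, \<eta> x1 r1 / k}" using \<delta> \<open>s < r1\<close> \<eta>1 k by simp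
      have m1: "Min {\<delta>, r1 - s, \<eta> x1 r1 / k} \<le> \<delta>" "Min {\<delta>, r1 - s, \<eta> x1 r1 / k} \<le> r1 - s"
        "Min {\<delta>, r1 - s, \<eta> x1 r1 / k} \<le> \<eta> x1 r1 / k" by auto
      have \<epsilon>: "0 < \<epsilon>" "\<epsilon> < \<delta>" "\<epsilon> \<le> r1 - s" "\<epsilon> \<le> \<eta> x1 r1 / k" using m0 m1 unfolding \<epsilon>_def by linarith+
      have "k * \<epsilon> \<le> \<eta> x1 r1" using \<epsilon>(4) k by (simp add: field_simps)
      then have "0 \<le> \<eta> x1 (r1 - \<epsilon>)" by (simp add: \<eta>_def \<rho>_def algebra_simps)
      then have "(x1, r1 - \<epsilon>) \<in> X" using X1 \<epsilon> by (auto simp: X_def)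
      from z(2)[OF this] \<delta>(2)[OF \<epsilon>(1,2)] show False by (simp add: D_def z1)
    qed
    have "e * hl \<le> e * h'" using 1 2 p'(3) by linarith
    then have "hl \<le> h'" using e by simp
    then have "8 * n - 4 * real DIM('a) * \<eta> x1 r1 \<le> 2 * \<eta> x1 r1 * k - a * (\<eta> x1 r1)\<^sup>2"
      using E by (simp add: hl_def h'_def)
    moreover have "n = \<rho> r1 - \<eta> x1 r1" by (simp add: \<eta>_def n_def)
    ultimately have "a * (\<eta> x1 r1)\<^sup>2 - B * \<eta> x1 r1 + 8 * \<rho> r1 \<le> 0" by (simp add: B_def algebra_simps)
    moreover have "0 \<le> (B / (4 * r0) * \<eta> x1 r1 - 2 * r0)\<^sup>2" by simp
    then have "0 \<le> a * (\<eta> x1 r1)\<^sup>2 - B * \<eta> x1 r1 + 4 * r0\<^sup>2"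
      using r0 by (simp add: a_def power2_diff power_mult_distrib field_simps power2_eq_square)
    moreover have "r0\<^sup>2 \<le> \<rho> r1" using \<rho>b X1 by simp
    moreover have "0 < r0\<^sup>2" using r0 by simp
    ultimately show False by linarith
  qed
  then have "0 \<le> D (x, t)" using z(2)[OF xt] by linarith
  moreover have "0 < h x t"
  proof -
    have "(norm (x - y))\<^sup>2 < R\<^sup>2" using x by (intro power_strict_mono) (auto simp: dist_norm norm_minus_commute)
    then show ?thesis by (simp add: h_def \<eta>_def \<rho>t)
  qed
  then have "0 < e * h x t" using e by simp
  ultimately show ?thesis unfolding D_def fst_conv snd_conv by linarith
qed

text \<open>The points that are positive at all times in \<open>(a, b]\<close> form a set which is
  open, and so is its complement in the domain, because positivity spreads over every ball compactly
  contained in the domain. Connectedness and the starting point \<open>x0\<close> finish the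
  proof.\<close>

lemma strong_maximum_principle:
  fixes \<Omega> :: "'a::euclidean_space set"
  assumes op: "open \<Omega>" and "connected \<Omega>"
    and cont: "continuous_on (\<Omega> \<times> {a..b}) (\<lambda>(x, r). p x r)"
    and nn: "\<And>x r. x \<in> \<Omega> \<Longrightarrow> a \<le> r \<Longrightarrow> r \<le> b \<Longrightarrow> 0 \<le> p x r"
    and super: "\<And>x r. x \<in> \<Omega> \<Longrightarrow> a < r \<Longrightarrow> r \<le> b \<Longrightarrow>
       \<exists>p' pl. (p x has_real_derivative p') (at r) \<and> has_lap (\<lambda>z. p z r) x pl \<and> pl \<le> p'"
    and x0: "x0 \<in> \<Omega>" "0 < p x0 a"
    and x: "x \<in> \<Omega>" "a < t" "t \<le> b"
  shows "0 < p x t"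
proof -
  have spread: "0 < p z t" if "cball y R \<subseteq> \<Omega>" "0 < R" "z \<in> ball y R" "0 < p y s" "a \<le> s" "s < t" "t \<le> b"
    for y z R s t
  proof (rule positivity_spreads_in_ball[where p = p and y = y and s = s and R = R])
    show "s < t" "0 < R" "0 < p y s" "z \<in> ball y R" using that by auto
    show "continuous_on (cball y R \<times> {s..t}) (\<lambda>(x, r). p x r)"
      by (rule continuous_on_subset[OF cont]) (use that in auto)
    show "0 \<le> p x r" if "x \<in> cball y R" "s \<le> r" "r \<le> t" for x r
      using that \<open>cball y R \<subseteq> \<Omega>\<close> \<open>a \<le> s\<close> \<open>t \<le> b\<close> by (intro nn) auto
    show "\<exists>p' pl. (p x has_real_derivative p') (at r) \<and> has_lap (\<lambda>z. p z r) x pl \<and> pl \<le> p'"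
      if "x \<in> ball y R" "s < r" "r \<le> t" for x r
      using that \<open>cball y R \<subseteq> \<Omega>\<close> \<open>a \<le> s\<close> \<open>t \<le> b\<close> ball_subset_cball by (intro super) auto
  qed
  define S where "S = {x\<in>\<Omega>. \<forall>t. a < t \<longrightarrow> t \<le> b \<longrightarrow> 0 < p x t}"
  have step: "z \<in> S" if "y \<in> S" "cball y R \<subseteq> \<Omega>" "0 < R" "z \<in> ball y R" for y z R
  proof -
    \<comment> \<open>Spreading takes arbitrarily little time, so starting from \<open>y\<close>
      halfway between \<open>a\<close> and \<open>t\<close> reaches every
      \<open>t > a\<close>.\<close>
    have "0 < p z t" if "a < t" "t \<le> b" for t
    proof (rule spread[of y R z "(a + t) / 2"])
      show "0 < p y ((a + t) / 2)" using \<open>y \<in> S\<close> that by (simp add: S_def)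
    qed (use that \<open>cball y R \<subseteq> \<Omega>\<close> \<open>0 < R\<close> \<open>z \<in> ball y R\<close> in auto)
    moreover have "z \<in> \<Omega>" using that ball_subset_cball by blast
    ultimately show ?thesis by (simp add: S_def)
  qed
  have nbhd: "\<exists>R>0. cball y R \<subseteq> \<Omega>" if "y \<in> \<Omega>" for y using op that open_contains_cball by blast
  have "open S"
    unfolding open_contains_ball
  proof
    fix y assume y: "y \<in> S"
    then obtain R where R: "0 < R" "cball y R \<subseteq> \<Omega>" using nbhd[of y] by (auto simp: S_def)
    then show "\<exists>e>0. ball y e \<subseteq> S" using step[OF y R(2,1)] by blast
  qed
  moreover have "open (\<Omega> - S)"
    unfolding open_contains_ball
  proof
    fix y assume y: "y \<in> \<Omega> - S"
    then obtain R where R: "0 < R" "cball y R \<subseteq> \<Omega>" using nbhd[of y] by auto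
    \<comment> \<open>Halving the radius lets the ball around \<open>w\<close> contain
      \<open>y\<close> and still stay inside the domain, so membership of \<open>w\<close> would
      carry back to \<open>y\<close>.\<close>
    have "w \<in> \<Omega> - S" if w: "w \<in> ball y (R/2)" for w
    proof
      show "w \<in> \<Omega>" using w R by (auto simp: subset_iff)
      show "w \<notin> S"
      proof
        assume "w \<in> S"
        moreover have "cball w (R/2) \<subseteq> cball y R"
        proof
          fix v assume "v \<in> cball w (R/2)"
          then show "v \<in> cball y R" using w dist_triangle[of y v w] by simp
        qed
        moreover have "y \<in> ball w (R/2)" using w by (simp add: dist_commute)
        ultimately have "y \<in> S" using step[of w "R/2" y] R by auto
        then show False using y by simp
      qed
    qed
    then show "\<exists>e>0. ball y e \<subseteq> \<Omega> - S" using R(1) by (intro exI[of _ "R/2"]) auto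
  qed
  moreover have "x0 \<in> S"
  proof -
    obtain R where "0 < R" "cball x0 R \<subseteq> \<Omega>" using nbhd[OF x0(1)] by blast
    then show ?thesis using spread[of x0 R x0 a] x0 by (auto simp: S_def)
  qed
  ultimately have "(\<Omega> - S) \<inter> \<Omega> = {}"
    using connectedD[OF \<open>connected \<Omega>\<close>, of S "\<Omega> - S"] x0(1) by blast
  then show ?thesis using x by (auto simp: S_def)
qed

section \<open>Comparison with stationary solutions\<close>

lemma weight_continuous:
  assumes "weight \<Omega> \<alpha>"
  shows "continuous_on (closure \<Omega>) \<alpha>"
proof -
  obtain \<gamma> C where \<gamma>: "0 < \<gamma>" and C: "\<forall>x\<in>closure \<Omega>. \<forall>y\<in>closure \<Omega>. \<bar>\<alpha> x - \<alpha> y\<bar> \<le> C * dist x y powr \<gamma>"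
    using assms unfolding weight_def hoelder_continuous_on_def by blast
  show ?thesis unfolding continuous_on_def
  proof
    fix x assume x: "x \<in> closure \<Omega>"
    have "((\<lambda>y. dist y x powr \<gamma>) \<longlongrightarrow> dist x x powr \<gamma>) (at x within closure \<Omega>)"
      using \<gamma> by (intro tendsto_powr' tendsto_intros) auto
    then have 0: "((\<lambda>y. C * dist y x powr \<gamma>) \<longlongrightarrow> 0) (at x within closure \<Omega>)"
      using tendsto_mult_right_zero[of _ _ C] by simp
    have "((\<lambda>y. \<alpha> y - \<alpha> x) \<longlongrightarrow> 0) (at x within closure \<Omega>)"
    proof (rule Lim_null_comparison[OF _ 0])
      show "\<forall>\<^sub>F y in at x within closure \<Omega>. norm (\<alpha> y - \<alpha> x) \<le> C * dist y x powr \<gamma>"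
        unfolding eventually_at_filter using C x by (intro always_eventually) auto
    qed
    then show "(\<alpha> \<longlongrightarrow> \<alpha> x) (at x within closure \<Omega>)" by (simp add: LIM_zero_iff)
  qed
qed

text \<open>Nontriviality only provides a point of the closure, possibly on the boundary; continuity
  moves it inside, where the equation is available.\<close>

lemma weight_pos_point:
  fixes \<Omega> :: "'a::euclidean_space set"
  assumes "weight \<Omega> \<alpha>"
  obtains x where "x \<in> \<Omega>" "0 < \<alpha> x"
proof -
  have "\<exists>x\<in>\<Omega>. 0 < \<alpha> x"
  proof (rule ccontr)
    assume "\<not> (\<exists>x\<in>\<Omega>. 0 < \<alpha> x)"
    then have le: "\<And>x. x \<in> \<Omega> \<Longrightarrow> \<alpha> x \<le> 0" by force
    have "\<alpha> x \<le> 0" if "x \<in> closure \<Omega>" for x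
      by (rule continuous_le_on_closure[OF weight_continuous[OF assms] that le])
    then show False using assms unfolding weight_def by (metis order_antisym)
  qed
  then show ?thesis using that by blast
qed

lemma solution_E_has_lap:
  assumes "solution_E \<Omega> f g \<alpha> \<beta> lam \<mu> w z" "open \<Omega>" "x \<in> \<Omega>"
  shows "has_lap w x (- (lam * \<alpha> x * f (z x)))"
proof -
  have "- laplacian w x = lam * \<alpha> x * f (z x)" using assms by (simp add: solution_E_def)
  then have "laplacian w x = - (lam * \<alpha> x * f (z x))" by simp
  moreover have "has_lap w x (laplacian w x)"
    using assms by (intro has_lap_C2) (auto simp: solution_E_def)
  ultimately show ?thesis by simp
qed

lemma solution_E_swap:
  "solution_E \<Omega> f g \<alpha> \<beta> lam \<mu> w z \<Longrightarrow> solution_E \<Omega> g f \<beta> \<alpha> \<mu> lam z w"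
  by (auto simp: solution_E_def)

locale parabolic_problem =
  fixes \<Omega> :: "'a::euclidean_space set" and f g :: "real \<Rightarrow> real" and \<alpha> \<beta> :: "'a \<Rightarrow> real"
    and lam \<mu> :: real and u0 v0 :: "'a \<Rightarrow> real" and u v :: "'a \<Rightarrow> real \<Rightarrow> real"
  assumes domain: "smooth_bounded_domain \<Omega>"
    and nl_f: "nonlinearity f" and nl_g: "nonlinearity g"
    and weight_\<alpha>: "weight \<Omega> \<alpha>" and weight_\<beta>: "weight \<Omega> \<beta>" and lam_pos: "0 < lam" and \<mu>_pos: "0 < \<mu>"
    and sol: "global_solution_P \<Omega> f g \<alpha> \<beta> lam \<mu> u0 v0 u v"
begin

text \<open>Exchanging the two equations maps the problem to itself. Lemmas on one component thus
  yield those on the other through an interpretation with exchanged roles.\<close>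

lemma swap: "parabolic_problem \<Omega> g f \<beta> \<alpha> \<mu> lam v0 u0 v u"
  using parabolic_problem_axioms
  unfolding parabolic_problem_def global_solution_P_def solution_P_def by auto

lemma open_\<Omega>: "open \<Omega>" and bounded_\<Omega>: "bounded \<Omega>" and connected_\<Omega>: "connected \<Omega>"
  using domain by (auto simp: smooth_bounded_domain_def)

lemma in_closure: "x \<in> \<Omega> \<Longrightarrow> x \<in> closure \<Omega>"
  using closure_subset by blast

lemma compact_closure_\<Omega>: "compact (closure \<Omega>)"
  using bounded_\<Omega> by simp

lemma closure_cases: "x \<in> closure \<Omega> \<Longrightarrow> x \<in> \<Omega> \<or> x \<in> frontier \<Omega>"
  using open_\<Omega> by (auto simp: frontier_def interior_open)

lemma frontier_closure: "x \<in> frontier \<Omega> \<Longrightarrow> x \<in> closure \<Omega>"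
  by (simp add: frontier_def)

lemma sol_T: "0 < T \<Longrightarrow> solution_P \<Omega> f g \<alpha> \<beta> lam \<mu> u0 v0 T u v"
  using sol by (simp add: global_solution_P_def)

section \<open>Elementary bounds on solutions and weights\<close>

lemma u_continuous:
  assumes "0 \<le> a"
  shows "continuous_on (closure \<Omega> \<times> {a..b}) (\<lambda>(x, t). u x t)"
proof -
  have "continuous_on (closure \<Omega> \<times> {0..<\<bar>b\<bar> + 1}) (\<lambda>(x, t). u x t)"
    using sol_T[of "\<bar>b\<bar> + 1"] by (simp add: solution_P_def)
  then show ?thesis by (rule continuous_on_subset) (use assms in auto)
qed

lemma u_range: "x \<in> closure \<Omega> \<Longrightarrow> 0 \<le> t \<Longrightarrow> 0 \<le> u x t \<and> u x t < 1"
  using sol_T[of "t + 1"] by (simp add: solution_P_def)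

lemma u_initial: "x \<in> \<Omega> \<Longrightarrow> u x 0 = u0 x"
  using sol_T[of 1] by (simp add: solution_P_def)

lemma u_equation:
  assumes x: "x \<in> \<Omega>" and t: "0 < t"
  obtains p' pl where "(u x has_real_derivative p') (at t)" "has_lap (\<lambda>y. u y t) x pl"
    "p' - pl = lam * \<alpha> x * f (v x t)"
proof -
  have s: "solution_P \<Omega> f g \<alpha> \<beta> lam \<mu> u0 v0 (t + 1) u v" using t by (intro sol_T) simp
  have "u x differentiable_on {0<..<t+1}" using s x by (simp add: solution_P_def C21_on_def)
  then have "u x differentiable (at t)"
    using t by (simp add: differentiable_on_eq_differentiable_at)
  then have "(u x has_real_derivative deriv (u x) t) (at t)"
    by (simp add: DERIV_deriv_iff_real_differentiable)
  moreover have "has_lap (\<lambda>y. u y t) x (laplacian (\<lambda>y. u y t) x)"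
    using s t by (intro has_lap_C2[OF _ open_\<Omega> x]) (simp add: solution_P_def C21_on_def)
  moreover have "deriv (u x) t - laplacian (\<lambda>y. u y t) x = lam * \<alpha> x * f (v x t)"
    using s x t by (simp add: solution_P_def)
  ultimately show ?thesis using that by blast
qed

text \<open>The boundary condition is imposed for positive times; continuity on the closed cylinder
  extends it to time 0.\<close>

lemma u_boundary:
  assumes x: "x \<in> frontier \<Omega>" and t: "0 \<le> t"
  shows "u x t = 0"
proof -
  have pos: "u x r = 0" if "0 < r" for r
    using sol_T[of "r + 1"] x that by (simp add: solution_P_def)
  have "continuous_on {0..1} (\<lambda>r. (\<lambda>(x, t). u x t) (x, r))"
    by (rule continuous_on_compose2[OF u_continuous[of 0 1]])
       (use frontier_closure[OF x] in \<open>auto intro!: continuous_intros\<close>)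
  then have "continuous_on (closure {0<..<1}) (u x)" by simp
  then have "u x 0 \<le> 0" by (rule continuous_le_on_closure) (use pos in auto)
  then show ?thesis using pos[of t] t u_range[OF frontier_closure[OF x], of 0] by (cases "t = 0") auto
qed

text \<open>On a finite time interval the solution attains its maximum, so it stays away from the
  singularity of the nonlinearities at 1.\<close>

lemma u_less_one:
  obtains m where "0 \<le> m" "m < 1" "\<And>x t. x \<in> closure \<Omega> \<Longrightarrow> 0 \<le> t \<Longrightarrow> t \<le> T \<Longrightarrow> u x t \<le> m"
proof (cases "closure \<Omega> \<times> {0..T} = {}")
  case True
  then show ?thesis by (intro that[of 0]) auto
next
  case False
  have "compact (closure \<Omega> \<times> {0..T})" using compact_closure_\<Omega> by (intro compact_Times) auto
  then obtain z where z: "z \<in> closure \<Omega> \<times> {0..T}"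
    "\<And>w. w \<in> closure \<Omega> \<times> {0..T} \<Longrightarrow> (\<lambda>(x, t). u x t) w \<le> (\<lambda>(x, t). u x t) z"
    using continuous_attains_sup[OF _ False u_continuous[of 0 T]] by force
  obtain x t where xt: "z = (x, t)" by (cases z)
  show ?thesis
  proof (rule that[of "u x t"])
    show "0 \<le> u x t" "u x t < 1" using u_range[of x t] z xt by auto
    show "u y r \<le> u x t" if "y \<in> closure \<Omega>" "0 \<le> r" "r \<le> T" for y r
      using z(2)[of "(y, r)"] that xt by auto
  qed
qed

lemma \<alpha>_bounds: "x \<in> closure \<Omega> \<Longrightarrow> 0 \<le> \<alpha> x"
  using weight_\<alpha> by (simp add: weight_def)

lemma \<alpha>_bounded:
  obtains A where "0 < A" "\<And>x. x \<in> closure \<Omega> \<Longrightarrow> lam * \<alpha> x \<le> A"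
proof -
  have "bounded (\<alpha> ` closure \<Omega>)"
    by (intro compact_imp_bounded compact_continuous_image weight_continuous[OF weight_\<alpha>] compact_closure_\<Omega>)
  then obtain B where B: "\<And>x. x \<in> closure \<Omega> \<Longrightarrow> \<bar>\<alpha> x\<bar> \<le> B" unfolding bounded_iff by (metis image_eqI real_norm_def)
  show ?thesis
  proof (rule that[of "lam * \<bar>B\<bar> + 1"])
    show "0 < lam * \<bar>B\<bar> + 1" using lam_pos by (simp add: add_nonneg_pos)
    fix x assume "x \<in> closure \<Omega>"
    then have "\<alpha> x \<le> \<bar>B\<bar>" using B[of x] by linarith
    then have "lam * \<alpha> x \<le> lam * \<bar>B\<bar>" using lam_pos by (intro mult_left_mono) auto
    then show "lam * \<alpha> x \<le> lam * \<bar>B\<bar> + 1" by simp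
  qed
qed

lemma solution_E_facts:
  assumes "solution_E \<Omega> f g \<alpha> \<beta> lam \<mu> w z"
  shows "continuous_on (closure \<Omega>) w" "x \<in> closure \<Omega> \<Longrightarrow> 0 \<le> w x \<and> w x < 1" "x \<in> frontier \<Omega> \<Longrightarrow> w x = 0"
    "x \<in> closure \<Omega> \<Longrightarrow> w x \<in> {0..<1}"
  using assms by (auto simp: solution_E_def)

lemma solution_E_less_one:
  assumes E: "solution_E \<Omega> f g \<alpha> \<beta> lam \<mu> w z"
  obtains m where "0 \<le> m" "m < 1" "\<And>x. x \<in> closure \<Omega> \<Longrightarrow> w x \<le> m"
proof -
  have "closure \<Omega> \<noteq> {}" using domain by (simp add: smooth_bounded_domain_def)
  then obtain y where "y \<in> closure \<Omega>" "\<And>x. x \<in> closure \<Omega> \<Longrightarrow> w x \<le> w y"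
    using continuous_attains_sup[OF compact_closure_\<Omega> _ solution_E_facts(1)[OF E]] by blast
  then show ?thesis using solution_E_facts(2)[OF E, of y] by (intro that[of "w y"]) auto
qed

text \<open>Exponential growth faster than the Lipschitz bound \<open>A * deriv01 f m\<close>
  outruns the reaction term. The tangent is taken at \<open>v x t\<close>, so \<open>f\<close> is
  never evaluated at the perturbed function, which may exceed 1.\<close>

lemma perturbed_solution_strict_sub:
  assumes E: "solution_E \<Omega> f g \<alpha> \<beta> lam \<mu> w z" and x: "x \<in> \<Omega>" and t: "0 < t"
    and m: "0 \<le> m" "m < 1" "v x t \<le> m" and A: "lam * \<alpha> x \<le> A" and k: "A * deriv01 f m < k"
    and \<delta>: "0 < \<delta>" and le: "v x t \<le> z x + \<delta> * exp (k * t)"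
  shows "strict_sub_at u (\<lambda>x t. w x + \<delta> * exp (k * t)) x t"
proof -
  obtain p' pl where p: "(u x has_real_derivative p') (at t)" "has_lap (\<lambda>y. u y t) x pl"
    "p' - pl = lam * \<alpha> x * f (v x t)" using u_equation[OF x t] by blast
  interpret S: parabolic_problem \<Omega> g f \<beta> \<alpha> \<mu> lam v0 u0 v u by (rule swap)
  have xc: "x \<in> closure \<Omega>" by (rule in_closure[OF x])
  have vr: "v x t \<in> {0..<1}" using S.u_range[OF xc, of t] t by simp
  have zr: "z x \<in> {0..<1}" by (rule S.solution_E_facts(4)[OF solution_E_swap[OF E] xc])
  define D where "D = \<delta> * exp (k * t)"
  have D: "0 < D" using \<delta> by (simp add: D_def)
  have F: "0 \<le> deriv01 f m" using m by (intro nonlinearity_deriv_nonneg[OF nl_f]) auto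
  have "f (v x t) - f (z x) \<le> deriv01 f m * D"
  proof (cases "v x t \<le> z x")
    case True
    then have "f (v x t) \<le> f (z x)" using nonlinearity_le[OF nl_f, of "v x t" "z x"] vr zr by auto
    then show ?thesis using F D by (smt (verit) mult_nonneg_nonneg)
  next
    case False
    have "f (v x t) - f (z x) \<le> deriv01 f (v x t) * (v x t - z x)"
      using nonlinearity_tangent[OF nl_f vr zr] by (simp add: algebra_simps)
    also have "\<dots> \<le> deriv01 f m * D"
      using False le vr m F nonlinearity_deriv_mono[OF nl_f, of "v x t" m]
      by (intro mult_mono) (auto simp: D_def)
    finally show ?thesis .
  qed
  then have "lam * \<alpha> x * (f (v x t) - f (z x)) \<le> lam * \<alpha> x * (deriv01 f m * D)"
    using lam_pos \<alpha>_bounds[OF xc] by (intro mult_left_mono) auto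
  also have "\<dots> \<le> A * (deriv01 f m * D)" using A F D by (intro mult_right_mono) auto
  also have "\<dots> < k * D" using k D by (simp add: mult.assoc[symmetric])
  finally have lt: "p' - pl < k * D - (- (lam * \<alpha> x * f (z x)) + 0)" using p(3) by (simp add: algebra_simps)
  show ?thesis unfolding strict_sub_at_def
  proof (intro exI conjI)
    show "((\<lambda>t. w x + \<delta> * exp (k * t)) has_real_derivative k * D) (at t)"
      by (auto intro!: derivative_eq_intros simp: D_def)
    show "upper_lap (\<lambda>y. w y + \<delta> * exp (k * t)) x (- (lam * \<alpha> x * f (z x)) + 0)"
      by (intro has_lap_imp_upper has_lap_add has_lap_const solution_E_has_lap[OF E open_\<Omega> x])
  qed (fact p lt)+
qed

lemma continuous_on_fst_closure:
  "continuous_on (closure \<Omega>) F \<Longrightarrow> continuous_on (closure \<Omega> \<times> I) (\<lambda>z. F (fst z))"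
  by (rule continuous_on_compose2[of "closure \<Omega>"]) (auto intro!: continuous_intros)

lemma continuous_on_snd_interval:
  "continuous_on I s \<Longrightarrow> continuous_on (X \<times> I) (\<lambda>z. s (snd z))"
  by (rule continuous_on_compose2[of I]) (auto intro!: continuous_intros)

text \<open>The lift \<open>\<delta> * exp (k * t)\<close> makes all inequalities strict, as the
  comparison principle demands. The time is fixed, so \<open>m\<close>, \<open>n\<close> and
  \<open>k\<close> may depend on it.\<close>

lemma stays_below_solution:
  assumes E: "solution_E \<Omega> f g \<alpha> \<beta> lam \<mu> w z" and le: "pair_le \<Omega> u0 v0 w z"
    and x: "x \<in> closure \<Omega>" and t: "0 \<le> t"
  shows "u x t \<le> w x \<and> v x t \<le> z x"
proof -
  interpret S: parabolic_problem \<Omega> g f \<beta> \<alpha> \<mu> lam v0 u0 v u by (rule swap)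
  have E': "solution_E \<Omega> g f \<beta> \<alpha> \<mu> lam z w" by (rule solution_E_swap[OF E])
  obtain m where m: "0 \<le> m" "m < 1" "\<And>x r. x \<in> closure \<Omega> \<Longrightarrow> 0 \<le> r \<Longrightarrow> r \<le> t \<Longrightarrow> u x r \<le> m"
    using u_less_one[of t] by blast
  obtain n where n: "0 \<le> n" "n < 1" "\<And>x r. x \<in> closure \<Omega> \<Longrightarrow> 0 \<le> r \<Longrightarrow> r \<le> t \<Longrightarrow> v x r \<le> n"
    using S.u_less_one[of t] by blast
  obtain A where A: "\<And>x. x \<in> closure \<Omega> \<Longrightarrow> lam * \<alpha> x \<le> A" using \<alpha>_bounded by blast
  obtain B where B: "\<And>x. x \<in> closure \<Omega> \<Longrightarrow> \<mu> * \<beta> x \<le> B" using S.\<alpha>_bounded by blast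
  define k where "k = max (A * deriv01 f n) (B * deriv01 g m) + 1"
  have init: "u x 0 \<le> w x \<and> v x 0 \<le> z x" if "x \<in> closure \<Omega>" for x
    using closure_cases[OF that]
  proof
    assume "x \<in> \<Omega>"
    then show ?thesis using le u_initial S.u_initial by (simp add: pair_le_def)
  next
    assume "x \<in> frontier \<Omega>"
    then show ?thesis using u_boundary S.u_boundary solution_E_facts[OF E] S.solution_E_facts[OF E'] by simp
  qed
  have lt: "u x t < w x + \<delta> * exp (k * t) \<and> v x t < z x + \<delta> * exp (k * t)" if \<delta>: "0 < \<delta>" for \<delta>
  proof (rule system_comparison[where \<Omega> = \<Omega> and p = u and q = v and A = "\<lambda>x t. w x + \<delta> * exp (k * t)"
        and B = "\<lambda>x t. z x + \<delta> * exp (k * t)" and a = 0 and b = t])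
    show "continuous_on (closure \<Omega> \<times> {0..t}) (\<lambda>(x, t). w x + \<delta> * exp (k * t))"
      "continuous_on (closure \<Omega> \<times> {0..t}) (\<lambda>(x, t). z x + \<delta> * exp (k * t))"
      unfolding case_prod_unfold
      by (intro continuous_intros continuous_on_fst_closure solution_E_facts(1)[OF E] S.solution_E_facts(1)[OF E'])+
    show "u x 0 < w x + \<delta> * exp (k * 0) \<and> v x 0 < z x + \<delta> * exp (k * 0)" if "x \<in> closure \<Omega>" for x
      using init[OF that] \<delta> by simp
    show "u x r < w x + \<delta> * exp (k * r) \<and> v x r < z x + \<delta> * exp (k * r)"
      if "x \<in> frontier \<Omega>" "0 < r" for x r
      using that \<delta> u_boundary S.u_boundary solution_E_facts[OF E] S.solution_E_facts[OF E'] by simp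
    show "strict_sub_at u (\<lambda>x t. w x + \<delta> * exp (k * t)) x r"
      if "x \<in> \<Omega>" "0 < r" "r \<le> t" "v x r \<le> z x + \<delta> * exp (k * r)" for x r
      using that in_closure[OF that(1)] n A \<delta>
      by (intro perturbed_solution_strict_sub[OF E, where m = n and A = A]) (auto simp: k_def)
    show "strict_sub_at v (\<lambda>x t. z x + \<delta> * exp (k * t)) x r"
      if "x \<in> \<Omega>" "0 < r" "r \<le> t" "u x r \<le> w x + \<delta> * exp (k * r)" for x r
      using that in_closure[OF that(1)] m B \<delta>
      by (intro S.perturbed_solution_strict_sub[OF E', where m = m and A = B]) (auto simp: k_def)
  qed (use open_\<Omega> bounded_\<Omega> x t u_continuous S.u_continuous in auto)
  \<comment> \<open>\<open>\<delta>\<close> is rescaled so that the lift at time \<open>t\<close> is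
    exactly \<open>\<epsilon>\<close>.\<close>
  have "u x t \<le> w x + \<epsilon> \<and> v x t \<le> z x + \<epsilon>" if "0 < \<epsilon>" for \<epsilon>
    using lt[of "\<epsilon> * exp (- (k * t))"] that by (simp add: mult.assoc exp_minus)
  then show ?thesis by (auto intro: field_le_epsilon)
qed

text \<open>The tangent of \<open>f\<close> at \<open>z x\<close> bounds
  \<open>f (z x) - f (v x t)\<close> by the linearized term whatever the sign or size of
  \<open>z x - v x t\<close>; no smallness is involved.\<close>

lemma lower_strict_sub:
  assumes E: "solution_E \<Omega> f g \<alpha> \<beta> lam \<mu> w z" and x: "x \<in> \<Omega>" and t: "0 < t"
    and l: "upper_lap \<Phi> x l" "l < - (lam * \<alpha> x * deriv01 f (z x) * \<Psi> x + \<nu> * \<Phi> x)"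
    and c: "0 < c" and le: "z x - v x t \<le> c * exp (- \<nu> * t) * \<Psi> x"
  shows "strict_sub_at (\<lambda>x t. w x - u x t) (\<lambda>x t. c * exp (- \<nu> * t) * \<Phi> x) x t"
proof -
  obtain p' pl where p: "(u x has_real_derivative p') (at t)" "has_lap (\<lambda>y. u y t) x pl"
    "p' - pl = lam * \<alpha> x * f (v x t)" using u_equation[OF x t] by blast
  interpret S: parabolic_problem \<Omega> g f \<beta> \<alpha> \<mu> lam v0 u0 v u by (rule swap)
  have xc: "x \<in> closure \<Omega>" by (rule in_closure[OF x])
  have vr: "v x t \<in> {0..<1}" using S.u_range[OF xc, of t] t by simp
  have zr: "z x \<in> {0..<1}" by (rule S.solution_E_facts(4)[OF solution_E_swap[OF E] xc])
  define D where "D = c * exp (- \<nu> * t)"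
  have D: "0 < D" using c by (simp add: D_def)
  have F: "0 \<le> deriv01 f (z x)" by (rule nonlinearity_deriv_nonneg[OF nl_f zr])
  have "f (z x) - f (v x t) \<le> deriv01 f (z x) * (z x - v x t)"
    using nonlinearity_tangent[OF nl_f zr vr] by (simp add: algebra_simps)
  also have "\<dots> \<le> deriv01 f (z x) * (D * \<Psi> x)" using le F by (intro mult_left_mono) (auto simp: D_def)
  finally have "lam * \<alpha> x * (f (z x) - f (v x t)) \<le> lam * \<alpha> x * (deriv01 f (z x) * (D * \<Psi> x))"
    using lam_pos \<alpha>_bounds[OF xc] by (intro mult_left_mono) auto
  moreover have "D * l < D * (- (lam * \<alpha> x * deriv01 f (z x) * \<Psi> x + \<nu> * \<Phi> x))" using l(2) D by simp
  ultimately have lt: "(0 - p') - (- (lam * \<alpha> x * f (z x)) - pl) < - \<nu> * D * \<Phi> x - D * l"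
    using p(3) by (simp add: algebra_simps)
  show ?thesis unfolding strict_sub_at_def
  proof (intro exI conjI)
    show "((\<lambda>t. w x - u x t) has_real_derivative 0 - p') (at t)" by (intro DERIV_diff DERIV_const p)
    show "((\<lambda>t. c * exp (- \<nu> * t) * \<Phi> x) has_real_derivative - \<nu> * D * \<Phi> x) (at t)"
      by (auto intro!: derivative_eq_intros simp: D_def)
    show "upper_lap (\<lambda>y. c * exp (- \<nu> * t) * \<Phi> y) x (D * l)"
      unfolding D_def[symmetric] by (rule upper_lap_cmult) (use l D in auto)
    show "has_lap (\<lambda>y. w y - u y t) x (- (lam * \<alpha> x * f (z x)) - pl)"
      by (intro has_lap_diff solution_E_has_lap[OF E open_\<Omega> x] p)
  qed (fact lt)
qed

text \<open>With the factor \<open>1 / e\<close> the supersolution is at least 1 initially, whereas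
  \<open>w - u\<close> and \<open>z - v\<close> are below 1 because all functions take values in
  \<open>[0,1)\<close>.\<close>

lemma lower_decay:
  assumes E: "solution_E \<Omega> f g \<alpha> \<beta> lam \<mu> w z"
    and e: "0 < e" and c\<Phi>: "continuous_on (closure \<Omega>) \<Phi>" and c\<Psi>: "continuous_on (closure \<Omega>) \<Psi>"
    and \<Phi>e: "\<And>x. x \<in> closure \<Omega> \<Longrightarrow> e \<le> \<Phi> x" and \<Psi>e: "\<And>x. x \<in> closure \<Omega> \<Longrightarrow> e \<le> \<Psi> x"
    and \<Phi>: "\<And>x. x \<in> \<Omega> \<Longrightarrow> \<exists>l. upper_lap \<Phi> x l \<and> l < - (lam * \<alpha> x * deriv01 f (z x) * \<Psi> x + \<nu> * \<Phi> x)"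
    and \<Psi>: "\<And>x. x \<in> \<Omega> \<Longrightarrow> \<exists>l. upper_lap \<Psi> x l \<and> l < - (\<mu> * \<beta> x * deriv01 g (w x) * \<Phi> x + \<nu> * \<Psi> x)"
    and x: "x \<in> closure \<Omega>" and t: "0 \<le> t"
  shows "w x - u x t < 1 / e * exp (- \<nu> * t) * \<Phi> x \<and> z x - v x t < 1 / e * exp (- \<nu> * t) * \<Psi> x"
proof -
  interpret S: parabolic_problem \<Omega> g f \<beta> \<alpha> \<mu> lam v0 u0 v u by (rule swap)
  have E': "solution_E \<Omega> g f \<beta> \<alpha> \<mu> lam z w" by (rule solution_E_swap[OF E])
  have pos: "0 < \<Phi> x" "0 < \<Psi> x" if "x \<in> closure \<Omega>" for x using \<Phi>e[OF that] \<Psi>e[OF that] e by auto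
  show ?thesis
  proof (rule system_comparison[where \<Omega> = \<Omega> and p = "\<lambda>x t. w x - u x t" and q = "\<lambda>x t. z x - v x t"
        and A = "\<lambda>x t. 1 / e * exp (- \<nu> * t) * \<Phi> x"
        and B = "\<lambda>x t. 1 / e * exp (- \<nu> * t) * \<Psi> x" and a = 0 and b = t])
    show "continuous_on (closure \<Omega> \<times> {0..t}) (\<lambda>(x, t). 1 / e * exp (- \<nu> * t) * \<Phi> x)"
      "continuous_on (closure \<Omega> \<times> {0..t}) (\<lambda>(x, t). 1 / e * exp (- \<nu> * t) * \<Psi> x)"
      "continuous_on (closure \<Omega> \<times> {0..t}) (\<lambda>(x, t). w x - u x t)"
      "continuous_on (closure \<Omega> \<times> {0..t}) (\<lambda>(x, t). z x - v x t)"
      unfolding case_prod_unfold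
      using u_continuous[of 0 t] S.u_continuous[of 0 t] e unfolding case_prod_unfold
      by (auto intro!: continuous_intros continuous_on_fst_closure solution_E_facts(1)[OF E]
          S.solution_E_facts(1)[OF E'] c\<Phi> c\<Psi>)
    show "w x - u x 0 < 1 / e * exp (- \<nu> * 0) * \<Phi> x \<and> z x - v x 0 < 1 / e * exp (- \<nu> * 0) * \<Psi> x"
      if "x \<in> closure \<Omega>" for x
    proof -
      have "1 \<le> 1 / e * \<Phi> x" "1 \<le> 1 / e * \<Psi> x" using \<Phi>e[OF that] \<Psi>e[OF that] e by (auto simp: field_simps)
      then show ?thesis
        using u_range[OF that, of 0] S.u_range[OF that, of 0] solution_E_facts(2)[OF E that]
          S.solution_E_facts(2)[OF E' that] by simp
    qed
    show "w x - u x r < 1 / e * exp (- \<nu> * r) * \<Phi> x \<and> z x - v x r < 1 / e * exp (- \<nu> * r) * \<Psi> x"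
      if "x \<in> frontier \<Omega>" "0 < r" for x r
      using that e pos[OF frontier_closure] u_boundary S.u_boundary solution_E_facts(3)[OF E] S.solution_E_facts(3)[OF E'] by simp
    show "strict_sub_at (\<lambda>x t. w x - u x t) (\<lambda>x t. 1 / e * exp (- \<nu> * t) * \<Phi> x) x r"
      if h: "x \<in> \<Omega>" "0 < r" "z x - v x r \<le> 1 / e * exp (- \<nu> * r) * \<Psi> x" for x r
    proof -
      obtain l where l: "upper_lap \<Phi> x l" "l < - (lam * \<alpha> x * deriv01 f (z x) * \<Psi> x + \<nu> * \<Phi> x)"
        using \<Phi>[OF h(1)] by blast
      have "0 < 1 / e" using e by simp
      from lower_strict_sub[where \<Phi> = \<Phi> and \<Psi> = \<Psi> and \<nu> = \<nu>, OF E h(1,2) l this h(3)] show ?thesis .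
    qed
    show "strict_sub_at (\<lambda>x t. z x - v x t) (\<lambda>x t. 1 / e * exp (- \<nu> * t) * \<Psi> x) x r"
      if h: "x \<in> \<Omega>" "0 < r" "w x - u x r \<le> 1 / e * exp (- \<nu> * r) * \<Phi> x" for x r
    proof -
      obtain l where l: "upper_lap \<Psi> x l" "l < - (\<mu> * \<beta> x * deriv01 g (w x) * \<Phi> x + \<nu> * \<Psi> x)"
        using \<Psi>[OF h(1)] by blast
      have "0 < 1 / e" using e by simp
      from S.lower_strict_sub[where \<Phi> = \<Psi> and \<Psi> = \<Phi> and \<nu> = \<nu>, OF E' h(1,2) l this h(3)] show ?thesis .
    qed
  qed (use open_\<Omega> bounded_\<Omega> x t in auto)
qed

section \<open>Strict ordering at positive times\<close>

lemma below_solution_super: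
  assumes E: "solution_E \<Omega> f g \<alpha> \<beta> lam \<mu> w z" and x: "x \<in> \<Omega>" and t: "0 < t" and le: "v x t \<le> z x"
  obtains p' pl where "((\<lambda>t. w x - u x t) has_real_derivative p') (at t)" "has_lap (\<lambda>y. w y - u y t) x pl"
    "p' - pl = lam * \<alpha> x * (f (z x) - f (v x t))" "pl \<le> p'"
proof -
  obtain p' pl where p: "(u x has_real_derivative p') (at t)" "has_lap (\<lambda>y. u y t) x pl"
    "p' - pl = lam * \<alpha> x * f (v x t)" using u_equation[OF x t] by blast
  interpret S: parabolic_problem \<Omega> g f \<beta> \<alpha> \<mu> lam v0 u0 v u by (rule swap)
  have xc: "x \<in> closure \<Omega>" by (rule in_closure[OF x])
  have vr: "v x t \<in> {0..<1}" using S.u_range[OF xc, of t] t by simp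
  have zr: "z x \<in> {0..<1}" by (rule S.solution_E_facts(4)[OF solution_E_swap[OF E] xc])
  have e: "(0 - p') - (- (lam * \<alpha> x * f (z x)) - pl) = lam * \<alpha> x * (f (z x) - f (v x t))"
    using p(3) by (simp add: algebra_simps)
  have "f (v x t) \<le> f (z x)" using le vr zr by (intro nonlinearity_le[OF nl_f]) auto
  then have "0 \<le> lam * \<alpha> x * (f (z x) - f (v x t))" using lam_pos \<alpha>_bounds[OF xc] by simp
  then have "- (lam * \<alpha> x * f (z x)) - pl \<le> 0 - p'" using e by linarith
  moreover have "((\<lambda>t. w x - u x t) has_real_derivative 0 - p') (at t)" by (intro DERIV_diff DERIV_const p)
  moreover have "has_lap (\<lambda>y. w y - u y t) x (- (lam * \<alpha> x * f (z x)) - pl)"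
      by (intro has_lap_diff solution_E_has_lap[OF E open_\<Omega> x] p)
  ultimately show ?thesis using e that by blast
qed

lemma strictly_below_persists:
  assumes E: "solution_E \<Omega> f g \<alpha> \<beta> lam \<mu> w z" and le: "pair_le \<Omega> u0 v0 w z"
    and x0: "x0 \<in> \<Omega>" "u x0 a < w x0" and a: "0 \<le> a" and x: "x \<in> \<Omega>" and t: "a < t"
  shows "u x t < w x"
proof -
  interpret S: parabolic_problem \<Omega> g f \<beta> \<alpha> \<mu> lam v0 u0 v u by (rule swap)
  have below: "u y r \<le> w y \<and> v y r \<le> z y" if "y \<in> \<Omega>" "0 \<le> r" for y r
    by (rule stays_below_solution[OF E le in_closure[OF that(1)] that(2)])
  have "0 < w x - u x t"
  proof (rule strong_maximum_principle[OF open_\<Omega> connected_\<Omega>, where p = "\<lambda>x t. w x - u x t" and a = a and b = t])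
    have "continuous_on (closure \<Omega> \<times> {a..t}) (\<lambda>(x, r). w x - u x r)"
      unfolding case_prod_unfold using u_continuous[OF a, of t] unfolding case_prod_unfold
      by (auto intro!: continuous_intros continuous_on_fst_closure solution_E_facts(1)[OF E])
    then show "continuous_on (\<Omega> \<times> {a..t}) (\<lambda>(x, r). w x - u x r)"
      by (rule continuous_on_subset) (use in_closure in auto)
    show "\<exists>p' pl. ((\<lambda>t. w x - u x t) has_real_derivative p') (at r) \<and> has_lap (\<lambda>z. w z - u z r) x pl \<and> pl \<le> p'"
      if "x \<in> \<Omega>" "a < r" for x r
      using below_solution_super[OF E that(1), of r] below[OF that(1), of r] that a by (metis less_imp_le less_le_trans not_le)
  qed (use below a x0 x t in auto)
  then show ?thesis by simp
qed

text \<open>Once \<open>v < z\<close> everywhere, the source of the equation for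
  \<open>w - u\<close> is positive at a point \<open>y\<close> with \<open>\<alpha> y > 0\<close>.
  Were \<open>u = w\<close> at \<open>y\<close> over a time interval, the time derivative there
  would vanish while \<open>w - u\<close> has a spatial minimum, which forces that source to be
  nonpositive. So \<open>u\<close> falls below \<open>w\<close> at \<open>y\<close> at some time
  before \<open>t\<close>, and strictness persists.\<close>

lemma strictly_below_transfers:
  assumes E: "solution_E \<Omega> f g \<alpha> \<beta> lam \<mu> w z" and le: "pair_le \<Omega> u0 v0 w z"
    and x0: "x0 \<in> \<Omega>" "v x0 0 < z x0" and x: "x \<in> \<Omega>" and t: "0 < t"
  shows "u x t < w x"
proof -
  interpret S: parabolic_problem \<Omega> g f \<beta> \<alpha> \<mu> lam v0 u0 v u by (rule swap)
  have E': "solution_E \<Omega> g f \<beta> \<alpha> \<mu> lam z w" by (rule solution_E_swap[OF E])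
  have le': "pair_le \<Omega> v0 u0 z w" using le by (simp add: pair_le_def)
  have below: "u y r \<le> w y \<and> v y r \<le> z y" if "y \<in> \<Omega>" "0 \<le> r" for y r
    by (rule stays_below_solution[OF E le in_closure[OF that(1)] that(2)])
  have vz: "v y r < z y" if "y \<in> \<Omega>" "0 < r" for y r
    by (rule S.strictly_below_persists[OF E' le' x0 _ that]) simp
  obtain y where y: "y \<in> \<Omega>" "0 < \<alpha> y" by (rule weight_pos_point[OF weight_\<alpha>])
  have "\<exists>r. 0 < r \<and> r < t \<and> u y r < w y"
  proof (rule ccontr)
    assume "\<not> (\<exists>r. 0 < r \<and> r < t \<and> u y r < w y)"
    then have eq: "u y r = w y" if "0 < r" "r < t" for r using below[OF y(1), of r] that by force
    define r where "r = t / 2"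
    have r: "0 < r" "r < t" using t by (auto simp: r_def)
    have vy: "v y r \<le> z y" using below[OF y(1), of r] r by simp
    obtain p' pl where p: "((\<lambda>t. w y - u y t) has_real_derivative p') (at r)" "has_lap (\<lambda>x. w x - u x r) y pl"
      "p' - pl = lam * \<alpha> y * (f (z y) - f (v y r))"
      by (rule below_solution_super[OF E y(1) r(1) vy])
    have "((\<lambda>t. w y - u y t) has_real_derivative 0) (at r)"
    proof (rule has_field_derivative_transform_within_open[of "\<lambda>t. 0" _ _ "{0<..<t}"])
      show "\<And>s. s \<in> {0<..<t} \<Longrightarrow> 0 = w y - u y s" using eq by auto
    qed (use r in auto)
    then have "p' = 0" using p(1) DERIV_unique by blast
    moreover have "- pl \<le> 0"
    proof (rule has_lap_local_max)
      show "has_lap (\<lambda>x. u x r - w x) y (- pl)" using has_lap_cmult[OF p(2), of "-1"] by simp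
      show "\<forall>\<^sub>F x in nhds y. u x r - w x \<le> u y r - w y"
        using eventually_nhds_in_open[OF open_\<Omega> y(1)]
        by eventually_elim (use below r eq in auto)
    qed
    ultimately have "lam * \<alpha> y * (f (z y) - f (v y r)) \<le> 0" using p(3) by simp
    moreover have "f (v y r) < f (z y)"
      using vz[OF y(1) r(1)] S.u_range[OF in_closure[OF y(1)], of r] r
        S.solution_E_facts(2)[OF E' in_closure[OF y(1)]] by (intro nonlinearity_less[OF nl_f]) auto
    ultimately show False using lam_pos y(2) by (simp add: mult_le_0_iff)
  qed
  then obtain r where r: "0 < r" "r < t" "u y r < w y" by blast
  show ?thesis by (rule strictly_below_persists[OF E le y(1) r(3) _ x r(2)]) (use r in simp)
qed

end

section \<open>Interpolation between two stationary solutions\<close>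

context parabolic_problem
begin

text \<open>The Laplacians of \<open>w\<close> and \<open>w1\<close> interpolate linearly in
  \<open>s\<close>, matching the right side of \<open>defect\<close>, and the term linear in
  \<open>\<tau>\<close> cancels against the linearized operator. What remains is the margin
  \<open>\<tau> * \<nu> * \<Phi>\<close>; \<open>slack\<close> says that it pays for the motion of
  \<open>s\<close> and \<open>\<tau>\<close> and for the error
  \<open>\<tau> * \<epsilon>\<close>.\<close>

lemma interpolating_strict_sub:
  assumes E: "solution_E \<Omega> f g \<alpha> \<beta> lam \<mu> w z" and E1: "solution_E \<Omega> f g \<alpha> \<beta> lam \<mu> w1 z1"
    and x: "x \<in> \<Omega>" and t: "0 < t"
    and l: "upper_lap \<Phi> x l" "l < - (lam * \<alpha> x * deriv01 f (z x) * \<Psi> x + \<nu> * \<Phi> x)"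
    and s: "(s has_real_derivative s') (at t)" and \<tau>: "(\<tau> has_real_derivative \<tau>') (at t)" "0 < \<tau> t"
    and A: "lam * \<alpha> x \<le> A" and \<epsilon>: "0 \<le> \<epsilon>"
    and le: "v x t \<le> z x + s t * (z1 x - z x) + \<tau> t * \<Psi> x"
    and defect: "z x + s t * (z1 x - z x) + \<tau> t * \<Psi> x < 1"
      "f (z x + s t * (z1 x - z x) + \<tau> t * \<Psi> x)
        \<le> (1 - s t) * f (z x) + s t * f (z1 x) + \<tau> t * (deriv01 f (z x) * \<Psi> x) + \<tau> t * \<epsilon>"
    and slack: "A * (\<tau> t * \<epsilon>) \<le> s' * (w1 x - w x) + \<tau>' * \<Phi> x + \<tau> t * \<nu> * \<Phi> x"
  shows "strict_sub_at u (\<lambda>x t. w x + s t * (w1 x - w x) + \<tau> t * \<Phi> x) x t"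
proof -
  obtain p' pl where p: "(u x has_real_derivative p') (at t)" "has_lap (\<lambda>y. u y t) x pl"
    "p' - pl = lam * \<alpha> x * f (v x t)" using u_equation[OF x t] by blast
  interpret S: parabolic_problem \<Omega> g f \<beta> \<alpha> \<mu> lam v0 u0 v u by (rule swap)
  have xc: "x \<in> closure \<Omega>" by (rule in_closure[OF x])
  have vr: "v x t \<in> {0..<1}" using S.u_range[OF xc, of t] t by simp
  define L where "L = - (lam * \<alpha> x * f (z x)) + s t * (- (lam * \<alpha> x * f (z1 x)) - - (lam * \<alpha> x * f (z x))) + \<tau> t * l"
  have la: "0 \<le> lam * \<alpha> x" using lam_pos \<alpha>_bounds[OF xc] by simp
  have "f (v x t) \<le> f (z x + s t * (z1 x - z x) + \<tau> t * \<Psi> x)"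
    using le vr defect(1) by (intro nonlinearity_le[OF nl_f]) auto
  then have "f (v x t) \<le> (1 - s t) * f (z x) + s t * f (z1 x) + \<tau> t * (deriv01 f (z x) * \<Psi> x) + \<tau> t * \<epsilon>"
    using defect(2) by linarith
  from mult_left_mono[OF this la]
  have 1: "p' - pl \<le> lam * \<alpha> x * ((1 - s t) * f (z x) + s t * f (z1 x) + \<tau> t * (deriv01 f (z x) * \<Psi> x))
      + lam * \<alpha> x * (\<tau> t * \<epsilon>)" unfolding p(3) by (simp only: distrib_left)
  have 2: "lam * \<alpha> x * (\<tau> t * \<epsilon>) \<le> A * (\<tau> t * \<epsilon>)" using A \<tau>(2) \<epsilon> by (intro mult_right_mono) auto
  have 3: "\<tau> t * l < \<tau> t * (- (lam * \<alpha> x * deriv01 f (z x) * \<Psi> x + \<nu> * \<Phi> x))" using l(2) \<tau>(2) by simp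
  have lt: "p' - pl < s' * (w1 x - w x) + \<tau>' * \<Phi> x - L"
    using 1 2 3 slack unfolding L_def by (simp add: algebra_simps)
  show ?thesis unfolding strict_sub_at_def
  proof (intro exI conjI)
    show "((\<lambda>t. w x + s t * (w1 x - w x) + \<tau> t * \<Phi> x) has_real_derivative s' * (w1 x - w x) + \<tau>' * \<Phi> x) (at t)"
      by (auto intro!: derivative_eq_intros s \<tau>)
    show "upper_lap (\<lambda>y. w y + s t * (w1 y - w y) + \<tau> t * \<Phi> y) x L"
      unfolding L_def using \<tau>(2)
      by (intro upper_lap_add_has_lap upper_lap_cmult has_lap_add has_lap_cmult has_lap_diff
          solution_E_has_lap[OF E open_\<Omega> x] solution_E_has_lap[OF E1 open_\<Omega> x] l) simp
  qed (fact p lt)+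
qed

text \<open>Near the boundary the gap \<open>c (1 - s) \<Phi>\<close> dominates \<open>(1 - s) (w1 - w)\<close> because \<open>\<Phi>\<close> is bounded
  below there; on the remaining compact set \<open>u\<close> is uniformly below \<open>w1\<close>. So no Hopf lemma is needed.\<close>

lemma below_interpolation:
  assumes E: "solution_E \<Omega> f g \<alpha> \<beta> lam \<mu> w z" and E1: "solution_E \<Omega> f g \<alpha> \<beta> lam \<mu> w1 z1"
    and t: "0 \<le> t" and lt: "\<And>x. x \<in> \<Omega> \<Longrightarrow> u x t < w1 x"
    and le: "\<And>x. x \<in> closure \<Omega> \<Longrightarrow> w x \<le> w1 x"
    and e: "0 < e" "0 < c" and \<Phi>: "\<And>x. x \<in> closure \<Omega> \<Longrightarrow> e \<le> \<Phi> x"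
  obtains s0 where "s0 < 1" "\<And>s x. s0 \<le> s \<Longrightarrow> s < 1 \<Longrightarrow> x \<in> closure \<Omega> \<Longrightarrow>
     u x t < w x + s * (w1 x - w x) + c * (1 - s) * \<Phi> x"
proof -
  note cw = solution_E_facts(1)[OF E] solution_E_facts(1)[OF E1]
  define K where "K = closure \<Omega> \<inter> (\<lambda>x. w1 x - w x) -` {c * e..}"
  have "closed K" unfolding K_def by (intro continuous_closed_preimage continuous_intros cw) auto
  moreover have "bounded K" using bounded_\<Omega> by (auto simp: K_def intro: bounded_subset bounded_closure)
  ultimately have K: "compact K" by (simp add: compact_eq_bounded_closed)
  have K\<Omega>: "x \<in> \<Omega>" if "x \<in> K" for x
  proof (rule ccontr)
    assume "x \<notin> \<Omega>"
    then have "w1 x - w x = 0"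
      using that closure_cases[of x] solution_E_facts(3)[OF E] solution_E_facts(3)[OF E1] by (auto simp: K_def)
    then have "c * e \<le> 0" using that by (simp add: K_def)
    then show False using e by (simp add: mult_le_0_iff)
  qed
  have "continuous_on (closure \<Omega>) (\<lambda>x. (\<lambda>(x, t). u x t) (x, t))"
    by (rule continuous_on_compose2[OF u_continuous[OF t, of t]]) (auto intro!: continuous_intros)
  then have cu: "continuous_on (closure \<Omega>) (\<lambda>x. u x t)" by simp
  have "\<exists>d>0. \<forall>x\<in>K. u x t \<le> w1 x - d"
  proof (cases "K = {}")
    case False
    have "continuous_on K (\<lambda>x. w1 x - u x t)"
      by (rule continuous_on_subset[of "closure \<Omega>"]) (auto intro!: continuous_intros cu cw simp: K_def)
    from continuous_attains_inf[OF K False this]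
    obtain y where "y \<in> K" "\<forall>x\<in>K. w1 y - u y t \<le> w1 x - u x t" by blast
    then show ?thesis using lt[of y] K\<Omega>[of y] by (intro exI[of _ "w1 y - u y t"]) (auto simp: algebra_simps)
  qed (auto intro: exI[of _ 1])
  then obtain d where d: "0 < d" "\<And>x. x \<in> K \<Longrightarrow> u x t \<le> w1 x - d" by blast
  show ?thesis
  \<comment> \<open>Since \<open>w1 - w \<le> 1\<close>, the interpolation lies below
    \<open>w1\<close> by at most \<open>1 - s\<close>, hence by at most the distance
    \<open>d\<close> that \<open>u\<close> keeps on \<open>K\<close>.\<close>
  proof (rule that[of "1 - d"])
    fix s x assume s: "1 - d \<le> s" "s < 1" and x: "x \<in> closure \<Omega>"
    define \<xi> where "\<xi> = w1 x - w x"
    have \<xi>: "0 \<le> \<xi>" "\<xi> \<le> 1" using le[OF x] solution_E_facts(2)[OF E x] solution_E_facts(2)[OF E1 x]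
      by (auto simp: \<xi>_def)
    have eq: "w x + s * (w1 x - w x) = w1 x - (1 - s) * \<xi>" by (simp add: \<xi>_def algebra_simps)
    have g: "0 < c * (1 - s) * e" "c * (1 - s) * e \<le> c * (1 - s) * \<Phi> x"
      using e s \<Phi>[OF x] by (auto intro!: mult_left_mono)
    show "u x t < w x + s * (w1 x - w x) + c * (1 - s) * \<Phi> x"
    proof (cases "x \<in> K")
      case True
      have "(1 - s) * \<xi> \<le> d * 1" using s \<xi> d by (intro mult_mono) auto
      then show ?thesis unfolding eq using d(2)[OF True] g by linarith
    next
      case False
      then have "\<xi> < c * e" using x by (simp add: K_def \<xi>_def)
      then have "(1 - s) * \<xi> < (1 - s) * (c * e)" using s by (intro mult_strict_left_mono) auto
      moreover have "u x t \<le> w1 x"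
        using closure_cases[OF x] lt[of x] u_boundary[OF _ t] solution_E_facts(3)[OF E1] by force
      moreover have "(1 - s) * (c * e) = c * (1 - s) * e" by simp
      ultimately show ?thesis unfolding eq using g(2) by linarith
    qed
  qed (use d in auto)
qed

end

locale interpolation = parabolic_problem \<Omega> f g \<alpha> \<beta> lam \<mu> u0 v0 u v
  for \<Omega> :: "'a::euclidean_space set" and f g \<alpha> \<beta> lam \<mu> u0 v0 u v +
  fixes w z w1 z1 :: "'a \<Rightarrow> real" and \<Phi> \<Psi> :: "'a \<Rightarrow> real" and e R \<nu> A \<epsilon> c :: real
  assumes E: "solution_E \<Omega> f g \<alpha> \<beta> lam \<mu> w z" and E1: "solution_E \<Omega> f g \<alpha> \<beta> lam \<mu> w1 z1"
    and le: "\<And>x. x \<in> closure \<Omega> \<Longrightarrow> w x \<le> w1 x \<and> z x \<le> z1 x"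
    and e: "0 < e" and \<nu>: "0 < \<nu>" and \<epsilon>: "0 \<le> \<epsilon>" "A * \<epsilon> \<le> \<nu> * e / 4" and c: "0 < c"
    and c\<Phi>: "continuous_on (closure \<Omega>) \<Phi>" and c\<Psi>: "continuous_on (closure \<Omega>) \<Psi>"
    and \<Phi>e: "\<And>x. x \<in> closure \<Omega> \<Longrightarrow> e \<le> \<Phi> x \<and> \<Phi> x \<le> R"
    and \<Psi>e: "\<And>x. x \<in> closure \<Omega> \<Longrightarrow> e \<le> \<Psi> x \<and> \<Psi> x \<le> R"
    and \<Phi>: "\<And>x. x \<in> \<Omega> \<Longrightarrow> \<exists>l. upper_lap \<Phi> x l \<and> l < - (lam * \<alpha> x * deriv01 f (z x) * \<Psi> x + \<nu> * \<Phi> x)"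
    and \<Psi>: "\<And>x. x \<in> \<Omega> \<Longrightarrow> \<exists>l. upper_lap \<Psi> x l \<and> l < - (\<mu> * \<beta> x * deriv01 g (w x) * \<Phi> x + \<nu> * \<Psi> x)"
    and A: "\<And>x. x \<in> closure \<Omega> \<Longrightarrow> lam * \<alpha> x \<le> A \<and> \<mu> * \<beta> x \<le> A"
    and defect_f: "\<And>x s \<tau>. x \<in> closure \<Omega> \<Longrightarrow> 0 \<le> s \<Longrightarrow> s \<le> 1 \<Longrightarrow> 0 \<le> \<tau> \<Longrightarrow> \<tau> \<le> c * (1 - s) \<Longrightarrow>
        z x + s * (z1 x - z x) + \<tau> * \<Psi> x < 1 \<and> f (z x + s * (z1 x - z x) + \<tau> * \<Psi> x)
        \<le> (1 - s) * f (z x) + s * f (z1 x) + \<tau> * (deriv01 f (z x) * \<Psi> x) + \<tau> * \<epsilon>"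
    and defect_g: "\<And>x s \<tau>. x \<in> closure \<Omega> \<Longrightarrow> 0 \<le> s \<Longrightarrow> s \<le> 1 \<Longrightarrow> 0 \<le> \<tau> \<Longrightarrow> \<tau> \<le> c * (1 - s) \<Longrightarrow>
        w x + s * (w1 x - w x) + \<tau> * \<Phi> x < 1 \<and> g (w x + s * (w1 x - w x) + \<tau> * \<Phi> x)
        \<le> (1 - s) * g (w x) + s * g (w1 x) + \<tau> * (deriv01 g (w x) * \<Phi> x) + \<tau> * \<epsilon>"
begin

text \<open>The margin \<open>\<nu> * \<tau> * F\<close> is split up: half covers the decrease of
  \<open>\<tau>\<close>. The other half is at least \<open>\<nu> * e / 2 * \<tau>\<close> and is
  shared equally by the decrease of \<open>s\<close> and the convexity error.\<close>

lemma slack: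
  assumes \<xi>: "0 \<le> \<xi>" "\<xi> \<le> 1" and F: "e \<le> F" and \<tau>: "0 < \<tau>"
    and s': "- (\<nu> * e / 4) * \<tau> \<le> s'" and \<tau>': "- (\<nu> / 2) * \<tau> \<le> \<tau>'"
  shows "A * (\<tau> * \<epsilon>) \<le> s' * \<xi> + \<tau>' * F + \<tau> * \<nu> * F"
proof -
  have "(- (\<nu> * e / 4) * \<tau>) * \<xi> \<le> s' * \<xi>" using s' \<xi> by (intro mult_right_mono) auto
  moreover have "\<nu> * e / 4 * \<tau> * \<xi> \<le> \<nu> * e / 4 * \<tau> * 1" using \<xi> \<nu> e \<tau> by (intro mult_left_mono) auto
  moreover have "(- (\<nu> / 2) * \<tau>) * F \<le> \<tau>' * F" using \<tau>' F e by (intro mult_right_mono) auto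
  moreover have "\<nu> / 2 * \<tau> * e \<le> \<nu> / 2 * \<tau> * F" using F \<nu> \<tau> by (intro mult_left_mono) auto
  moreover have "A * \<epsilon> * \<tau> \<le> \<nu> * e / 4 * \<tau>" using \<epsilon>(2) \<tau> by (intro mult_right_mono) auto
  ultimately show ?thesis by (simp add: algebra_simps)
qed

text \<open>Both stages are instances, with \<open>s\<close> moving and \<open>\<tau>\<close> fixed,
  or \<open>s = 0\<close> and \<open>\<tau>\<close> decaying. On the boundary the stationary terms
  vanish and \<open>\<tau> * \<Phi>\<close> alone gives strictness.\<close>

lemma interpolating_comparison:
  assumes a: "0 \<le> a" and cs: "continuous_on {a..b} s" "continuous_on {a..b} \<tau>"
    and ds: "\<And>t. a < t \<Longrightarrow> t \<le> b \<Longrightarrow> (s has_real_derivative s' t) (at t) \<and> - (\<nu> * e / 4) * \<tau> t \<le> s' t"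
    and d\<tau>: "\<And>t. a < t \<Longrightarrow> t \<le> b \<Longrightarrow> (\<tau> has_real_derivative \<tau>' t) (at t) \<and> - (\<nu> / 2) * \<tau> t \<le> \<tau>' t"
    and s: "\<And>t. a \<le> t \<Longrightarrow> t \<le> b \<Longrightarrow> 0 \<le> s t \<and> s t \<le> 1"
    and \<tau>: "\<And>t. a \<le> t \<Longrightarrow> t \<le> b \<Longrightarrow> 0 < \<tau> t \<and> \<tau> t \<le> c * (1 - s t)"
    and init: "\<And>x. x \<in> closure \<Omega> \<Longrightarrow> u x a < w x + s a * (w1 x - w x) + \<tau> a * \<Phi> x \<and>
       v x a < z x + s a * (z1 x - z x) + \<tau> a * \<Psi> x"
    and x: "x \<in> closure \<Omega>" and t: "a \<le> t" "t \<le> b"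
  shows "u x t < w x + s t * (w1 x - w x) + \<tau> t * \<Phi> x \<and> v x t < z x + s t * (z1 x - z x) + \<tau> t * \<Psi> x"
proof -
  interpret S: parabolic_problem \<Omega> g f \<beta> \<alpha> \<mu> lam v0 u0 v u by (rule swap)
  have E': "solution_E \<Omega> g f \<beta> \<alpha> \<mu> lam z w" by (rule solution_E_swap[OF E])
  have E1': "solution_E \<Omega> g f \<beta> \<alpha> \<mu> lam z1 w1" by (rule solution_E_swap[OF E1])
  have rng: "0 \<le> w1 x - w x" "w1 x - w x \<le> 1" "0 \<le> z1 x - z x" "z1 x - z x \<le> 1" if "x \<in> closure \<Omega>" for x
    using le[OF that] solution_E_facts(2)[OF E that] solution_E_facts(2)[OF E1 that]
      S.solution_E_facts(2)[OF E' that] S.solution_E_facts(2)[OF E1' that] by auto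
  show ?thesis
  proof (rule system_comparison[where \<Omega> = \<Omega> and p = u and q = v
        and A = "\<lambda>x t. w x + s t * (w1 x - w x) + \<tau> t * \<Phi> x"
        and B = "\<lambda>x t. z x + s t * (z1 x - z x) + \<tau> t * \<Psi> x" and a = a and b = b])
    show "continuous_on (closure \<Omega> \<times> {a..b}) (\<lambda>(x, t). w x + s t * (w1 x - w x) + \<tau> t * \<Phi> x)"
      "continuous_on (closure \<Omega> \<times> {a..b}) (\<lambda>(x, t). z x + s t * (z1 x - z x) + \<tau> t * \<Psi> x)"
      unfolding case_prod_unfold
      by (intro continuous_on_add continuous_on_mult continuous_on_diff continuous_on_fst_closure
          continuous_on_snd_interval cs c\<Phi> c\<Psi> solution_E_facts(1)[OF E] solution_E_facts(1)[OF E1]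
          S.solution_E_facts(1)[OF E'] S.solution_E_facts(1)[OF E1'])+
    show "u y r < w y + s r * (w1 y - w y) + \<tau> r * \<Phi> y \<and> v y r < z y + s r * (z1 y - z y) + \<tau> r * \<Psi> y"
      if h: "y \<in> frontier \<Omega>" "a < r" "r \<le> b" for y r
    proof -
      have "0 < \<tau> r" "0 < \<Phi> y" "0 < \<Psi> y"
        using \<tau>[of r] \<Phi>e[OF frontier_closure[OF h(1)]] \<Psi>e[OF frontier_closure[OF h(1)]] e h by auto
      then show ?thesis
        using u_boundary[OF h(1), of r] S.u_boundary[OF h(1), of r] h a solution_E_facts(3)[OF E h(1)]
          solution_E_facts(3)[OF E1 h(1)] S.solution_E_facts(3)[OF E' h(1)] S.solution_E_facts(3)[OF E1' h(1)]
        by simp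
    qed
    show "strict_sub_at u (\<lambda>x t. w x + s t * (w1 x - w x) + \<tau> t * \<Phi> x) y r"
      if h: "y \<in> \<Omega>" "a < r" "r \<le> b" "v y r \<le> z y + s r * (z1 y - z y) + \<tau> r * \<Psi> y" for y r
    proof -
      have yc: "y \<in> closure \<Omega>" by (rule in_closure[OF h(1)])
      have r: "0 < r" "a \<le> r" using a h by auto
      note sr = s[OF r(2) h(3)] and \<tau>r = \<tau>[OF r(2) h(3)]
      note df = defect_f[OF yc conjunct1[OF sr] conjunct2[OF sr] less_imp_le[OF conjunct1[OF \<tau>r]] conjunct2[OF \<tau>r]]
      obtain l where l: "upper_lap \<Phi> y l" "l < - (lam * \<alpha> y * deriv01 f (z y) * \<Psi> y + \<nu> * \<Phi> y)"
        using \<Phi>[OF h(1)] by blast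
      show ?thesis
        by (rule interpolating_strict_sub[where \<Psi> = \<Psi> and \<nu> = \<nu> and s' = "s' r" and \<tau>' = "\<tau>' r" and A = A and \<epsilon> = \<epsilon>,
              OF E E1 h(1) r(1) l])
           (use ds[OF h(2,3)] d\<tau>[OF h(2,3)] \<tau>r A[OF yc] \<epsilon> h(4) df rng[OF yc] \<Phi>e[OF yc]
             in \<open>auto intro!: slack\<close>)
    qed
    show "strict_sub_at v (\<lambda>x t. z x + s t * (z1 x - z x) + \<tau> t * \<Psi> x) y r"
      if h: "y \<in> \<Omega>" "a < r" "r \<le> b" "u y r \<le> w y + s r * (w1 y - w y) + \<tau> r * \<Phi> y" for y r
    proof -
      have yc: "y \<in> closure \<Omega>" by (rule in_closure[OF h(1)])
      have r: "0 < r" "a \<le> r" using a h by auto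
      note sr = s[OF r(2) h(3)] and \<tau>r = \<tau>[OF r(2) h(3)]
      note df = defect_g[OF yc conjunct1[OF sr] conjunct2[OF sr] less_imp_le[OF conjunct1[OF \<tau>r]] conjunct2[OF \<tau>r]]
      obtain l where l: "upper_lap \<Psi> y l" "l < - (\<mu> * \<beta> y * deriv01 g (w y) * \<Phi> y + \<nu> * \<Psi> y)"
        using \<Psi>[OF h(1)] by blast
      show ?thesis
        by (rule S.interpolating_strict_sub[where \<Psi> = \<Phi> and \<nu> = \<nu> and s' = "s' r" and \<tau>' = "\<tau>' r" and A = A and \<epsilon> = \<epsilon>,
              OF E' E1' h(1) r(1) l])
           (use ds[OF h(2,3)] d\<tau>[OF h(2,3)] \<tau>r A[OF yc] \<epsilon> h(4) df rng[OF yc] \<Psi>e[OF yc]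
             in \<open>auto intro!: slack\<close>)
    qed
  qed (use open_\<Omega> bounded_\<Omega> x t a init u_continuous S.u_continuous in auto)
qed

lemma upper_decay:
  assumes lt: "\<And>x. x \<in> \<Omega> \<Longrightarrow> u x 1 < w1 x \<and> v x 1 < z1 x"
  obtains C T where "1 \<le> T" "0 \<le> C"
    "\<And>x t. x \<in> closure \<Omega> \<Longrightarrow> T \<le> t \<Longrightarrow> u x t - w x \<le> C * exp (- (\<nu> / 2) * t) \<and> v x t - z x \<le> C * exp (- (\<nu> / 2) * t)"
proof -
  interpret S: parabolic_problem \<Omega> g f \<beta> \<alpha> \<mu> lam v0 u0 v u by (rule swap)
  have E': "solution_E \<Omega> g f \<beta> \<alpha> \<mu> lam z w" by (rule solution_E_swap[OF E])
  have E1': "solution_E \<Omega> g f \<beta> \<alpha> \<mu> lam z1 w1" by (rule solution_E_swap[OF E1])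
  have one: "0 \<le> (1::real)" by simp
  obtain su where su: "su < 1" "\<And>s x. su \<le> s \<Longrightarrow> s < 1 \<Longrightarrow> x \<in> closure \<Omega> \<Longrightarrow>
     u x 1 < w x + s * (w1 x - w x) + c * (1 - s) * \<Phi> x"
    by (rule below_interpolation[where t = 1 and e = e and c = c and \<Phi> = \<Phi>, OF E E1 one _ _ e c])
       (use lt le \<Phi>e in auto)
  obtain sv where sv: "sv < 1" "\<And>s x. sv \<le> s \<Longrightarrow> s < 1 \<Longrightarrow> x \<in> closure \<Omega> \<Longrightarrow>
     v x 1 < z x + s * (z1 x - z x) + c * (1 - s) * \<Psi> x"
    by (rule S.below_interpolation[where t = 1 and e = e and c = c and \<Phi> = \<Psi>, OF E' E1' one _ _ e c])
       (use lt le \<Psi>e in auto)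
  define s2 where "s2 = max 0 (max su sv)"
  have s2: "0 \<le> s2" "s2 < 1" "su \<le> s2" "sv \<le> s2" using su sv by (auto simp: s2_def)
  \<comment> \<open>The largest value allowed when \<open>s = s2\<close>. The bound
    \<open>c * (1 - s)\<close> only grows while \<open>s\<close> decreases, so the same
    \<open>\<tau>\<close> serves throughout the first stage.\<close>
  define \<tau> where "\<tau> = c * (1 - s2)"
  have \<tau>: "0 < \<tau>" "\<tau> \<le> c" using c s2 by (auto simp: \<tau>_def mult_left_le)
  \<comment> \<open>The fastest descent of \<open>s\<close> that the budget permits;
    \<open>T\<close> is the time at which \<open>s\<close> reaches 0.\<close>
  define \<kappa> where "\<kappa> = \<nu> * e / 4 * \<tau>"
  have \<kappa>: "0 < \<kappa>" using \<nu> e \<tau> by (simp add: \<kappa>_def)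
  define T where "T = 1 + s2 / \<kappa>"
  have T: "1 \<le> T" "\<kappa> * (T - 1) = s2" using s2 \<kappa> by (auto simp: T_def)
  have stage1: "u x t < w x + (s2 - \<kappa> * (t - 1)) * (w1 x - w x) + \<tau> * \<Phi> x \<and>
      v x t < z x + (s2 - \<kappa> * (t - 1)) * (z1 x - z x) + \<tau> * \<Psi> x" if "x \<in> closure \<Omega>" "1 \<le> t" "t \<le> T" for x t
  proof (rule interpolating_comparison[where a = 1 and b = T and s = "\<lambda>t. s2 - \<kappa> * (t - 1)" and \<tau> = "\<lambda>t. \<tau>"
        and s' = "\<lambda>t. - \<kappa>" and \<tau>' = "\<lambda>t. 0"])
    show "((\<lambda>t. s2 - \<kappa> * (t - 1)) has_real_derivative - \<kappa>) (at r) \<and> - (\<nu> * e / 4) * \<tau> \<le> - \<kappa>" for r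
      by (auto intro!: derivative_eq_intros simp: \<kappa>_def)
    have b: "\<kappa> * (r - 1) \<le> s2" if "r \<le> T" for r
    proof -
      have "\<kappa> * (r - 1) \<le> \<kappa> * (T - 1)" using that \<kappa> by (intro mult_left_mono) auto
      then show ?thesis using T by simp
    qed
    show "0 \<le> s2 - \<kappa> * (r - 1) \<and> s2 - \<kappa> * (r - 1) \<le> 1" if "1 \<le> r" "r \<le> T" for r
      using b[OF that(2)] s2 that \<kappa> by (smt (verit) mult_nonneg_nonneg)
    show "0 < \<tau> \<and> \<tau> \<le> c * (1 - (s2 - \<kappa> * (r - 1)))" if "1 \<le> r" for r
    proof -
      have "c * (1 - s2) \<le> c * (1 - (s2 - \<kappa> * (r - 1)))" using that \<kappa> c by (intro mult_left_mono) auto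
      then show ?thesis using \<tau> by (simp add: \<tau>_def)
    qed
    show "u x 1 < w x + (s2 - \<kappa> * (1 - 1)) * (w1 x - w x) + \<tau> * \<Phi> x \<and>
       v x 1 < z x + (s2 - \<kappa> * (1 - 1)) * (z1 x - z x) + \<tau> * \<Psi> x" if "x \<in> closure \<Omega>" for x
      using su(2)[OF s2(3,2) that] sv(2)[OF s2(4,2) that] by (simp add: \<tau>_def)
  qed (use that \<tau> \<nu> in \<open>auto intro!: continuous_intros\<close>)
  \<comment> \<open>With \<open>s = 0\<close> the comparison function is
    \<open>w + \<tau> * \<Phi>\<close>, and \<open>\<tau>\<close> may decay at rate
    \<open>\<nu> / 2\<close>, its full share of the budget.\<close>
  have stage2: "u x t < w x + 0 * (w1 x - w x) + (\<tau> * exp (- (\<nu> / 2) * (t - T))) * \<Phi> x \<and>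
      v x t < z x + 0 * (z1 x - z x) + (\<tau> * exp (- (\<nu> / 2) * (t - T))) * \<Psi> x"
    if "x \<in> closure \<Omega>" "T \<le> t" for x t
  proof (rule interpolating_comparison[where a = T and b = t and s = "\<lambda>t. 0"
        and \<tau> = "\<lambda>t. \<tau> * exp (- (\<nu> / 2) * (t - T))"
        and s' = "\<lambda>t. 0" and \<tau>' = "\<lambda>t. - (\<nu> / 2) * (\<tau> * exp (- (\<nu> / 2) * (t - T)))"])
    show "((\<lambda>t. \<tau> * exp (- (\<nu> / 2) * (t - T))) has_real_derivative - (\<nu> / 2) * (\<tau> * exp (- (\<nu> / 2) * (r - T)))) (at r) \<and>
      - (\<nu> / 2) * (\<tau> * exp (- (\<nu> / 2) * (r - T))) \<le> - (\<nu> / 2) * (\<tau> * exp (- (\<nu> / 2) * (r - T)))" for r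
      by (auto intro!: derivative_eq_intros)
    show "0 < \<tau> * exp (- (\<nu> / 2) * (r - T)) \<and> \<tau> * exp (- (\<nu> / 2) * (r - T)) \<le> c * (1 - 0)" if "T \<le> r" for r
    proof -
      have "\<tau> * exp (- (\<nu> / 2) * (r - T)) \<le> \<tau> * 1"
        using \<tau> \<nu> that by (intro mult_left_mono) (auto simp: mult_le_0_iff)
      then have "\<tau> * exp (- (\<nu> / 2) * (r - T)) \<le> c" using \<tau> by linarith
      moreover have "0 < \<tau> * exp (- (\<nu> / 2) * (r - T))" using \<tau> by simp
      ultimately show ?thesis by simp
    qed
    show "u x T < w x + 0 * (w1 x - w x) + \<tau> * exp (- (\<nu> / 2) * (T - T)) * \<Phi> x \<and>
       v x T < z x + 0 * (z1 x - z x) + \<tau> * exp (- (\<nu> / 2) * (T - T)) * \<Psi> x" if "x \<in> closure \<Omega>" for x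
      using stage1[OF that T(1) order_refl] T(2) by simp
  qed (use that \<tau> \<nu> e T in \<open>auto intro!: continuous_intros\<close>)
  have "\<Omega> \<noteq> {}" using domain by (simp add: smooth_bounded_domain_def)
  then have R: "0 \<le> R" using \<Phi>e[OF in_closure] e by force
  show ?thesis
  proof (rule that[of T "\<tau> * exp (\<nu> / 2 * T) * R"])
    fix x t assume x: "x \<in> closure \<Omega>" and t: "T \<le> t"
    define D where "D = \<tau> * exp (- (\<nu> / 2) * (t - T))"
    have D: "0 < D" using \<tau> by (simp add: D_def)
    have "- (\<nu> / 2) * (t - T) = \<nu> / 2 * T + - (\<nu> / 2) * t" by (simp add: field_simps)
    then have eq: "\<tau> * exp (\<nu> / 2 * T) * R * exp (- (\<nu> / 2) * t) = D * R"
      unfolding D_def by (simp only: exp_add) (simp add: mult_ac)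
    have "D * \<Phi> x \<le> D * R" "D * \<Psi> x \<le> D * R" using \<Phi>e[OF x] \<Psi>e[OF x] D by (auto intro!: mult_left_mono)
    then show "u x t - w x \<le> \<tau> * exp (\<nu> / 2 * T) * R * exp (- (\<nu> / 2) * t) \<and>
      v x t - z x \<le> \<tau> * exp (\<nu> / 2 * T) * R * exp (- (\<nu> / 2) * t)"
      using stage2[OF x t] unfolding eq D_def[symmetric] by simp
  qed (use T \<tau> R in auto)
qed

end

section \<open>Exponential decay\<close>

lemma L2_norm_power2_le:
  fixes \<Omega> :: "'a::euclidean_space set"
  assumes "open \<Omega>" "bounded \<Omega>" and F: "\<And>x. x \<in> \<Omega> \<Longrightarrow> \<bar>F x\<bar> \<le> D"
  shows "(L2_norm \<Omega> F)\<^sup>2 \<le> measure lebesgue \<Omega> * D\<^sup>2"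
proof -
  have lm: "\<Omega> \<in> lmeasurable" using assms by (simp add: lmeasurable_open)
  have 0: "(L2_norm \<Omega> F)\<^sup>2 = (\<integral>x. \<bar>F x\<bar>\<^sup>2 \<partial>lebesgue_on \<Omega>)"
    unfolding L2_norm_def by (simp add: integral_nonneg_AE)
  also have "\<dots> \<le> measure lebesgue \<Omega> * D\<^sup>2"
  proof (cases "integrable (lebesgue_on \<Omega>) (\<lambda>x. \<bar>F x\<bar>\<^sup>2)")
    case True
    interpret finite_measure "lebesgue_on \<Omega>" using lm by (rule finite_measure_lebesgue_on)
    have "(\<integral>x. \<bar>F x\<bar>\<^sup>2 \<partial>lebesgue_on \<Omega>) \<le> (\<integral>x. D\<^sup>2 \<partial>lebesgue_on \<Omega>)"
      by (intro integral_mono True integrable_const power_mono) (use F in auto)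
    also have "\<dots> = measure lebesgue \<Omega> * D\<^sup>2"
      using lm by (simp add: measure_restrict_space fmeasurableD)
    finally show ?thesis .
  \<comment> \<open>The integral of a non-integrable function is 0 by convention, so the bound is
    trivial in this case.\<close>
  qed (simp add: not_integrable_integral_eq)
  finally show ?thesis .
qed

text \<open>The constant is traded for rate: as \<open>\<theta> < 2 * \<nu>\<close>, the factor
  \<open>exp ((2 * \<nu> - \<theta>) * t)\<close> eventually exceeds any constant.\<close>

lemma L2_decay:
  fixes \<Omega> :: "'a::euclidean_space set"
  assumes "open \<Omega>" "bounded \<Omega>" and C: "0 \<le> C" and \<nu>: "0 < \<nu>" "0 < \<theta>"
    and F: "\<And>x t. x \<in> \<Omega> \<Longrightarrow> T \<le> t \<Longrightarrow> \<bar>F x t\<bar> \<le> C * exp (- \<nu> * t)"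
    and G: "\<And>x t. x \<in> \<Omega> \<Longrightarrow> T \<le> t \<Longrightarrow> \<bar>G x t\<bar> \<le> C * exp (- \<nu> * t)"
    and \<theta>: "\<theta> < 2 * \<nu>"
  shows "\<exists>T0>0. \<forall>t>T0. (L2_norm \<Omega> (\<lambda>x. F x t))\<^sup>2 + (L2_norm \<Omega> (\<lambda>x. G x t))\<^sup>2 \<le> exp (- \<theta> * t)"
proof -
  define V where "V = 2 * (measure lebesgue \<Omega> * C\<^sup>2)"
  have V: "0 \<le> V" by (simp add: V_def)
  \<comment> \<open>From \<open>V / (2 * \<nu> - \<theta>)\<close> on, the bound
    \<open>y \<le> exp y\<close> suffices to absorb \<open>V\<close>; the absolute value and the 1
    make \<open>T0\<close> positive.\<close>
  define T0 where "T0 = \<bar>T\<bar> + V / (2 * \<nu> - \<theta>) + 1"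
  have "0 \<le> V / (2 * \<nu> - \<theta>)" using V \<theta> by simp
  then have T0: "0 < T0" "T \<le> T0" "V / (2 * \<nu> - \<theta>) \<le> T0" unfolding T0_def by linarith+
  have "(L2_norm \<Omega> (\<lambda>x. F x t))\<^sup>2 + (L2_norm \<Omega> (\<lambda>x. G x t))\<^sup>2 \<le> exp (- \<theta> * t)" if t: "T0 < t" for t
  proof -
    have "(L2_norm \<Omega> (\<lambda>x. F x t))\<^sup>2 + (L2_norm \<Omega> (\<lambda>x. G x t))\<^sup>2
      \<le> measure lebesgue \<Omega> * (C * exp (- \<nu> * t))\<^sup>2 + measure lebesgue \<Omega> * (C * exp (- \<nu> * t))\<^sup>2"
      by (intro add_mono L2_norm_power2_le assms) (use t T0 in auto)
    also have "\<dots> = V * exp (- (2 * \<nu>) * t)"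
      by (simp add: V_def power_mult_distrib exp_double[symmetric] mult.assoc)
    also have "V \<le> exp ((2 * \<nu> - \<theta>) * t)"
    proof -
      have "V / (2 * \<nu> - \<theta>) \<le> t" using t T0 by simp
      then have "V \<le> (2 * \<nu> - \<theta>) * t" using \<theta> by (simp add: field_simps)
      also have "\<dots> \<le> exp ((2 * \<nu> - \<theta>) * t)" using exp_ge_add_one_self[of "(2 * \<nu> - \<theta>) * t"] by linarith
      finally show ?thesis .
    qed
    then have "V * exp (- (2 * \<nu>) * t) \<le> exp ((2 * \<nu> - \<theta>) * t) * exp (- (2 * \<nu>) * t)"
      by (intro mult_right_mono) auto
    also have "\<dots> = exp (- \<theta> * t)" unfolding exp_add[symmetric] by (simp add: algebra_simps)
    finally show ?thesis .
  qed
  then show ?thesis using T0(1) by blast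
qed

context parabolic_problem
begin

lemma exponential_decay:
  assumes min: "minimal_solution_E \<Omega> f g \<alpha> \<beta> lam \<mu> w z"
    and ini: "pair_le \<Omega> u0 v0 w z \<or>
       solution_E \<Omega> f g \<alpha> \<beta> lam \<mu> w1 z1 \<and> pair_le \<Omega> u0 v0 w1 z1 \<and> \<not> pair_eq \<Omega> u0 v0 w1 z1"
    and \<nu>1: "0 < \<nu>1" and ev: "linearized_eigenpair \<Omega> f g \<alpha> \<beta> lam \<mu> w z \<nu>1 \<phi> \<psi>"
    and pos: "\<forall>x\<in>\<Omega>. 0 < \<phi> x \<and> 0 < \<psi> x"
  shows "\<exists>C T. 0 \<le> C \<and> (\<forall>x\<in>\<Omega>. \<forall>t\<ge>T. \<bar>u x t - w x\<bar> \<le> C * exp (- (3 / 8 * \<nu>1) * t) \<and>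
     \<bar>v x t - z x\<bar> \<le> C * exp (- (3 / 8 * \<nu>1) * t))"
proof -
  interpret S: parabolic_problem \<Omega> g f \<beta> \<alpha> \<mu> lam v0 u0 v u by (rule swap)
  have E: "solution_E \<Omega> f g \<alpha> \<beta> lam \<mu> w z" using min by (simp add: minimal_solution_E_def)
  have E': "solution_E \<Omega> g f \<beta> \<alpha> \<mu> lam z w" by (rule solution_E_swap[OF E])
  \<comment> \<open>Any factor strictly between 1/2 and 1 would do: \<open>\<nu> < \<nu>1\<close> is
    needed for the supersolution, and the squared rate \<open>2 * (\<nu> / 2) = \<nu>\<close> has to
    exceed \<open>\<nu>1 / 2\<close>.\<close>
  define \<nu> where "\<nu> = 3 / 4 * \<nu>1"
  have \<nu>: "0 < \<nu>" "\<nu> < \<nu>1" using \<nu>1 by (auto simp: \<nu>_def)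
  have \<nu>2: "\<nu> / 2 = 3 / 8 * \<nu>1" by (simp add: \<nu>_def)
  have ca: "continuous_on (closure \<Omega>) (\<lambda>x. lam * \<alpha> x * deriv01 f (z x))"
    by (intro continuous_intros weight_continuous[OF weight_\<alpha>]
        continuous_on_compose2[OF nonlinearity_deriv_continuous[OF nl_f] S.solution_E_facts(1)[OF E']])
       (use S.solution_E_facts(2)[OF E'] in auto)
  have cb: "continuous_on (closure \<Omega>) (\<lambda>x. \<mu> * \<beta> x * deriv01 g (w x))"
    by (intro continuous_intros weight_continuous[OF weight_\<beta>]
        continuous_on_compose2[OF nonlinearity_deriv_continuous[OF nl_g] solution_E_facts(1)[OF E]])
       (use solution_E_facts(2)[OF E] in auto)
  have a0: "0 \<le> lam * \<alpha> x * deriv01 f (z x)" and b0: "0 \<le> \<mu> * \<beta> x * deriv01 g (w x)" if "x \<in> \<Omega>" for x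
    using in_closure[OF that] lam_pos \<mu>_pos \<alpha>_bounds S.\<alpha>_bounds
      nonlinearity_deriv_nonneg[OF nl_f S.solution_E_facts(4)[OF E']]
      nonlinearity_deriv_nonneg[OF nl_g solution_E_facts(4)[OF E]] by auto
  obtain \<Phi> \<Psi> e R where e: "0 < e" and cont: "continuous_on (closure \<Omega>) \<Phi>" "continuous_on (closure \<Omega>) \<Psi>"
    and \<Phi>e: "\<And>x. x \<in> closure \<Omega> \<Longrightarrow> e \<le> \<Phi> x \<and> \<Phi> x \<le> R" and \<Psi>e: "\<And>x. x \<in> closure \<Omega> \<Longrightarrow> e \<le> \<Psi> x \<and> \<Psi> x \<le> R"
    and \<Phi>: "\<And>x. x \<in> \<Omega> \<Longrightarrow> \<exists>l. upper_lap \<Phi> x l \<and> l < - (lam * \<alpha> x * deriv01 f (z x) * \<Psi> x + \<nu> * \<Phi> x)"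
    and \<Psi>: "\<And>x. x \<in> \<Omega> \<Longrightarrow> \<exists>l. upper_lap \<Psi> x l \<and> l < - (\<mu> * \<beta> x * deriv01 g (w x) * \<Phi> x + \<nu> * \<Psi> x)"
  proof (rule positive_strict_supersolution[OF domain ca cb a0 b0, of \<phi> \<psi> \<nu>1 \<nu>])
    show "Ck_on 2 \<Omega> \<phi>" "continuous_on (closure \<Omega>) \<phi>" "Ck_on 2 \<Omega> \<psi>" "continuous_on (closure \<Omega>) \<psi>"
      using ev by (auto simp: linearized_eigenpair_def)
    show "\<phi> x = 0 \<and> \<psi> x = 0" if "x \<in> frontier \<Omega>" for x
      using ev that by (simp add: linearized_eigenpair_def)
    show "- laplacian \<phi> x - lam * \<alpha> x * deriv01 f (z x) * \<psi> x = \<nu>1 * \<phi> x \<and>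
       - laplacian \<psi> x - \<mu> * \<beta> x * deriv01 g (w x) * \<phi> x = \<nu>1 * \<psi> x" if "x \<in> \<Omega>" for x
      using ev that by (simp add: linearized_eigenpair_def)
  qed (use pos \<nu> in auto)
  have "\<Omega> \<noteq> {}" using domain by (simp add: smooth_bounded_domain_def)
  then have R: "0 < R" using \<Phi>e[OF in_closure] e by force
  \<comment> \<open>The lower bound decays at the full rate \<open>\<nu>\<close>; it is weakened to
    \<open>\<nu> / 2\<close> to match the upper bound.\<close>
  have lower: "w x - u x t \<le> R / e * exp (- (\<nu> / 2) * t) \<and> z x - v x t \<le> R / e * exp (- (\<nu> / 2) * t)"
    if x: "x \<in> closure \<Omega>" and t: "0 \<le> t" for x t
  proof -
    have b: "1 / e * exp (- \<nu> * t) * F \<le> R / e * exp (- (\<nu> / 2) * t)" if "F \<le> R" for F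
    proof -
      have "1 / e * exp (- \<nu> * t) * F \<le> 1 / e * exp (- \<nu> * t) * R" using that e by (intro mult_left_mono) auto
      also have "\<dots> = R / e * exp (- \<nu> * t)" by simp
      also have "\<dots> \<le> R / e * exp (- (\<nu> / 2) * t)"
        using R e \<nu> t by (intro mult_left_mono) auto
      finally show ?thesis .
    qed
    have "w x - u x t < 1 / e * exp (- \<nu> * t) * \<Phi> x \<and> z x - v x t < 1 / e * exp (- \<nu> * t) * \<Psi> x"
      by (rule lower_decay[OF E e cont _ _ \<Phi> \<Psi> x t]) (use \<Phi>e \<Psi>e in auto)
    then show ?thesis using b[of "\<Phi> x"] b[of "\<Psi> x"] \<Phi>e[OF x] \<Psi>e[OF x] by linarith
  qed
  have "\<exists>C T. 0 \<le> C \<and> (\<forall>x\<in>closure \<Omega>. \<forall>t\<ge>T. u x t - w x \<le> C * exp (- (\<nu> / 2) * t) \<and>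
     v x t - z x \<le> C * exp (- (\<nu> / 2) * t))"
    using ini
  proof
    assume "pair_le \<Omega> u0 v0 w z"
    then show ?thesis using stays_below_solution[OF E]
      by (intro exI[of _ 0]) auto
  next
    assume ii: "solution_E \<Omega> f g \<alpha> \<beta> lam \<mu> w1 z1 \<and> pair_le \<Omega> u0 v0 w1 z1 \<and> \<not> pair_eq \<Omega> u0 v0 w1 z1"
    then have E1: "solution_E \<Omega> f g \<alpha> \<beta> lam \<mu> w1 z1" and ple: "pair_le \<Omega> u0 v0 w1 z1" by auto
    have E1': "solution_E \<Omega> g f \<beta> \<alpha> \<mu> lam z1 w1" by (rule solution_E_swap[OF E1])
    have ple': "pair_le \<Omega> v0 u0 z1 w1" using ple by (simp add: pair_le_def)
    have le: "w x \<le> w1 x \<and> z x \<le> z1 x" if "x \<in> closure \<Omega>" for x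
      using closure_cases[OF that]
    proof
      assume "x \<in> \<Omega>"
      then show ?thesis using min E1 by (simp add: minimal_solution_E_def pair_le_def)
    next
      assume "x \<in> frontier \<Omega>"
      then show ?thesis using solution_E_facts(3)[OF E] solution_E_facts(3)[OF E1]
          S.solution_E_facts(3)[OF E'] S.solution_E_facts(3)[OF E1'] by simp
    qed
    have lt: "u x 1 < w1 x \<and> v x 1 < z1 x" if x: "x \<in> \<Omega>" for x
    proof -
      \<comment> \<open>The initial pairs are ordered but not identical, so one of the components is
        strictly ordered somewhere. Either alternative makes both components strict by time
        1.\<close>
      obtain x0 where x0: "x0 \<in> \<Omega>" "u x0 0 < w1 x0 \<or> v x0 0 < z1 x0"
        using ii u_initial S.u_initial by (force simp: pair_eq_def pair_le_def)
      from x0(2) show ?thesis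
      proof
        assume h: "u x0 0 < w1 x0"
        show ?thesis using strictly_below_persists[OF E1 ple x0(1) h _ x, of 1]
            S.strictly_below_transfers[OF E1' ple' x0(1) h x, of 1] by simp
      next
        assume h: "v x0 0 < z1 x0"
        show ?thesis using S.strictly_below_persists[OF E1' ple' x0(1) h _ x, of 1]
            strictly_below_transfers[OF E1 ple x0(1) h x, of 1] by simp
      qed
    qed
    obtain A1 where A1: "0 < A1" "\<And>x. x \<in> closure \<Omega> \<Longrightarrow> lam * \<alpha> x \<le> A1" using \<alpha>_bounded by blast
    obtain A2 where A2: "0 < A2" "\<And>x. x \<in> closure \<Omega> \<Longrightarrow> \<mu> * \<beta> x \<le> A2" using S.\<alpha>_bounded by blast
    define A where "A = max A1 A2"
    have A: "0 < A" using A1(1) by (simp add: A_def)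
    \<comment> \<open>Chosen so that \<open>A * \<epsilon>\<close> is exactly the share of the
      budget reserved for the convexity error.\<close>
    define \<epsilon> where "\<epsilon> = \<nu> * e / 4 / A"
    have \<epsilon>: "0 < \<epsilon>" "A * \<epsilon> = \<nu> * e / 4" using A \<nu> e by (auto simp: \<epsilon>_def)
    obtain m where m: "0 \<le> m" "m < 1" "\<And>x. x \<in> closure \<Omega> \<Longrightarrow> w1 x \<le> m" by (rule solution_E_less_one[OF E1]) blast
    obtain n where n: "0 \<le> n" "n < 1" "\<And>x. x \<in> closure \<Omega> \<Longrightarrow> z1 x \<le> n" by (rule S.solution_E_less_one[OF E1']) blast
    obtain cf where cf: "0 < cf"
      "\<And>z z1 s \<tau> P. 0 \<le> z \<Longrightarrow> z \<le> z1 \<Longrightarrow> z1 \<le> n \<Longrightarrow> 0 \<le> s \<Longrightarrow> s \<le> 1 \<Longrightarrow> 0 \<le> \<tau> \<Longrightarrow> \<tau> \<le> cf * (1 - s) \<Longrightarrow>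
        0 \<le> P \<Longrightarrow> P \<le> R \<Longrightarrow> z + s * (z1 - z) + \<tau> * P < 1 \<and>
        f (z + s * (z1 - z) + \<tau> * P) \<le> (1 - s) * f z + s * f z1 + \<tau> * (deriv01 f z * P) + \<tau> * \<epsilon>"
      using convex_combination_defect[OF nl_f n(1,2) less_imp_le[OF R] \<epsilon>(1)] by blast
    obtain cg where cg: "0 < cg"
      "\<And>z z1 s \<tau> P. 0 \<le> z \<Longrightarrow> z \<le> z1 \<Longrightarrow> z1 \<le> m \<Longrightarrow> 0 \<le> s \<Longrightarrow> s \<le> 1 \<Longrightarrow> 0 \<le> \<tau> \<Longrightarrow> \<tau> \<le> cg * (1 - s) \<Longrightarrow>
        0 \<le> P \<Longrightarrow> P \<le> R \<Longrightarrow> z + s * (z1 - z) + \<tau> * P < 1 \<and>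
        g (z + s * (z1 - z) + \<tau> * P) \<le> (1 - s) * g z + s * g z1 + \<tau> * (deriv01 g z * P) + \<tau> * \<epsilon>"
      using convex_combination_defect[OF nl_g m(1,2) less_imp_le[OF R] \<epsilon>(1)] by blast
    define c where "c = min cf cg"
    have cc: "\<tau> \<le> cf * (1 - s) \<and> \<tau> \<le> cg * (1 - s)" if "s \<le> 1" "\<tau> \<le> c * (1 - s)" for s \<tau>
    proof -
      have "c * (1 - s) \<le> cf * (1 - s)" "c * (1 - s) \<le> cg * (1 - s)"
        using that(1) by (auto simp: c_def intro!: mult_right_mono)
      then show ?thesis using that(2) by simp
    qed
    interpret interpolation \<Omega> f g \<alpha> \<beta> lam \<mu> u0 v0 u v w z w1 z1 \<Phi> \<Psi> e R \<nu> A \<epsilon> c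
    proof unfold_locales
      show "z x + s * (z1 x - z x) + \<tau> * \<Psi> x < 1 \<and> f (z x + s * (z1 x - z x) + \<tau> * \<Psi> x)
        \<le> (1 - s) * f (z x) + s * f (z1 x) + \<tau> * (deriv01 f (z x) * \<Psi> x) + \<tau> * \<epsilon>"
        if "x \<in> closure \<Omega>" "0 \<le> s" "s \<le> 1" "0 \<le> \<tau>" "\<tau> \<le> c * (1 - s)" for x s \<tau>
        by (rule cf(2)) (use that cc[OF that(3,5)] le[OF that(1)] n(3)[OF that(1)] \<Psi>e[OF that(1)] e
              S.solution_E_facts(2)[OF E' that(1)] in auto)
      show "w x + s * (w1 x - w x) + \<tau> * \<Phi> x < 1 \<and> g (w x + s * (w1 x - w x) + \<tau> * \<Phi> x)
        \<le> (1 - s) * g (w x) + s * g (w1 x) + \<tau> * (deriv01 g (w x) * \<Phi> x) + \<tau> * \<epsilon>"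
        if "x \<in> closure \<Omega>" "0 \<le> s" "s \<le> 1" "0 \<le> \<tau>" "\<tau> \<le> c * (1 - s)" for x s \<tau>
        by (rule cg(2)) (use that cc[OF that(3,5)] le[OF that(1)] m(3)[OF that(1)] \<Phi>e[OF that(1)] e
              solution_E_facts(2)[OF E that(1)] in auto)
      show "lam * \<alpha> x \<le> A \<and> \<mu> * \<beta> x \<le> A" if "x \<in> closure \<Omega>" for x
        using A1(2)[OF that] A2(2)[OF that] by (auto simp: A_def)
      show "0 < c" using cf(1) cg(1) by (simp add: c_def)
    qed (fact E E1 le e \<nu>(1) cont \<Phi>e \<Psi>e \<Phi> \<Psi> | use \<epsilon> in simp)+
    show ?thesis using upper_decay[OF lt] by metis
  qed
  then obtain C T where C: "0 \<le> C" and up: "\<And>x t. x \<in> closure \<Omega> \<Longrightarrow> T \<le> t \<Longrightarrow>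
     u x t - w x \<le> C * exp (- (\<nu> / 2) * t) \<and> v x t - z x \<le> C * exp (- (\<nu> / 2) * t)" by blast
  show ?thesis
  proof (rule exI[of _ "max C (R / e)"], rule exI[of _ "max 0 T"], intro conjI ballI allI impI)
    show "0 \<le> max C (R / e)" using C by simp
    fix x t assume x: "x \<in> \<Omega>" and t: "max 0 T \<le> t"
    define D where "D = exp (- (\<nu> / 2) * t)"
    have "C * D \<le> max C (R / e) * D" "R / e * D \<le> max C (R / e) * D"
      by (intro mult_right_mono; simp add: D_def)+
    then have "\<bar>u x t - w x\<bar> \<le> max C (R / e) * D \<and> \<bar>v x t - z x\<bar> \<le> max C (R / e) * D"
      using up[OF in_closure[OF x], of t] lower[OF in_closure[OF x], of t] t unfolding D_def[symmetric] by auto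
    then show "\<bar>u x t - w x\<bar> \<le> max C (R / e) * exp (- (3 / 8 * \<nu>1) * t)"
      "\<bar>v x t - z x\<bar> \<le> max C (R / e) * exp (- (3 / 8 * \<nu>1) * t)"
      unfolding D_def \<nu>2 by auto
  qed
qed

end

theorem theorem1p2:
  fixes \<Omega> :: "'a::euclidean_space set"
  assumes "smooth_bounded_domain \<Omega>"
    and "1 \<le> DIM('a)" and "DIM('a) \<le> 3"
  shows "\<exists>C\<^sub>0 :: ('a \<Rightarrow> real) \<Rightarrow> ('a \<Rightarrow> real) \<Rightarrow> ('a \<Rightarrow> real) \<Rightarrow> ('a \<Rightarrow> real) \<Rightarrow>
                 ('a \<Rightarrow> real) \<Rightarrow> ('a \<Rightarrow> real) \<Rightarrow> ('a \<Rightarrow> real) \<Rightarrow> ('a \<Rightarrow> real) \<Rightarrow> real.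
    \<forall>f g \<alpha> \<beta> lam \<mu> \<Gamma> lam_star \<mu>_star u0 v0 w z w1 z1 u v lam1 \<nu>1 \<phi>1 \<psi>1.
      nonlinearity f \<and> nonlinearity g \<and> weight \<Omega> \<alpha> \<and> weight \<Omega> \<beta> \<and>
      initial_datum \<Omega> u0 \<and> initial_datum \<Omega> v0 \<and>
      critical_curve (Lambda_set \<Omega> f g \<alpha> \<beta>) \<Gamma> lam_star \<mu>_star \<and>
      (lam, \<mu>) \<in> O1_set (Lambda_set \<Omega> f g \<alpha> \<beta>) \<Gamma> lam_star \<and>
      minimal_solution_E \<Omega> f g \<alpha> \<beta> lam \<mu> w z \<and>
      (pair_le \<Omega> u0 v0 w z \<or>
       solution_E \<Omega> f g \<alpha> \<beta> lam \<mu> w1 z1 \<and> \<not> pair_eq \<Omega> w1 z1 w z \<and>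
       pair_le \<Omega> u0 v0 w1 z1 \<and> \<not> pair_eq \<Omega> u0 v0 w1 z1) \<and>
      global_solution_P \<Omega> f g \<alpha> \<beta> lam \<mu> u0 v0 u v \<and>
      first_dirichlet_eigenvalue \<Omega> lam1 \<and>
      0 < \<nu>1 \<and> first_linearized_eigenvalue \<Omega> f g \<alpha> \<beta> lam \<mu> w z \<nu>1 \<and>
      linearized_eigenpair \<Omega> f g \<alpha> \<beta> lam \<mu> w z \<nu>1 \<phi>1 \<psi>1 \<and>
      (\<forall>x\<in>\<Omega>. 0 < \<phi>1 x \<and> 0 < \<psi>1 x)
      \<longrightarrow> (\<exists>T\<^sub>0>0. \<forall>t>T\<^sub>0.
            (L2_norm \<Omega> (\<lambda>x. u x t - w x))\<^sup>2 + (L2_norm \<Omega> (\<lambda>x. v x t - z x))\<^sup>2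
              \<le> C\<^sub>0 u0 v0 w z w1 z1 \<phi>1 \<psi>1 * exp (- min (2 * lam1) (\<nu>1 / 2) * t))"
proof (intro exI[of _ "\<lambda>_ _ _ _ _ _ _ _. 1"] allI impI, elim conjE)
  fix f g :: "real \<Rightarrow> real" and \<alpha> \<beta> :: "'a \<Rightarrow> real" and lam \<mu> :: real and \<Gamma> :: "real \<Rightarrow> real"
    and lam_star \<mu>_star :: real and u0 v0 w z w1 z1 :: "'a \<Rightarrow> real" and u v :: "'a \<Rightarrow> real \<Rightarrow> real"
    and lam1 \<nu>1 :: real and \<phi>1 \<psi>1 :: "'a \<Rightarrow> real"
  assume nl: "nonlinearity f" "nonlinearity g" and wt: "weight \<Omega> \<alpha>" "weight \<Omega> \<beta>"
    and O1: "(lam, \<mu>) \<in> O1_set (Lambda_set \<Omega> f g \<alpha> \<beta>) \<Gamma> lam_star"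
    and min: "minimal_solution_E \<Omega> f g \<alpha> \<beta> lam \<mu> w z"
    and ini: "pair_le \<Omega> u0 v0 w z \<or>
       solution_E \<Omega> f g \<alpha> \<beta> lam \<mu> w1 z1 \<and> \<not> pair_eq \<Omega> w1 z1 w z \<and>
       pair_le \<Omega> u0 v0 w1 z1 \<and> \<not> pair_eq \<Omega> u0 v0 w1 z1"
    and sol: "global_solution_P \<Omega> f g \<alpha> \<beta> lam \<mu> u0 v0 u v"
    and \<nu>1: "0 < \<nu>1" and ev: "linearized_eigenpair \<Omega> f g \<alpha> \<beta> lam \<mu> w z \<nu>1 \<phi>1 \<psi>1"
    and pos: "\<forall>x\<in>\<Omega>. 0 < \<phi>1 x \<and> 0 < \<psi>1 x"
  have lm: "0 < lam" "0 < \<mu>" using O1 by (auto simp: O1_set_def Lambda_set_def)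
  interpret parabolic_problem \<Omega> f g \<alpha> \<beta> lam \<mu> u0 v0 u v
    by unfold_locales (fact assms(1) nl wt lm sol)+
  have ini': "pair_le \<Omega> u0 v0 w z \<or>
       solution_E \<Omega> f g \<alpha> \<beta> lam \<mu> w1 z1 \<and> pair_le \<Omega> u0 v0 w1 z1 \<and> \<not> pair_eq \<Omega> u0 v0 w1 z1"
    using ini by blast
  obtain C T where C: "0 \<le> C" and decay: "\<And>x t. x \<in> \<Omega> \<Longrightarrow> T \<le> t \<Longrightarrow>
     \<bar>u x t - w x\<bar> \<le> C * exp (- (3 / 8 * \<nu>1) * t) \<and> \<bar>v x t - z x\<bar> \<le> C * exp (- (3 / 8 * \<nu>1) * t)"
    using exponential_decay[OF min ini' \<nu>1 ev pos] by blast
  have "\<exists>T0>0. \<forall>t>T0. (L2_norm \<Omega> (\<lambda>x. u x t - w x))\<^sup>2 + (L2_norm \<Omega> (\<lambda>x. v x t - z x))\<^sup>2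
      \<le> exp (- (\<nu>1 / 2) * t)"
    by (rule L2_decay[OF open_\<Omega> bounded_\<Omega> C, of "3 / 8 * \<nu>1" _ T]) (use decay \<nu>1 in auto)
  then obtain T0 where T0: "0 < T0" "\<And>t. T0 < t \<Longrightarrow>
     (L2_norm \<Omega> (\<lambda>x. u x t - w x))\<^sup>2 + (L2_norm \<Omega> (\<lambda>x. v x t - z x))\<^sup>2 \<le> exp (- (\<nu>1 / 2) * t)" by blast
  \<comment> \<open>The minimum is at most \<open>\<nu>1 / 2\<close> and \<open>t\<close> is
    positive, so the claimed bound is the weaker one.\<close>
  have "exp (- (\<nu>1 / 2) * t) \<le> 1 * exp (- min (2 * lam1) (\<nu>1 / 2) * t)" if "T0 < t" for t
    using that T0(1) by (auto intro!: mult_right_mono)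
  then show "\<exists>T\<^sub>0>0. \<forall>t>T\<^sub>0.
      (L2_norm \<Omega> (\<lambda>x. u x t - w x))\<^sup>2 + (L2_norm \<Omega> (\<lambda>x. v x t - z x))\<^sup>2
        \<le> 1 * exp (- min (2 * lam1) (\<nu>1 / 2) * t)"
    using T0 by (meson order_trans)
qed

end
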